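(* Let $\mathcal{P}$ be a regular polytope and let $k<r$ be integers such that $\mathcal{P}$ has $k$-dimensional and $r$-dimensional faces. Let $H$ be the $(k,r)$-incidence graph of $\mathcal{P}$ and let $t$ be the number of vertices in the larger of the two parts of its bipartition. Then $\mathrm{ex}(n,H)=O(n^{2-c})$ as $n\to\infty$, where $c=\frac{v(H)-t-1}{e(H)-t}$.
   Context: For a graph $H$ and natural number $n$, $\mathrm{ex}(n,H)$ is the largest number of edges in an $n$-vertex graph containing no subgraph isomorphic to $H$. The $(k,r)$-incidence graph of a polytope $\mathcal{P}$ (with $k<r$) is the bipartite graph whose two parts are the set of all $k$-faces and the set of all $r$-faces of $\mathcal{P}$, where a $k$-face and an $r$-face are adjacent if and only if the $k$-face is contained in the $r$-face. $v(H)$ and $e(H)$ denote the numbers of vertices and edges of $H$. *)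

theory Defs
  imports "HOL-Analysis.Analysis" "HOL-Library.Landau_Symbols"
begin

text \<open>A (simple, undirected) graph is a pair of a vertex set and a set of two-element edges.\<close>

type_synonym 'a graph = "'a set \<times> 'a set set"

abbreviation verts :: "'a graph \<Rightarrow> 'a set" where
  "verts G \<equiv> fst G"

abbreviation edges :: "'a graph \<Rightarrow> 'a set set" where
  "edges G \<equiv> snd G"

definition simple_graph :: "'a graph \<Rightarrow> bool" where
  "simple_graph G \<longleftrightarrow> (\<forall>e\<in>edges G. e \<subseteq> verts G \<and> card e = 2)"

definition subgraph_of :: "'a graph \<Rightarrow> 'a graph \<Rightarrow> bool" where
  "subgraph_of K G \<longleftrightarrow> simple_graph K \<and> verts K \<subseteq> verts G \<and> edges K \<subseteq> edges G"

definition isomorphic_graphs :: "'a graph \<Rightarrow> 'b graph \<Rightarrow> bool" where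
  "isomorphic_graphs H K \<longleftrightarrow>
     (\<exists>f. bij_betw f (verts H) (verts K) \<and> (\<lambda>e. f ` e) ` edges H = edges K)"

definition contains_copy :: "'a graph \<Rightarrow> 'b graph \<Rightarrow> bool" where
  "contains_copy G H \<longleftrightarrow> (\<exists>K. subgraph_of K G \<and> isomorphic_graphs H K)"

text \<open>
  Every \<open>n\<close>-vertex graph is isomorphic to one whose vertices are natural numbers, so it
  suffices to range over those. The set is finite, and it is nonempty as soon as \<open>H\<close> has
  an edge.
\<close>

definition ex :: "nat \<Rightarrow> 'a graph \<Rightarrow> nat" where
  "ex n H = Max {card (edges G) | G :: nat graph.
     simple_graph G \<and> finite (verts G) \<and> card (verts G) = n \<and> \<not> contains_copy G H}"

definition faces_of_dim :: "'a::euclidean_space set \<Rightarrow> int \<Rightarrow> 'a set set" where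
  "faces_of_dim P k = {F. F face_of P \<and> aff_dim F = k}"

definition incidence_graph :: "'a::euclidean_space set \<Rightarrow> int \<Rightarrow> int \<Rightarrow> 'a set graph" where
  "incidence_graph P k r =
     (faces_of_dim P k \<union> faces_of_dim P r,
      {{F, G} | F G. F \<in> faces_of_dim P k \<and> G \<in> faces_of_dim P r \<and> F \<subseteq> G})"

text \<open>
  The faces include the empty face and \<open>P\<close> itself; these belong to every flag, so they do not
  affect the notion of regularity.
\<close>

definition flag :: "'a::euclidean_space set \<Rightarrow> 'a set set \<Rightarrow> bool" where
  "flag P C \<longleftrightarrow> subset.maxchain {F. F face_of P} C"

text \<open>
  An isometry of the affine hull of \<open>P\<close> extends to the whole space, so symmetries may be taken
  to be isometries of the ambient space even if \<open>P\<close> is not full-dimensional.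
\<close>

definition symmetry_of :: "'a::euclidean_space set \<Rightarrow> ('a \<Rightarrow> 'a) \<Rightarrow> bool" where
  "symmetry_of P f \<longleftrightarrow> (\<forall>x y. dist (f x) (f y) = dist x y) \<and> f ` P = P"

definition regular_polytope :: "'a::euclidean_space set \<Rightarrow> bool" where
  "regular_polytope P \<longleftrightarrow> polytope P \<and>
     (\<forall>C D. flag P C \<and> flag P D \<longrightarrow> (\<exists>f. symmetry_of P f \<and> (\<lambda>F. f ` F) ` C = D))"

end

theory Submission
  imports Defs
begin

text \<open>
  Let \<open>A\<close> and \<open>B\<close> be the parts of \<open>H\<close>. A symmetry of \<open>P\<close> that exchanges two adjacent flags is a
  reflection, and its mirror never separates two incident faces. By the Cauchy-Schwarz inequality
  homomorphism counts can therefore be folded along the mirror: a count with extra conditions on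
  one side is at most the geometric mean of the two counts in which the conditions on one side
  are replaced by the mirror image of those on the other.

  Starting from a single edge of \<open>H\<close>, folds towards a chamber that contains it eventually reproduce
  all of \<open>H\<close>; this gives the Sidorenko bound \<open>hom(H, G) \<ge> m ^ v p ^ e\<close> for a host of density
  \<open>p\<close> on \<open>m\<close> vertices. Starting from the condition that two vertices of one part have the same image,
  the folds identify the whole part, hence
  \<open>N({u, v}) ^ (M + 1) \<le> hom(H, G) ^ M N(A)\<close> for some \<open>M\<close>, where \<open>N(S)\<close> counts the homomorphisms
  that are constant on \<open>S\<close>. If \<open>G\<close> contains no copy of \<open>H\<close>, then every homomorphism is
  degenerate, so \<open>hom(H, G)\<close> is at most a constant times \<open>N(A)\<close> or \<open>N(B)\<close>, and these count stars:
  they are at most \<open>m \<Delta> ^ t\<close> for a host of maximum degree \<open>\<Delta>\<close>. In a host with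
  \<open>\<Delta> = O(p m)\<close> the two bounds contradict each other once \<open>p\<close> is a large multiple of
  \<open>m powr (- c)\<close>, because \<open>v - c e = 1 + t - c t\<close>.
\<close>

section \<open>Folding a graph along a reflection\<close>

text \<open>Collapsing depends on the factor that each use of Cauchy-Schwarz discards. It is at most
  hom(H, G) only if the far half still meets the identified set; otherwise a factor
  \<open>card X\<close> is lost. This is why the flag is chosen with care and why a pair of vertices
  is carried along that meets both closed halves of every wall.

  Regularity only provides symmetries that permute the flags. One that fixes all faces of a flag but
  one acts as a reflection because the centres of these faces affinely span the polytope. All such
  statements are restricted to points of \<open>P\<close>, which need not be full-dimensional.

  The upper bound counts stars and is governed by the maximum degree, the lower bound only sees the
  average degree. The subgraph that maximises \<open>e(U) / |U|^(1 + \<epsilon>)\<close>, with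
  \<open>\<epsilon> = 1 - c\<close>, makes the two comparable. This needs \<open>c < 1\<close>,
  which follows from the biregularity of the incidence graph; for \<open>c \<le> 0\<close> the
  trivial bound suffices.\<close>

definition homs :: "'v set \<Rightarrow> 'x set \<Rightarrow> ('x \<times> 'x) set \<Rightarrow> ('v \<times> 'v) set \<Rightarrow> ('v \<Rightarrow> 'x) set" where
  "homs V X R E = {\<phi> \<in> V \<rightarrow>\<^sub>E X. \<forall>(a, b)\<in>E. (\<phi> a, \<phi> b) \<in> R}"

text \<open>For nonempty \<open>B\<close> this is the number of homomorphisms that are constant on \<open>B\<close>, but for
  \<open>B = {}\<close> it is \<open>card X\<close> times the number of all homomorphisms. This makes the fold inequality
  uniform in \<open>B\<close>.\<close>

definition hom_const ::
  "'v set \<Rightarrow> 'x set \<Rightarrow> ('x \<times> 'x) set \<Rightarrow> ('v \<times> 'v) set \<Rightarrow> 'v set \<Rightarrow> nat" where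
  "hom_const V X R E B = (\<Sum>w\<in>X. card {\<phi> \<in> homs V X R E. \<forall>b\<in>B. \<phi> b = w})"

text \<open>\<open>P\<close> is a closed half of \<open>V\<close>; the fixed points of \<open>\<sigma>\<close> are those of \<open>P \<inter> \<sigma> ` P\<close>.\<close>

definition cut :: "'v set \<Rightarrow> ('v \<times> 'v) set \<Rightarrow> ('v \<Rightarrow> 'v) \<Rightarrow> 'v set \<Rightarrow> bool" where
  "cut V E \<sigma> P \<longleftrightarrow> P \<subseteq> V \<and> E \<subseteq> V \<times> V \<and> (\<forall>a\<in>V. \<sigma> a \<in> V \<and> \<sigma> (\<sigma> a) = a) \<and>
     (\<forall>a\<in>V. a \<in> P \<or> \<sigma> a \<in> P) \<and> (\<forall>a\<in>P. \<sigma> a \<in> P \<longrightarrow> \<sigma> a = a) \<and>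
     (\<forall>(a, b)\<in>E. (\<sigma> a, \<sigma> b) \<in> E \<and> (a \<in> P \<and> b \<in> P \<or> \<sigma> a \<in> P \<and> \<sigma> b \<in> P))"

definition fold_map :: "('v \<Rightarrow> 'v) \<Rightarrow> 'v set \<Rightarrow> 'v \<Rightarrow> 'v" where
  "fold_map \<sigma> P a = (if a \<in> P then a else \<sigma> a)"

text \<open>For a fold onto \<open>P\<close> this is the part of \<open>D\<close> inside
  \<open>P\<close> together with its mirror image, that is, the edge set of the folded
  graph.\<close>

definition pull :: "('v \<times> 'v) set \<Rightarrow> ('v \<Rightarrow> 'v) \<Rightarrow> ('v \<times> 'v) set \<Rightarrow> ('v \<times> 'v) set" where
  "pull E \<pi> D = {(a, b) \<in> E. (\<pi> a, \<pi> b) \<in> D}"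

lemma cutD:
  assumes "cut V E \<sigma> P"
  shows "a \<in> V \<Longrightarrow> \<sigma> a \<in> V" "a \<in> V \<Longrightarrow> \<sigma> (\<sigma> a) = a" "a \<in> V \<Longrightarrow> a \<in> P \<or> \<sigma> a \<in> P"
    "a \<in> P \<Longrightarrow> \<sigma> a \<in> P \<Longrightarrow> \<sigma> a = a"
  using assms by (auto simp: cut_def)

section \<open>The Cauchy-Schwarz inequality of a cut\<close>

lemma finite_homs: "finite V \<Longrightarrow> finite X \<Longrightarrow> finite (homs V X R E)"
  by (rule finite_subset[OF _ finite_PiE[of V "\<lambda>_. X"]]) (auto simp: homs_def)

text \<open>Cauchy-Schwarz produces a fold onto each of the two halves, so both have to be
  cuts.\<close>

lemma cut_opposite:
  assumes "cut V E \<sigma> P"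
  shows "cut V E \<sigma> (\<sigma> ` P)"
  unfolding cut_def
proof (intro conjI ballI)
  have V: "\<And>a. a \<in> V \<Longrightarrow> \<sigma> a \<in> V \<and> \<sigma> (\<sigma> a) = a" and PV: "P \<subseteq> V"
    using assms by (auto simp: cut_def)
  have im: "a \<in> \<sigma> ` P \<longleftrightarrow> \<sigma> a \<in> P" if "a \<in> V" for a
    using that V PV by (metis (no_types, opaque_lifting) image_iff in_mono)
  show "\<sigma> ` P \<subseteq> V" using V PV by auto
  show "E \<subseteq> V \<times> V" using assms by (simp add: cut_def)
  fix a
  { assume "a \<in> V"
    then show "\<sigma> a \<in> V" "\<sigma> (\<sigma> a) = a" using V by auto
    show "a \<in> \<sigma> ` P \<or> \<sigma> a \<in> \<sigma> ` P"
      using im[OF \<open>a \<in> V\<close>] im[of "\<sigma> a"] V[OF \<open>a \<in> V\<close>] assms \<open>a \<in> V\<close> by (auto simp: cut_def) }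
  { assume a: "a \<in> \<sigma> ` P"
    then obtain b where b: "b \<in> P" "a = \<sigma> b" by auto
    then have "b \<in> V" using PV by auto
    then have "\<sigma> a = b" using V b by auto
    show "\<sigma> a \<in> \<sigma> ` P \<longrightarrow> \<sigma> a = a"
      using im[OF \<open>b \<in> V\<close>] \<open>\<sigma> a = b\<close> b assms by (auto simp: cut_def) }
next
  have V: "\<And>a. a \<in> V \<Longrightarrow> \<sigma> a \<in> V \<and> \<sigma> (\<sigma> a) = a" and PV: "P \<subseteq> V"
    using assms by (auto simp: cut_def)
  fix e assume e: "e \<in> E"
  obtain a b where ab: "e = (a, b)" by (cases e)
  have 1: "(\<sigma> a, \<sigma> b) \<in> E" "a \<in> P \<and> b \<in> P \<or> \<sigma> a \<in> P \<and> \<sigma> b \<in> P"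
    using assms e ab by (auto simp: cut_def)
  have "(\<sigma> (\<sigma> a), \<sigma> (\<sigma> b)) \<in> E" using 1(1) assms by (auto simp: cut_def)
  show "case e of (a, b) \<Rightarrow> (\<sigma> a, \<sigma> b) \<in> E \<and> (a \<in> \<sigma> ` P \<and> b \<in> \<sigma> ` P \<or> \<sigma> a \<in> \<sigma> ` P \<and> \<sigma> b \<in> \<sigma> ` P)"
  proof (cases "a \<in> P \<and> b \<in> P")
    case True then show ?thesis using 1 ab by auto
  next
    case False
    then have s: "\<sigma> a \<in> P" "\<sigma> b \<in> P" using 1 by auto
    have "a \<in> V \<and> b \<in> V"
      using e ab assms by (auto simp: cut_def)
    then have "a = \<sigma> (\<sigma> a)" "b = \<sigma> (\<sigma> b)" using V by auto
    then have "a \<in> \<sigma> ` P" "b \<in> \<sigma> ` P" using s by (metis imageI)+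
    then show ?thesis using 1 ab by auto
  qed
qed

text \<open>Restricting a map to the two halves makes the counts into an inner product indexed by the
  values on the common fixed points.\<close>

lemma card_glue:
  assumes "finite V" "finite X" "V = P \<union> Q"
    and S: "\<And>\<phi> \<psi>. (\<And>a. a \<in> P \<Longrightarrow> \<phi> a = \<psi> a) \<Longrightarrow> S \<phi> \<longleftrightarrow> S \<psi>"
    and T: "\<And>\<phi> \<psi>. (\<And>a. a \<in> Q \<Longrightarrow> \<phi> a = \<psi> a) \<Longrightarrow> T \<phi> \<longleftrightarrow> T \<psi>"
  shows "card {\<phi> \<in> V \<rightarrow>\<^sub>E X. S \<phi> \<and> T \<phi>} =
    (\<Sum>x\<in>P \<inter> Q \<rightarrow>\<^sub>E X. card {\<alpha> \<in> P \<rightarrow>\<^sub>E X. restrict \<alpha> (P \<inter> Q) = x \<and> S \<alpha>} *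
                        card {\<beta> \<in> Q \<rightarrow>\<^sub>E X. restrict \<beta> (P \<inter> Q) = x \<and> T \<beta>})"
proof -
  let ?F = "P \<inter> Q"
  let ?L = "\<lambda>x. {\<alpha> \<in> P \<rightarrow>\<^sub>E X. restrict \<alpha> ?F = x \<and> S \<alpha>}"
  let ?R = "\<lambda>x. {\<beta> \<in> Q \<rightarrow>\<^sub>E X. restrict \<beta> ?F = x \<and> T \<beta>}"
  let ?f = "\<lambda>\<phi>. (restrict \<phi> ?F, restrict \<phi> P, restrict \<phi> Q)"
  let ?g = "\<lambda>(x, \<alpha>, \<beta>). \<lambda>a. if a \<in> P then \<alpha> a else \<beta> a"
  have fin: "finite P" "finite Q" using assms(1,3) by auto
  have finL: "finite (?L x)" for x
    by (rule finite_subset[OF _ finite_PiE[of P "\<lambda>_. X"]]) (use fin assms(2) in auto)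
  have finR: "finite (?R x)" for x
    by (rule finite_subset[OF _ finite_PiE[of Q "\<lambda>_. X"]]) (use fin assms(2) in auto)
  have "bij_betw ?f {\<phi> \<in> V \<rightarrow>\<^sub>E X. S \<phi> \<and> T \<phi>} (SIGMA x:?F \<rightarrow>\<^sub>E X. ?L x \<times> ?R x)"
  proof (rule bij_betw_byWitness[where f' = ?g])
    show "\<forall>a\<in>{\<phi> \<in> V \<rightarrow>\<^sub>E X. S \<phi> \<and> T \<phi>}. ?g (?f a) = a"
    proof
      fix \<phi> assume "\<phi> \<in> {\<phi> \<in> V \<rightarrow>\<^sub>E X. S \<phi> \<and> T \<phi>}"
      then have p: "\<phi> \<in> V \<rightarrow>\<^sub>E X" by simp
      show "?g (?f \<phi>) = \<phi>"
        using PiE_arb[OF p] assms(3) by (auto simp: fun_eq_iff)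
    qed
    show "\<forall>a'\<in>SIGMA x:?F \<rightarrow>\<^sub>E X. ?L x \<times> ?R x. ?f (?g a') = a'"
    proof
      fix y assume "y \<in> (SIGMA x:?F \<rightarrow>\<^sub>E X. ?L x \<times> ?R x)"
      then obtain \<alpha> \<beta> where y: "y = (restrict \<alpha> ?F, \<alpha>, \<beta>)"
        and a: "\<alpha> \<in> P \<rightarrow>\<^sub>E X" "\<beta> \<in> Q \<rightarrow>\<^sub>E X" and eq: "restrict \<beta> ?F = restrict \<alpha> ?F"
        by blast
      have "\<beta> a = \<alpha> a" if "a \<in> P" "a \<in> Q" for a
        using fun_cong[OF eq, of a] that by auto
      then have "restrict (\<lambda>a. if a \<in> P then \<alpha> a else \<beta> a) ?F = restrict \<alpha> ?F \<and>
          restrict (\<lambda>a. if a \<in> P then \<alpha> a else \<beta> a) P = \<alpha> \<and>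
          restrict (\<lambda>a. if a \<in> P then \<alpha> a else \<beta> a) Q = \<beta>"
        using a by (auto simp: fun_eq_iff PiE_def extensional_def)
      then show "?f (?g y) = y" by (simp add: y)
    qed
    show "?f ` {\<phi> \<in> V \<rightarrow>\<^sub>E X. S \<phi> \<and> T \<phi>} \<subseteq> (SIGMA x:?F \<rightarrow>\<^sub>E X. ?L x \<times> ?R x)"
    proof (rule image_subsetI)
      fix \<phi> assume "\<phi> \<in> {\<phi> \<in> V \<rightarrow>\<^sub>E X. S \<phi> \<and> T \<phi>}"
      then have p: "\<phi> \<in> V \<rightarrow>\<^sub>E X" "S \<phi>" "T \<phi>" by auto
      have "S (restrict \<phi> P)" "T (restrict \<phi> Q)"
        using p S[of \<phi> "restrict \<phi> P"] T[of \<phi> "restrict \<phi> Q"] by auto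
      moreover have "restrict \<phi> P \<in> P \<rightarrow>\<^sub>E X" "restrict \<phi> Q \<in> Q \<rightarrow>\<^sub>E X" "restrict \<phi> ?F \<in> ?F \<rightarrow>\<^sub>E X"
        using p assms(3) by auto
      moreover have "restrict (restrict \<phi> P) ?F = restrict \<phi> ?F" "restrict (restrict \<phi> Q) ?F = restrict \<phi> ?F"
        by (auto simp: fun_eq_iff)
      ultimately show "?f \<phi> \<in> (SIGMA x:?F \<rightarrow>\<^sub>E X. ?L x \<times> ?R x)"
        by simp
    qed
    show "?g ` (SIGMA x:?F \<rightarrow>\<^sub>E X. ?L x \<times> ?R x) \<subseteq> {\<phi> \<in> V \<rightarrow>\<^sub>E X. S \<phi> \<and> T \<phi>}"
    proof (rule image_subsetI)
      fix y assume "y \<in> (SIGMA x:?F \<rightarrow>\<^sub>E X. ?L x \<times> ?R x)"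
      then obtain \<alpha> \<beta> where y: "y = (restrict \<alpha> ?F, \<alpha>, \<beta>)"
        and a: "\<alpha> \<in> P \<rightarrow>\<^sub>E X" "\<beta> \<in> Q \<rightarrow>\<^sub>E X" and eq: "restrict \<beta> ?F = restrict \<alpha> ?F"
        and ST: "S \<alpha>" "T \<beta>"
        by blast
      let ?h = "\<lambda>a. if a \<in> P then \<alpha> a else \<beta> a"
      have e: "\<beta> a = \<alpha> a" if "a \<in> P" "a \<in> Q" for a
        using fun_cong[OF eq, of a] that by auto
      have "S ?h" using ST S[of \<alpha> ?h] by auto
      moreover have "T ?h" using ST T[of \<beta> ?h] e by auto
      moreover have "?h \<in> V \<rightarrow>\<^sub>E X" using a assms(3) by (auto simp: PiE_def extensional_def)
      ultimately show "?g y \<in> {\<phi> \<in> V \<rightarrow>\<^sub>E X. S \<phi> \<and> T \<phi>}" by (simp add: y)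
    qed
  qed
  then have "card {\<phi> \<in> V \<rightarrow>\<^sub>E X. S \<phi> \<and> T \<phi>} = card (SIGMA x:?F \<rightarrow>\<^sub>E X. ?L x \<times> ?R x)"
    by (rule bij_betw_same_card)
  also have "\<dots> = (\<Sum>x\<in>?F \<rightarrow>\<^sub>E X. card (?L x \<times> ?R x))"
    using finL finR fin assms(2) by (intro card_SigmaI) (auto intro!: finite_PiE)
  finally show ?thesis by (simp add: card_cartesian_product)
qed

text \<open>Composition with \<open>\<sigma>\<close> carries maps on one half to maps on the other
  and keeps the values on the mirror, so a mirrored condition has the same count for each boundary
  value \<open>x\<close>.\<close>

lemma card_reflect:
  assumes "P \<subseteq> V" "\<And>a. a \<in> V \<Longrightarrow> \<sigma> a \<in> V \<and> \<sigma> (\<sigma> a) = a" "\<And>a. a \<in> F \<Longrightarrow> \<sigma> a = a" "F \<subseteq> P"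
    and S: "\<And>\<phi> \<psi>. (\<And>a. a \<in> P \<Longrightarrow> \<phi> a = \<psi> a) \<Longrightarrow> S \<phi> \<longleftrightarrow> S \<psi>"
  shows "card {\<beta> \<in> \<sigma> ` P \<rightarrow>\<^sub>E X. restrict \<beta> F = x \<and> S (\<beta> \<circ> \<sigma>)} =
         card {\<alpha> \<in> P \<rightarrow>\<^sub>E X. restrict \<alpha> F = x \<and> S \<alpha>}"
proof (rule bij_betw_same_card)
  let ?f = "\<lambda>\<beta>. restrict (\<beta> \<circ> \<sigma>) P"
  let ?g = "\<lambda>\<alpha>. restrict (\<alpha> \<circ> \<sigma>) (\<sigma> ` P)"
  have ss: "\<And>a. a \<in> P \<Longrightarrow> \<sigma> (\<sigma> a) = a" using assms by auto
  have Fs: "F \<subseteq> \<sigma> ` P" using assms(3,4) by (metis image_eqI subset_iff)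
  show "bij_betw ?f {\<beta> \<in> \<sigma> ` P \<rightarrow>\<^sub>E X. restrict \<beta> F = x \<and> S (\<beta> \<circ> \<sigma>)}
     {\<alpha> \<in> P \<rightarrow>\<^sub>E X. restrict \<alpha> F = x \<and> S \<alpha>}"
  proof (rule bij_betw_byWitness[where f' = ?g])
    show "\<forall>a\<in>{\<beta> \<in> \<sigma> ` P \<rightarrow>\<^sub>E X. restrict \<beta> F = x \<and> S (\<beta> \<circ> \<sigma>)}. ?g (?f a) = a"
      using ss by (auto simp: fun_eq_iff PiE_def extensional_def) 
    show "\<forall>a'\<in>{\<alpha> \<in> P \<rightarrow>\<^sub>E X. restrict \<alpha> F = x \<and> S \<alpha>}. ?f (?g a') = a'"
      using ss by (auto simp: fun_eq_iff PiE_def extensional_def)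
    show "?f ` {\<beta> \<in> \<sigma> ` P \<rightarrow>\<^sub>E X. restrict \<beta> F = x \<and> S (\<beta> \<circ> \<sigma>)} \<subseteq> {\<alpha> \<in> P \<rightarrow>\<^sub>E X. restrict \<alpha> F = x \<and> S \<alpha>}"
    proof clarify
      fix \<beta> assume b: "\<beta> \<in> \<sigma> ` P \<rightarrow>\<^sub>E X" "S (\<beta> \<circ> \<sigma>)" "x = restrict \<beta> F"
      have "S (?f \<beta>)" using b(2) S[of "\<beta> \<circ> \<sigma>" "?f \<beta>"] by auto
      moreover have "restrict (?f \<beta>) F = restrict \<beta> F"
        using assms(3,4) by (auto simp: fun_eq_iff)
      moreover have "?f \<beta> \<in> P \<rightarrow>\<^sub>E X" using b by auto
      ultimately show "?f \<beta> \<in> P \<rightarrow>\<^sub>E X \<and> restrict (?f \<beta>) F = restrict \<beta> F \<and> S (?f \<beta>)" by auto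
    qed
    show "?g ` {\<alpha> \<in> P \<rightarrow>\<^sub>E X. restrict \<alpha> F = x \<and> S \<alpha>} \<subseteq> {\<beta> \<in> \<sigma> ` P \<rightarrow>\<^sub>E X. restrict \<beta> F = x \<and> S (\<beta> \<circ> \<sigma>)}"
    proof clarify
      fix \<alpha> assume b: "\<alpha> \<in> P \<rightarrow>\<^sub>E X" "S \<alpha>" "x = restrict \<alpha> F"
      have "S (?g \<alpha> \<circ> \<sigma>)" using b(2) S[of \<alpha> "?g \<alpha> \<circ> \<sigma>"] ss by auto
      moreover have "restrict (?g \<alpha>) F = restrict \<alpha> F"
        using assms(3,4) Fs by (auto simp: fun_eq_iff)
      moreover have "?g \<alpha> \<in> \<sigma> ` P \<rightarrow>\<^sub>E X" using b ss by auto
      ultimately show "?g \<alpha> \<in> \<sigma> ` P \<rightarrow>\<^sub>E X \<and> restrict (?g \<alpha>) F = restrict \<alpha> F \<and> S (?g \<alpha> \<circ> \<sigma>)" by auto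
    qed
  qed
qed

text \<open>For fixed values on the mirror the two halves are independent, so the mixed count is the
  inner product of two vectors; mirroring the conditions of one half yields the squared norm of its
  vector.\<close>

lemma cut_Cauchy_Schwarz:
  assumes "cut V E \<sigma> P" "finite V" "finite X"
    and S: "\<And>w \<phi> \<psi>. (\<And>a. a \<in> P \<Longrightarrow> \<phi> a = \<psi> a) \<Longrightarrow> S w \<phi> \<longleftrightarrow> S w \<psi>"
    and T: "\<And>w \<phi> \<psi>. (\<And>a. a \<in> \<sigma> ` P \<Longrightarrow> \<phi> a = \<psi> a) \<Longrightarrow> T w \<phi> \<longleftrightarrow> T w \<psi>"
  shows "(\<Sum>w\<in>W. card {\<phi> \<in> V \<rightarrow>\<^sub>E X. S w \<phi> \<and> T w \<phi>})\<^sup>2 \<le>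
    (\<Sum>w\<in>W. card {\<phi> \<in> V \<rightarrow>\<^sub>E X. S w \<phi> \<and> S w (\<phi> \<circ> \<sigma>)}) *
    (\<Sum>w\<in>W. card {\<phi> \<in> V \<rightarrow>\<^sub>E X. T w \<phi> \<and> T w (\<phi> \<circ> \<sigma>)})"
proof -
  let ?Q = "\<sigma> ` P"
  let ?F = "P \<inter> ?Q"
  let ?l = "\<lambda>w x. card {\<alpha> \<in> P \<rightarrow>\<^sub>E X. restrict \<alpha> ?F = x \<and> S w \<alpha>}"
  let ?r = "\<lambda>w x. card {\<beta> \<in> ?Q \<rightarrow>\<^sub>E X. restrict \<beta> ?F = x \<and> T w \<beta>}"
  have V: "\<And>a. a \<in> V \<Longrightarrow> \<sigma> a \<in> V \<and> \<sigma> (\<sigma> a) = a" and PV: "P \<subseteq> V"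
    using assms(1) by (auto simp: cut_def)
  have QV: "?Q \<subseteq> V" using V PV by auto
  have VPQ: "V = P \<union> ?Q" and fixF: "\<And>a. a \<in> ?F \<Longrightarrow> \<sigma> a = a" 
  proof -
    show "V = P \<union> ?Q"
    proof
      show "V \<subseteq> P \<union> ?Q"
      proof
        fix a assume "a \<in> V"
        then show "a \<in> P \<union> ?Q"
          using assms(1) V by (metis UnCI cut_def image_eqI)
      qed
    qed (use PV QV in auto)
    fix a assume a: "a \<in> ?F"
    then obtain b where "b \<in> P" "a = \<sigma> b" by auto
    then show "\<sigma> a = a" using a V PV assms(1)
      by (smt (verit) IntE cut_def subsetD)
  qed
  have QQ: "\<sigma> ` ?Q = P" using V PV by (auto simp: image_image subset_iff image_iff)
  have c1: "card {\<phi> \<in> V \<rightarrow>\<^sub>E X. S w \<phi> \<and> T w \<phi>} = (\<Sum>x\<in>?F \<rightarrow>\<^sub>E X. ?l w x * ?r w x)" for w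
    by (rule card_glue[OF assms(2,3) VPQ S T])
  have c2: "card {\<phi> \<in> V \<rightarrow>\<^sub>E X. S w \<phi> \<and> S w (\<phi> \<circ> \<sigma>)} = (\<Sum>x\<in>?F \<rightarrow>\<^sub>E X. ?l w x * ?l w x)" for w
  proof -
    have s: "card {\<beta> \<in> ?Q \<rightarrow>\<^sub>E X. restrict \<beta> ?F = x \<and> S w (\<beta> \<circ> \<sigma>)} = ?l w x" for x
      by (rule card_reflect[OF PV V fixF _ S]) auto
    have "card {\<phi> \<in> V \<rightarrow>\<^sub>E X. S w \<phi> \<and> S w (\<phi> \<circ> \<sigma>)} =
      (\<Sum>x\<in>?F \<rightarrow>\<^sub>E X. ?l w x * card {\<beta> \<in> ?Q \<rightarrow>\<^sub>E X. restrict \<beta> ?F = x \<and> S w (\<beta> \<circ> \<sigma>)})"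
      by (rule card_glue[OF assms(2,3) VPQ S]) (auto intro!: S)
    then show ?thesis by (simp only: s)
  qed
  have c3: "card {\<phi> \<in> V \<rightarrow>\<^sub>E X. T w \<phi> \<and> T w (\<phi> \<circ> \<sigma>)} = (\<Sum>x\<in>?F \<rightarrow>\<^sub>E X. ?r w x * ?r w x)" for w
  proof -
    have s: "card {\<beta> \<in> P \<rightarrow>\<^sub>E X. restrict \<beta> ?F = x \<and> T w (\<beta> \<circ> \<sigma>)} = ?r w x" for x
      using card_reflect[where P = ?Q and F = ?F and S = "T w" and x = x and X = X, OF QV V fixF _ T] 
      unfolding QQ by auto
    have "card {\<phi> \<in> V \<rightarrow>\<^sub>E X. T w (\<phi> \<circ> \<sigma>) \<and> T w \<phi>} =
      (\<Sum>x\<in>?F \<rightarrow>\<^sub>E X. card {\<beta> \<in> P \<rightarrow>\<^sub>E X. restrict \<beta> ?F = x \<and> T w (\<beta> \<circ> \<sigma>)} * ?r w x)"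
      by (rule card_glue[OF assms(2,3) VPQ _ T]) (auto intro!: T simp: V subsetD[OF PV])
    then show ?thesis unfolding s by (simp only: conj_commute)
  qed
  \<comment> \<open>\<open>w\<close> is treated as one more boundary value: it may tie the
    conditions on the two halves together, as the common image of a set that meets both halves
    does.\<close>
  let ?I = "W \<times> (?F \<rightarrow>\<^sub>E X)"
  have "(\<Sum>i\<in>?I. real (case_prod ?l i) * real (case_prod ?r i))\<^sup>2 \<le>
      (\<Sum>i\<in>?I. (real (case_prod ?l i))\<^sup>2) * (\<Sum>i\<in>?I. (real (case_prod ?r i))\<^sup>2)"
    by (rule Cauchy_Schwarz_ineq_sum)
  then have "real ((\<Sum>i\<in>?I. case_prod ?l i * case_prod ?r i)\<^sup>2) \<le>
      real ((\<Sum>i\<in>?I. case_prod ?l i * case_prod ?l i) * (\<Sum>i\<in>?I. case_prod ?r i * case_prod ?r i))"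
    by (simp add: power2_eq_square)
  then have "(\<Sum>i\<in>?I. case_prod ?l i * case_prod ?r i)\<^sup>2 \<le>
      (\<Sum>i\<in>?I. case_prod ?l i * case_prod ?l i) * (\<Sum>i\<in>?I. case_prod ?r i * case_prod ?r i)"
    by (simp only: of_nat_le_iff)
  then show ?thesis
    unfolding c1 c2 c3 sum.cartesian_product by (simp add: case_prod_unfold)
qed

text \<open>Every edge of \<open>D\<close> lies in one half, so the conditions split into two
  one-sided ones. The two parts of \<open>B\<close> are linked only through the common value
  \<open>w\<close>, which is why \<open>hom_const\<close> is a sum over \<open>w\<close>.\<close>

lemma hom_const_fold:
  assumes c: "cut V E \<sigma> P" and fin: "finite V" "finite X" and D: "D \<subseteq> E" and B: "B \<subseteq> V"
  shows "(hom_const V X R D B)\<^sup>2 \<le>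
    hom_const V X R (pull E (fold_map \<sigma> P) D) {a \<in> V. fold_map \<sigma> P a \<in> B} *
    hom_const V X R (pull E (fold_map \<sigma> (\<sigma> ` P)) D) {a \<in> V. fold_map \<sigma> (\<sigma> ` P) a \<in> B}"
proof -
  define S where "S P w \<phi> \<longleftrightarrow> (\<forall>(a, b)\<in>D. a \<in> P \<and> b \<in> P \<longrightarrow> (\<phi> a, \<phi> b) \<in> R) \<and>
    (\<forall>b\<in>B. b \<in> P \<longrightarrow> \<phi> b = w)" for P w and \<phi> :: "'a \<Rightarrow> 'b"
  have half: "S P w \<phi> \<and> S P w (\<phi> \<circ> \<sigma>) \<longleftrightarrow>
      (\<forall>(a, b)\<in>pull E (fold_map \<sigma> P) D. (\<phi> a, \<phi> b) \<in> R) \<and> (\<forall>b\<in>{a \<in> V. fold_map \<sigma> P a \<in> B}. \<phi> b = w)"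
    (is "_ \<longleftrightarrow> ?r") if c: "cut V E \<sigma> P" for P w and \<phi> :: "'a \<Rightarrow> 'b"
  proof
    have V: "\<And>a. a \<in> V \<Longrightarrow> \<sigma> a \<in> V \<and> \<sigma> (\<sigma> a) = a" "\<And>a. a \<in> V \<Longrightarrow> a \<in> P \<or> \<sigma> a \<in> P"
      "\<And>a. a \<in> P \<Longrightarrow> \<sigma> a \<in> P \<Longrightarrow> \<sigma> a = a" "P \<subseteq> V" "E \<subseteq> V \<times> V"
      and ED: "\<And>a b. (a, b) \<in> E \<Longrightarrow> (\<sigma> a, \<sigma> b) \<in> E \<and> (a \<in> P \<and> b \<in> P \<or> \<sigma> a \<in> P \<and> \<sigma> b \<in> P)"
      using c by (auto simp: cut_def)
    { assume s: "S P w \<phi> \<and> S P w (\<phi> \<circ> \<sigma>)"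
      show ?r
      proof (intro conjI ballI)
        fix e assume "e \<in> pull E (fold_map \<sigma> P) D"
        then obtain a b where e: "e = (a, b)" "(a, b) \<in> E" "(fold_map \<sigma> P a, fold_map \<sigma> P b) \<in> D"
          by (auto simp: pull_def)
        have ab: "a \<in> V" "b \<in> V" using e(2) V(5) by auto
        show "case e of (a, b) \<Rightarrow> (\<phi> a, \<phi> b) \<in> R"
        proof (cases "a \<in> P \<and> b \<in> P")
          case True
          then show ?thesis using e s by (auto simp: fold_map_def S_def)
        next
          case False
          then have p: "\<sigma> a \<in> P" "\<sigma> b \<in> P" using ED[OF e(2)] by auto
          have "fold_map \<sigma> P a = \<sigma> a" "fold_map \<sigma> P b = \<sigma> b"
            using p V(3)[of a] V(3)[of b] by (auto simp: fold_map_def)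
          then have "(\<sigma> a, \<sigma> b) \<in> D" using e(3) by simp
          then have "(\<phi> (\<sigma> (\<sigma> a)), \<phi> (\<sigma> (\<sigma> b))) \<in> R" using s p by (auto simp: S_def)
          then show ?thesis using V(1) ab e by simp
        qed
      next
        fix b assume "b \<in> {a \<in> V. fold_map \<sigma> P a \<in> B}"
        then have b: "b \<in> V" "fold_map \<sigma> P b \<in> B" by auto
        show "\<phi> b = w"
        proof (cases "b \<in> P")
          case True then show ?thesis using b s by (auto simp: fold_map_def S_def)
        next
          case False
          then have "\<phi> (\<sigma> (\<sigma> b)) = w" using V(2)[OF b(1)] b s by (auto simp: fold_map_def S_def)
          then show ?thesis using V(1) b by simp
        qed
      qed }
    assume r: ?r
    have r1: "(\<phi> a, \<phi> b) \<in> R" if "(a, b) \<in> E" "(fold_map \<sigma> P a, fold_map \<sigma> P b) \<in> D" for a b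
      using r that by (auto simp: pull_def)
    have r2: "\<phi> b = w" if "b \<in> V" "fold_map \<sigma> P b \<in> B" for b
      using r that by auto
    have f: "fold_map \<sigma> P (\<sigma> a) = a" if "a \<in> P" for a
      using that V(1,3,4) by (auto simp: fold_map_def)
    have f': "fold_map \<sigma> P a = a" if "a \<in> P" for a
      using that by (auto simp: fold_map_def)
    show "S P w \<phi> \<and> S P w (\<phi> \<circ> \<sigma>)"
      unfolding S_def
    proof (intro conjI ballI impI)
      fix e assume e: "e \<in> D"
      obtain a b where ab: "e = (a, b)" by (cases e)
      have "(a, b) \<in> E" "(\<sigma> a, \<sigma> b) \<in> E" using e ab D ED by auto
      then show "case e of (a, b) \<Rightarrow> a \<in> P \<and> b \<in> P \<longrightarrow> (\<phi> a, \<phi> b) \<in> R"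
        "case e of (a, b) \<Rightarrow> a \<in> P \<and> b \<in> P \<longrightarrow> ((\<phi> \<circ> \<sigma>) a, (\<phi> \<circ> \<sigma>) b) \<in> R"
        using ab e r1[of a b] r1[of "\<sigma> a" "\<sigma> b"] by (auto simp: f f')
    next
      fix b assume b: "b \<in> B" "b \<in> P"
      then have "b \<in> V" "\<sigma> b \<in> V" using V by auto
      then show "\<phi> b = w" "(\<phi> \<circ> \<sigma>) b = w" 
        using b r2[of b] r2[of "\<sigma> b"] by (auto simp: f f')
    qed
  qed
  have EP: "a \<in> P \<and> b \<in> P \<or> a \<in> \<sigma> ` P \<and> b \<in> \<sigma> ` P" if "(a, b) \<in> D" for a b
  proof -
    have "(a, b) \<in> E" using that D by auto
    then have "a \<in> V" "b \<in> V" "a \<in> P \<and> b \<in> P \<or> \<sigma> a \<in> P \<and> \<sigma> b \<in> P" using c by (auto simp: cut_def)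
    moreover have "\<sigma> (\<sigma> a) = a" "\<sigma> (\<sigma> b) = b" using \<open>a \<in> V\<close> \<open>b \<in> V\<close> c by (auto simp: cut_def)
    ultimately show ?thesis by (metis imageI)
  qed
  have BP: "b \<in> P \<or> b \<in> \<sigma> ` P" if "b \<in> B" for b
  proof -
    have "b \<in> V" using that B by auto
    then have "b \<in> P \<or> \<sigma> b \<in> P" "\<sigma> (\<sigma> b) = b" using c by (auto simp: cut_def)
    then show ?thesis by (metis imageI)
  qed
  have whole: "(\<forall>(a, b)\<in>D. (\<phi> a, \<phi> b) \<in> R) \<and> (\<forall>b\<in>B. \<phi> b = w) \<longleftrightarrow> S P w \<phi> \<and> S (\<sigma> ` P) w \<phi>" for w and \<phi> :: "'a \<Rightarrow> 'b"
  proof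
    show "S P w \<phi> \<and> S (\<sigma> ` P) w \<phi>" if "(\<forall>(a, b)\<in>D. (\<phi> a, \<phi> b) \<in> R) \<and> (\<forall>b\<in>B. \<phi> b = w)"
      using that unfolding S_def by auto
  next
    assume r: "S P w \<phi> \<and> S (\<sigma> ` P) w \<phi>"
    have R: "(\<phi> a, \<phi> b) \<in> R" if "(a, b) \<in> D" "S Q w \<phi>" "a \<in> Q \<and> b \<in> Q" for a b Q
      using that unfolding S_def by blast
    have B: "\<phi> b = w" if "b \<in> B" "S Q w \<phi>" "b \<in> Q" for b Q
      using that unfolding S_def by blast
    have "(\<phi> a, \<phi> b) \<in> R" if "(a, b) \<in> D" for a b
      using R[OF that conjunct1[OF r]] R[OF that conjunct2[OF r]] EP[OF that] by argo
    moreover have "\<phi> b = w" if "b \<in> B" for b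
      using B[OF that conjunct1[OF r]] B[OF that conjunct2[OF r]] BP[OF that] by argo
    ultimately show "(\<forall>(a, b)\<in>D. (\<phi> a, \<phi> b) \<in> R) \<and> (\<forall>b\<in>B. \<phi> b = w)" by auto
  qed
  have "(\<Sum>w\<in>X. card {\<phi> \<in> V \<rightarrow>\<^sub>E X. S P w \<phi> \<and> S (\<sigma> ` P) w \<phi>})\<^sup>2 \<le>
    (\<Sum>w\<in>X. card {\<phi> \<in> V \<rightarrow>\<^sub>E X. S P w \<phi> \<and> S P w (\<phi> \<circ> \<sigma>)}) *
    (\<Sum>w\<in>X. card {\<phi> \<in> V \<rightarrow>\<^sub>E X. S (\<sigma> ` P) w \<phi> \<and> S (\<sigma> ` P) w (\<phi> \<circ> \<sigma>)})"
  proof (rule cut_Cauchy_Schwarz[OF c fin])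
    show "S Q w \<phi> \<longleftrightarrow> S Q w \<psi>" if "\<And>a. a \<in> Q \<Longrightarrow> \<phi> a = \<psi> a" for w Q and \<phi> \<psi> :: "'a \<Rightarrow> 'b"
      unfolding S_def by (intro arg_cong2[of _ _ _ _ "(\<and>)"] ball_cong refl) (auto simp: that)
    then show "S Q w \<phi> \<longleftrightarrow> S Q w \<psi>" if "\<And>a. a \<in> Q \<Longrightarrow> \<phi> a = \<psi> a" for w Q and \<phi> \<psi> :: "'a \<Rightarrow> 'b"
      using that .
  qed
  then show ?thesis
    unfolding half[OF c] half[OF cut_opposite[OF c]] whole[symmetric]
    by (simp add: hom_const_def homs_def conj_assoc)
qed

section \<open>Identifying a whole part by repeated folds\<close>

lemma hom_const_empty: "hom_const V X R E {} = card X * card (homs V X R E)"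
  by (simp add: hom_const_def)

lemma hom_const_antimono:
  assumes "finite V" "finite X" "B \<subseteq> C"
  shows "hom_const V X R E C \<le> hom_const V X R E B"
  unfolding hom_const_def
  by (intro sum_mono card_mono) (use assms finite_homs[of V X R E] in auto)

lemma hom_const_eq:
  assumes "finite V" "finite X" "b \<in> B" "B \<subseteq> V"
  shows "hom_const V X R E B = card {\<phi> \<in> homs V X R E. \<forall>c\<in>B. \<phi> c = \<phi> b}"
proof -
  have "{\<phi> \<in> homs V X R E. \<forall>c\<in>B. \<phi> c = \<phi> b} = (\<Union>w\<in>X. {\<phi> \<in> homs V X R E. \<forall>b\<in>B. \<phi> b = w})"
  proof (intro equalityI subsetI)
    fix \<phi> assume p: "\<phi> \<in> {\<phi> \<in> homs V X R E. \<forall>c\<in>B. \<phi> c = \<phi> b}"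
    then have "\<phi> \<in> homs V X R E" by blast
    then have "\<phi> b \<in> X" using assms(3,4) by (auto simp: homs_def)
    with p show "\<phi> \<in> (\<Union>w\<in>X. {\<phi> \<in> homs V X R E. \<forall>b\<in>B. \<phi> b = w})" by blast
  qed (use assms(3) in auto)
  moreover have "card (\<Union>w\<in>X. {\<phi> \<in> homs V X R E. \<forall>b\<in>B. \<phi> b = w}) =
      (\<Sum>w\<in>X. card {\<phi> \<in> homs V X R E. \<forall>b\<in>B. \<phi> b = w})"
    using assms finite_homs[OF assms(1,2), of R E] by (intro card_UN_disjoint) auto
  ultimately show ?thesis by (simp add: hom_const_def)
qed

text \<open>For \<open>B = {}\<close> this fails in general, because of the extra factor
  \<open>card X\<close>. A factor may therefore be discarded after a fold only if the far half meets
  \<open>B\<close>.\<close>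

lemma hom_const_le:
  assumes "finite V" "finite X" "b \<in> B" "B \<subseteq> V"
  shows "hom_const V X R E B \<le> card (homs V X R E)"
  unfolding hom_const_eq[OF assms] by (rule card_mono) (use assms finite_homs in auto)

text \<open>The ends of an edge share a half, so both are kept or both are reflected: a fold is an
  endomorphism of the whole graph.\<close>

lemma pull_full:
  assumes "cut V E \<sigma> P"
  shows "pull E (fold_map \<sigma> P) E = E"
proof -
  have "(fold_map \<sigma> P a, fold_map \<sigma> P b) \<in> E" if "(a, b) \<in> E" for a b
  proof -
    have "(\<sigma> a, \<sigma> b) \<in> E" "a \<in> P \<and> b \<in> P \<or> \<sigma> a \<in> P \<and> \<sigma> b \<in> P"
      and "a \<in> P \<Longrightarrow> \<sigma> a \<in> P \<Longrightarrow> \<sigma> a = a" "b \<in> P \<Longrightarrow> \<sigma> b \<in> P \<Longrightarrow> \<sigma> b = b"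
      using assms that by (auto simp: cut_def)
    then show ?thesis using that by (auto simp: fold_map_def)
  qed
  then show ?thesis by (auto simp: pull_def)
qed

text \<open>\<open>M\<close> must not depend on the host, so that the final constant does not
  either. Hosts have vertices in \<open>nat\<close> because a definition cannot quantify over
  types.\<close>

definition collapses :: "'v set \<Rightarrow> ('v \<times> 'v) set \<Rightarrow> 'v set \<Rightarrow> 'v set \<Rightarrow> bool" where
  "collapses V E A B \<longleftrightarrow> (\<exists>M. \<forall>(X::nat set) R. finite X \<longrightarrow>
     hom_const V X R E B ^ Suc M \<le> card (homs V X R E) ^ M * hom_const V X R E A)"

lemma collapses_superset:
  assumes "finite V" "A \<subseteq> B"
  shows "collapses V E A B"
  unfolding collapses_def using assms by (intro exI[of _ 0]) (simp add: hom_const_antimono)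

text \<open>Of the two factors in the fold inequality the one for the far half is at most the number
  of all homomorphisms, since \<open>y\<close> keeps its set nonempty; \<open>col\<close> takes care
  of the other.\<close>

lemma collapses_fold:
  assumes c: "cut V E \<sigma> P" and "finite V" "B \<subseteq> V" "x \<in> B" "x \<in> P" "y \<in> B" "\<sigma> y \<in> P"
    and col: "collapses V E A {a \<in> V. fold_map \<sigma> P a \<in> B}"
  shows "collapses V E A B"
proof -
  obtain M where M: "\<And>X R. finite (X::nat set) \<Longrightarrow>
     hom_const V X R E {a \<in> V. fold_map \<sigma> P a \<in> B} ^ Suc M \<le> card (homs V X R E) ^ M * hom_const V X R E A"
    using col unfolding collapses_def by blast
  have yV: "y \<in> V" "\<sigma> (\<sigma> y) = y" using assms by (auto simp: cut_def)
  then have yQ: "y \<in> \<sigma> ` P" using assms(7) by (metis imageI)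
  \<comment> \<open>The squared inequality raised to the power \<open>Suc M\<close> has the exponent
    \<open>2 * Suc M = Suc (2 * M + 1)\<close> on the left; on the right \<open>?h ^ Suc M\<close>
    joins the \<open>?h ^ M\<close> from \<open>col\<close>.\<close>
  have "hom_const V X R E B ^ Suc (2 * M + 1) \<le> card (homs V X R E) ^ (2 * M + 1) * hom_const V X R E A"
    if X: "finite X" for X :: "nat set" and R
  proof -
    let ?h = "card (homs V X R E)"
    let ?L = "hom_const V X R E {a \<in> V. fold_map \<sigma> P a \<in> B}"
    let ?R = "hom_const V X R E {a \<in> V. fold_map \<sigma> (\<sigma> ` P) a \<in> B}"
    have "?R \<le> ?h"
      by (rule hom_const_le[where b = y]) (use X assms yV yQ in \<open>auto simp: fold_map_def\<close>)
    moreover have "(hom_const V X R E B)\<^sup>2 \<le> ?L * ?R"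
      using hom_const_fold[OF c assms(2) X order_refl assms(3), of R]
      by (simp add: pull_full[OF c] pull_full[OF cut_opposite[OF c]])
    ultimately have "(hom_const V X R E B)\<^sup>2 \<le> ?L * ?h"
      by (meson le_trans mult_le_mono2)
    then have "((hom_const V X R E B)\<^sup>2) ^ Suc M \<le> (?L * ?h) ^ Suc M"
      by (rule power_mono) auto
    also have "\<dots> = ?L ^ Suc M * ?h ^ Suc M" by (rule power_mult_distrib)
    also have "\<dots> \<le> (?h ^ M * hom_const V X R E A) * ?h ^ Suc M"
      using M[OF X, of R] by (rule mult_le_mono1)
    also have "\<dots> = ?h ^ (2 * M + 1) * hom_const V X R E A"
      by (simp add: mult_2 power_add)
    finally have "((hom_const V X R E B)\<^sup>2) ^ Suc M \<le> ?h ^ (2 * M + 1) * hom_const V X R E A" .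
    moreover have "2 * Suc M = Suc (2 * M + 1)" by simp
    ultimately show ?thesis by (metis power_mult)
  qed
  then show ?thesis unfolding collapses_def by blast
qed

text \<open>Folding replaces sets by preimages, so the fold composed last is the first one to be
  applied to a vertex set or an edge set.\<close>

inductive fold_comp :: "(('v \<Rightarrow> 'v) \<times> 'v set) set \<Rightarrow> ('v \<Rightarrow> 'v) \<Rightarrow> bool" for K where
  id: "fold_comp K id"
| step: "fold_comp K \<Phi> \<Longrightarrow> (\<sigma>, P) \<in> K \<Longrightarrow> fold_comp K (fold_map \<sigma> P \<circ> \<Phi>)"

lemma fold_map_in: "cut V E \<sigma> P \<Longrightarrow> a \<in> V \<Longrightarrow> fold_map \<sigma> P a \<in> V"
  by (auto simp: fold_map_def cut_def)

lemma fold_comp_in: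
  assumes "fold_comp K \<Phi>" "\<And>\<sigma> P. (\<sigma>, P) \<in> K \<Longrightarrow> cut V E \<sigma> P" "a \<in> V"
  shows "\<Phi> a \<in> V"
  using assms by (induction) (auto intro: fold_map_in)

text \<open>The pair \<open>x\<close>, \<open>y\<close> survives every fold: \<open>x\<close> is on
  the near side, and \<open>y\<close> is there too or is the mirror image of \<open>x\<close>. The
  far side is met by \<open>x\<close> if \<open>x\<close> is on the mirror and by \<open>y\<close>
  otherwise.\<close>

lemma collapses_fold_comp:
  assumes "fold_comp K \<Phi>"
    and K: "\<And>\<sigma> P. (\<sigma>, P) \<in> K \<Longrightarrow> cut V E \<sigma> P \<and> x \<in> P \<and> (\<sigma> x = x \<and> y \<in> P \<or> \<sigma> x = y)"
    and "finite V" "B \<subseteq> V" "x \<in> B" "y \<in> B" "collapses V E A {a \<in> V. \<Phi> a \<in> B}"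
  shows "collapses V E A B"
  using assms(1,4-)
proof (induction arbitrary: B)
  case id
  then have "{a \<in> V. id a \<in> B} = B" by auto
  then show ?case using id by simp
next
  case (step \<Phi> \<sigma> P B)
  have k: "cut V E \<sigma> P" "x \<in> P" "\<sigma> x = x \<and> y \<in> P \<or> \<sigma> x = y" using K[OF step(2)] by auto
  let ?B = "{a \<in> V. fold_map \<sigma> P a \<in> B}"
  have xV: "x \<in> V" "y \<in> V" using step.prems by auto
  have sy: "\<sigma> x = y \<Longrightarrow> \<sigma> y = x" using k xV by (auto simp: cut_def)
  have inV: "\<Phi> a \<in> V" if "a \<in> V" for a
    using fold_comp_in[OF step(1) _ that] K by blast
  have "{a \<in> V. \<Phi> a \<in> ?B} = {a \<in> V. (fold_map \<sigma> P \<circ> \<Phi>) a \<in> B}"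
    using inV by auto
  then have "collapses V E A {a \<in> V. \<Phi> a \<in> ?B}" using step.prems by simp
  moreover have "x \<in> ?B" "y \<in> ?B" using k step.prems xV sy by (auto simp: fold_map_def)
  ultimately have "collapses V E A ?B" using step.IH[of ?B] by auto
  moreover have "\<exists>z\<in>B. \<sigma> z \<in> P" using k step.prems sy by metis
  ultimately show ?case
    using collapses_fold[OF k(1) assms(3), of B x] k step.prems by blast
qed

text \<open>One of the two folds keeps an edge and the other reflects it, and
  \<open>\<sigma>\<close> permutes \<open>E\<close>. So the two folds have on average as many edges
  as \<open>D\<close>, which makes a normalisation by the number of edges compatible with
  folding.\<close>

lemma card_pull:
  assumes c: "cut V E \<sigma> P" and D: "D \<subseteq> E" and "finite E"
  shows "card (pull E (fold_map \<sigma> P) D) + card (pull E (fold_map \<sigma> (\<sigma> ` P)) D) = 2 * card D"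
proof -
  let ?\<pi> = "map_prod (fold_map \<sigma> P) (fold_map \<sigma> P)"
  let ?\<pi>' = "map_prod (fold_map \<sigma> (\<sigma> ` P)) (fold_map \<sigma> (\<sigma> ` P))"
  let ?s = "map_prod \<sigma> \<sigma>"
  have V: "\<And>a. a \<in> V \<Longrightarrow> \<sigma> a \<in> V \<and> \<sigma> (\<sigma> a) = a" "\<And>a. a \<in> V \<Longrightarrow> a \<in> P \<or> \<sigma> a \<in> P"
      "\<And>a. a \<in> P \<Longrightarrow> \<sigma> a \<in> P \<Longrightarrow> \<sigma> a = a" "P \<subseteq> V" "E \<subseteq> V \<times> V"
      and ED: "\<And>a b. (a, b) \<in> E \<Longrightarrow> (\<sigma> a, \<sigma> b) \<in> E \<and> (a \<in> P \<and> b \<in> P \<or> \<sigma> a \<in> P \<and> \<sigma> b \<in> P)"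
    using c by (auto simp: cut_def)
  have im: "a \<in> \<sigma> ` P \<longleftrightarrow> \<sigma> a \<in> P" if "a \<in> V" for a
    using that V(1,4) by (metis (no_types, opaque_lifting) image_iff in_mono)
  have fd: "finite D" using D assms(3) finite_subset by blast
  have sE: "?s ` E = E"
  proof
    show "?s ` E \<subseteq> E" using ED by auto
    show "E \<subseteq> ?s ` E"
    proof
      fix e assume e: "e \<in> E"
      then have "?s e \<in> E" "?s (?s e) = e" using ED V(1,5) by auto
      then show "e \<in> ?s ` E" by (metis imageI)
    qed
  qed
  have inj: "inj_on ?s E"
    by (rule inj_on_inverseI[of _ ?s]) (use V in auto)
  have pt: "of_bool (?\<pi> e \<in> D) + of_bool (?\<pi>' e \<in> D) = of_bool (e \<in> D) + (of_bool (?s e \<in> D) :: nat)"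
    if e: "e \<in> E" for e
  proof -
    obtain a b where ab: "e = (a, b)" by (cases e)
    then have abV: "a \<in> V" "b \<in> V" using e V by auto
    show ?thesis
    proof (cases "a \<in> P \<and> b \<in> P")
      case True
      then have "?\<pi> e = e" "?\<pi>' e = ?s e"
        using ab abV im V(3)[of a] V(3)[of b] by (auto simp: fold_map_def)
      then show ?thesis by simp
    next
      case False
      then have "\<sigma> a \<in> P" "\<sigma> b \<in> P" using ED e ab by auto
      then have "?\<pi> e = ?s e" "?\<pi>' e = e"
        using ab abV im V(3)[of a] V(3)[of b] by (auto simp: fold_map_def)
      then show ?thesis by simp
    qed
  qed
  have cardsum: "card {e \<in> E. Q e} = (\<Sum>e\<in>E. of_bool (Q e))" for Q
    using assms(3) by (simp add: of_bool_def sum.If_cases Int_def)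
  have p: "pull E \<pi> D = {e \<in> E. map_prod \<pi> \<pi> e \<in> D}" for \<pi>
    by (auto simp: pull_def)
  have "card (pull E (fold_map \<sigma> P) D) + card (pull E (fold_map \<sigma> (\<sigma> ` P)) D) =
     (\<Sum>e\<in>E. of_bool (?\<pi> e \<in> D) + of_bool (?\<pi>' e \<in> D))"
    unfolding p cardsum sum.distrib ..
  also have "\<dots> = (\<Sum>e\<in>E. of_bool (e \<in> D)) + (\<Sum>e\<in>E. of_bool (?s e \<in> D))"
    by (simp add: pt sum.distrib)
  also have "(\<Sum>e\<in>E. of_bool (?s e \<in> D)) = (\<Sum>e\<in>?s ` E. of_bool (e \<in> D) :: nat)"
    by (simp add: sum.reindex[OF inj])
  also have "(\<Sum>e\<in>?s ` E. of_bool (e \<in> D) :: nat) = (\<Sum>e\<in>E. of_bool (e \<in> D))" by (simp only: sE)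
  also have "(\<Sum>e\<in>E. of_bool (e \<in> D)) = card D"
    unfolding cardsum[symmetric] using D by (intro arg_cong[of _ _ card]) auto
  finally show ?thesis by simp
qed

section \<open>A lower bound for the number of homomorphisms\<close>

lemma finite_arg_max:
  fixes f :: "'b \<Rightarrow> real"
  assumes "finite S" "S \<noteq> {}"
  obtains x where "x \<in> S" "\<And>y. y \<in> S \<Longrightarrow> f y \<le> f x"
proof -
  have "Max (f ` S) \<in> f ` S" using assms by (intro Max_in) auto
  then obtain x where "x \<in> S" "f x = Max (f ` S)" by auto
  then show ?thesis using that[of x] assms by simp
qed

lemma card_homs_fold:
  assumes "cut V E \<sigma> P" "finite V" "finite X" "X \<noteq> {}" "D \<subseteq> E"
  shows "(card (homs V X R D))\<^sup>2 \<le>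
    card (homs V X R (pull E (fold_map \<sigma> P) D)) * card (homs V X R (pull E (fold_map \<sigma> (\<sigma> ` P)) D))"
proof -
  have "(card X * card (homs V X R D))\<^sup>2 \<le>
    (card X * card (homs V X R (pull E (fold_map \<sigma> P) D))) *
    (card X * card (homs V X R (pull E (fold_map \<sigma> (\<sigma> ` P)) D)))"
    using hom_const_fold[OF assms(1-3,5), of "{}" R] by (simp add: hom_const_empty)
  then have "(card X)\<^sup>2 * (card (homs V X R D))\<^sup>2 \<le> (card X)\<^sup>2 *
    (card (homs V X R (pull E (fold_map \<sigma> P) D)) * card (homs V X R (pull E (fold_map \<sigma> (\<sigma> ` P)) D)))"
    by (simp add: power2_eq_square algebra_simps)
  moreover have "card X > 0" using assms by (simp add: card_gt_0_iff)
  ultimately show ?thesis by simp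
qed

lemma card_homs_single_edge:
  assumes "finite V" "finite X" "R \<subseteq> X \<times> X" "a \<in> V" "b \<in> V" "a \<noteq> b"
  shows "card (homs V X R {(a, b)}) = card R * card X ^ (card V - 2)"
proof -
  let ?P = "{a, b}" and ?Q = "V - {a, b}"
  have "card {\<phi> \<in> V \<rightarrow>\<^sub>E X. (\<phi> a, \<phi> b) \<in> R \<and> True} =
     (\<Sum>x\<in>?P \<inter> ?Q \<rightarrow>\<^sub>E X. card {\<alpha> \<in> ?P \<rightarrow>\<^sub>E X. restrict \<alpha> (?P \<inter> ?Q) = x \<and> (\<alpha> a, \<alpha> b) \<in> R} *
                        card {\<beta> \<in> ?Q \<rightarrow>\<^sub>E X. restrict \<beta> (?P \<inter> ?Q) = x \<and> True})"
    by (rule card_glue[OF assms(1,2)]) (use assms in auto)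
  also have "?P \<inter> ?Q = {}" by auto
  finally have "card (homs V X R {(a, b)}) = card {\<alpha> \<in> ?P \<rightarrow>\<^sub>E X. (\<alpha> a, \<alpha> b) \<in> R} * card (?Q \<rightarrow>\<^sub>E X)"
    by (simp add: homs_def restrict_def)
  moreover have "card (?Q \<rightarrow>\<^sub>E X) = card X ^ (card V - 2)"
    using assms by (simp add: card_PiE card_Diff_subset numeral_2_eq_2)
  moreover have "bij_betw (\<lambda>\<alpha>. (\<alpha> a, \<alpha> b)) {\<alpha> \<in> ?P \<rightarrow>\<^sub>E X. (\<alpha> a, \<alpha> b) \<in> R} R"
  proof (rule bij_betw_byWitness[where f' = "\<lambda>(x, y). restrict (\<lambda>c. if c = a then x else y) ?P"])
    show "\<forall>\<alpha>\<in>{\<alpha> \<in> ?P \<rightarrow>\<^sub>E X. (\<alpha> a, \<alpha> b) \<in> R}.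
       (case (\<alpha> a, \<alpha> b) of (x, y) \<Rightarrow> restrict (\<lambda>c. if c = a then x else y) ?P) = \<alpha>"
      by (auto simp: fun_eq_iff PiE_def extensional_def)
  qed (use assms in \<open>auto split: if_splits\<close>)
  ultimately show ?thesis by (simp add: bij_betw_same_card)
qed

lemma fold_map_edge:
  "cut V E \<sigma> P \<Longrightarrow> (a, b) \<in> E \<Longrightarrow> (fold_map \<sigma> P a, fold_map \<sigma> P b) \<in> E"
  using pull_full[of V E \<sigma> P] by (auto simp: pull_def)

lemma fold_comp_edge:
  assumes "fold_comp K \<Phi>" "\<And>\<sigma> P. (\<sigma>, P) \<in> K \<Longrightarrow> cut V E \<sigma> P" "(a, b) \<in> E"
  shows "(\<Phi> a, \<Phi> b) \<in> E"
  using assms by (induction) (auto intro: fold_map_edge)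

text \<open>Among all nonempty \<open>D \<subseteq> E\<close> consider those which maximise \<open>ln (h D / m ^ v) / card D\<close>, where
  \<open>h D\<close> counts the homomorphisms of \<open>D\<close>. By the inequality above both folds of a maximiser
  are maximisers, so \<open>E\<close> itself is one, while a single edge has the value \<open>ln (card R / m\<^sup>2)\<close>.\<close>

lemma homs_Sidorenko:
  assumes fin: "finite V" "finite X" and R: "R \<subseteq> X \<times> X" "R \<noteq> {}"
    and E: "E \<subseteq> A \<times> B" "A \<inter> B = {}" "A \<union> B \<subseteq> V" "E \<noteq> {}"
    and trans: "\<And>e. e \<in> E \<Longrightarrow> \<exists>K \<Phi>. fold_comp K \<Phi> \<and> (\<forall>(a, b)\<in>E. (\<Phi> a, \<Phi> b) = e) \<and>
       (\<forall>(\<sigma>, P)\<in>K. cut V E \<sigma> P \<and> fst e \<in> P \<and> snd e \<in> P)"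
  shows "(card R / (card X)\<^sup>2) ^ card E * real (card X) ^ card V \<le> card (homs V X R E)"
proof -
  let ?h = "\<lambda>D. real (card (homs V X R D))"
  let ?m = "real (card X)"
  define f where "f D = ln (?h D / ?m ^ card V)" for D
  have X: "X \<noteq> {}" and m: "?m > 0" using R fin by (auto simp: card_gt_0_iff)
  have EV: "E \<subseteq> V \<times> V" using E by blast
  then have finE: "finite E" using fin finite_subset by blast
  \<comment> \<open>For one pair of \<open>R\<close>, sending \<open>A\<close> to \<open>x\<close>
    and the rest to \<open>y\<close> is a homomorphism; so all logarithms below are of positive
    numbers.\<close>
  have pos: "?h D > 0" if D: "D \<subseteq> E" for D
  proof -
    obtain x y where xy: "(x, y) \<in> R" using R by auto
    have "restrict (\<lambda>a. if a \<in> A then x else y) V \<in> homs V X R D"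
      using xy R E D EV by (auto simp: homs_def)
    then show ?thesis using finite_homs[OF fin] by (auto simp: card_gt_0_iff)
  qed
  have f0: "f {} = 0" 
    using m fin by (simp add: f_def homs_def card_PiE)
  have "finite (Pow E - {{}})" "Pow E - {{}} \<noteq> {}" using finE E(4) by auto
  then obtain D where D: "D \<in> Pow E - {{}}" and
    Dmax: "\<And>D'. D' \<in> Pow E - {{}} \<Longrightarrow> f D' / card D' \<le> f D / card D"
    by (rule finite_arg_max[where f = "\<lambda>D. f D / card D"]) auto
  define \<mu> where "\<mu> = f D / card D"
  have cD: "card D' > 0" if "D' \<in> Pow E - {{}}" for D'
    using that finE finite_subset by (auto simp: card_gt_0_iff)
  have le: "f D' \<le> \<mu> * card D'" if "D' \<subseteq> E" for D'
  proof (cases "D' = {}")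
    case False
    then show ?thesis using Dmax[of D'] cD[of D'] that by (simp add: \<mu>_def field_simps)
  qed (use f0 in simp)
  \<comment> \<open>Maximality is stated without a quotient, so that an empty fold is no
    exception.\<close>
  have fold: "f (pull E (fold_map \<sigma> P) D') \<ge> \<mu> * card (pull E (fold_map \<sigma> P) D')"
    if c: "cut V E \<sigma> P" and D': "D' \<subseteq> E" "f D' \<ge> \<mu> * card D'" for \<sigma> P D'
  proof -
    let ?L = "pull E (fold_map \<sigma> P) D'" and ?R = "pull E (fold_map \<sigma> (\<sigma> ` P)) D'"
    have sub: "?L \<subseteq> E" "?R \<subseteq> E" by (auto simp: pull_def)
    have "real ((card (homs V X R D'))\<^sup>2) \<le> real (card (homs V X R ?L) * card (homs V X R ?R))"
      using card_homs_fold[OF c fin X D'(1), of R] of_nat_le_iff by blast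
    then have "(?h D' / ?m ^ card V) * (?h D' / ?m ^ card V) \<le> (?h ?L / ?m ^ card V) * (?h ?R / ?m ^ card V)"
      using m by (simp add: power2_eq_square divide_right_mono)
    then have "ln ((?h D' / ?m ^ card V) * (?h D' / ?m ^ card V)) \<le> ln ((?h ?L / ?m ^ card V) * (?h ?R / ?m ^ card V))"
      using pos[OF D'(1)] m by (intro ln_mono) auto
    then have "2 * f D' \<le> f ?L + f ?R"
      using pos[OF D'(1)] pos[OF sub(1)] pos[OF sub(2)] m
      unfolding f_def by (subst (asm) (1 2) ln_mult_pos) auto
    moreover have "f ?R \<le> \<mu> * card ?R" by (rule le[OF sub(2)])
    moreover have "real (card ?L) + real (card ?R) = 2 * real (card D')"
      using card_pull[OF c D'(1) finE] by linarith
    then have "\<mu> * card ?L + \<mu> * card ?R = 2 * (\<mu> * card D')"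
      by (metis distrib_left mult.left_commute)
    ultimately show ?thesis using D'(2) by linarith
  qed
  obtain e where e: "e \<in> D" "e \<in> E" using D by auto
  obtain K \<Phi> where \<Phi>: "fold_comp K \<Phi>" "\<forall>(a, b)\<in>E. (\<Phi> a, \<Phi> b) = e"
    and K: "\<And>\<sigma> P. (\<sigma>, P) \<in> K \<Longrightarrow> cut V E \<sigma> P"
    using trans[OF e(2)] by fast
  have all: "f (pull E \<Psi> D') \<ge> \<mu> * card (pull E \<Psi> D')" 
    if "fold_comp K \<Psi>" "D' \<subseteq> E" "f D' \<ge> \<mu> * card D'" for \<Psi> D'
    using that
  proof (induction arbitrary: D')
    case id
    have "pull E id D' = D'" using id by (auto simp: pull_def)
    then show ?case using id by (simp only:)
  next
    case (step \<Psi> \<sigma> P)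
    have "pull E (fold_map \<sigma> P \<circ> \<Psi>) D' = pull E \<Psi> (pull E (fold_map \<sigma> P) D')"
      using fold_comp_edge[OF step(1) K] by (auto simp: pull_def)
    moreover have "pull E (fold_map \<sigma> P) D' \<subseteq> E" by (auto simp: pull_def)
    ultimately show ?case using step.IH fold[OF K[OF step(2)] step.prems] by presburger
  qed
  have "f D \<ge> \<mu> * card D" using cD[OF D] by (simp add: \<mu>_def)
  moreover have "D \<subseteq> E" using D by auto
  \<comment> \<open>The composite sends every edge to \<open>e\<close>, which lies in
    \<open>D\<close>; so the folds enlarge \<open>D\<close> to all of \<open>E\<close>.\<close>
  moreover have "pull E \<Phi> D = E" using \<Phi>(2) e by (auto simp: pull_def)
  ultimately have fE: "f E \<ge> \<mu> * card E" using all[OF \<Phi>(1), of D] by presburger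
  obtain a b where ab: "(a, b) \<in> E" using E by auto
  have "a \<in> V" "b \<in> V" "a \<noteq> b" using ab E by auto
  then have v: "?h {(a, b)} / ?m ^ card V = card R / (card X)\<^sup>2"
  proof -
    have "card {a, b} \<le> card V" by (rule card_mono) (use \<open>a \<in> V\<close> \<open>b \<in> V\<close> fin in auto)
    then have "2 \<le> card V" using \<open>a \<noteq> b\<close> by simp
    then have "?m ^ card V = ?m ^ (card V - 2) * ?m ^ 2"
      by (metis le_add_diff_inverse2 power_add)
    then show ?thesis
      using card_homs_single_edge[OF fin R(1) \<open>a \<in> V\<close> \<open>b \<in> V\<close> \<open>a \<noteq> b\<close>] m by simp
  qed
  have cR: "card R > 0" using R fin finite_subset[of R "X \<times> X"] by (auto simp: card_gt_0_iff)
  have "ln (card R / (card X)\<^sup>2) \<le> \<mu>"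
    using le[of "{(a, b)}"] ab v by (simp add: f_def)
  then have "card E * ln (card R / (card X)\<^sup>2) \<le> card E * \<mu>"
    by (rule mult_left_mono) auto
  also have "\<dots> \<le> f E" using fE by (simp add: mult.commute)
  finally have "ln ((card R / (card X)\<^sup>2) ^ card E) \<le> ln (?h E / ?m ^ card V)"
    using cR m by (simp add: f_def ln_realpow)
  then have "(card R / (card X)\<^sup>2) ^ card E \<le> ?h E / ?m ^ card V"
    using cR m pos[of E] by (subst (asm) ln_le_cancel_iff) auto
  then show ?thesis using m by (simp add: pos_le_divide_eq)
qed

section \<open>Almost regular hosts\<close>

text \<open>Once all of \<open>C\<close> is mapped to \<open>w\<close>, each vertex of
  \<open>D\<close> has its image among the at most \<open>\<Delta>\<close> neighbours of
  \<open>w\<close>, and these images determine the map.\<close>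

lemma hom_const_star_le:
  fixes \<Delta> :: real
  assumes fin: "finite V" "finite X" and V: "V = C \<union> D"
    and nb: "\<And>\<phi> d. \<phi> \<in> homs V X R E \<Longrightarrow> d \<in> D \<Longrightarrow> \<exists>c\<in>C. \<phi> d \<in> N (\<phi> c)"
    and deg: "\<And>w. w \<in> X \<Longrightarrow> finite (N w) \<and> card (N w) \<le> \<Delta>"
  shows "hom_const V X R E C \<le> card X * \<Delta> ^ card D"
proof -
  have fD: "finite D" using fin V by auto
  have "real (card {\<phi> \<in> homs V X R E. \<forall>c\<in>C. \<phi> c = w}) \<le> \<Delta> ^ card D" if w: "w \<in> X" for w
  proof -
    let ?S = "{\<phi> \<in> homs V X R E. \<forall>c\<in>C. \<phi> c = w}"
    have "inj_on (\<lambda>\<phi>. restrict \<phi> D) ?S"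
    proof (rule inj_onI)
      fix \<phi> \<psi> assume p: "\<phi> \<in> ?S" "\<psi> \<in> ?S" and eq: "restrict \<phi> D = restrict \<psi> D"
      have ext: "\<phi> \<in> V \<rightarrow>\<^sub>E X" "\<psi> \<in> V \<rightarrow>\<^sub>E X" using p by (auto simp: homs_def)
      show "\<phi> = \<psi>"
      proof
        fix a
        show "\<phi> a = \<psi> a"
        proof (cases "a \<in> D")
          case True then show ?thesis using fun_cong[OF eq, of a] by simp
        next
          case False
          then show ?thesis
            using p ext V PiE_arb[OF ext(1), of a] PiE_arb[OF ext(2), of a] by (cases "a \<in> C") auto
        qed
      qed
    qed
    moreover have "(\<lambda>\<phi>. restrict \<phi> D) ` ?S \<subseteq> D \<rightarrow>\<^sub>E N w"
      using nb by fastforce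
    moreover have "finite (D \<rightarrow>\<^sub>E N w)" using fD deg[OF w] by (intro finite_PiE) auto
    ultimately have "card ?S \<le> card (D \<rightarrow>\<^sub>E N w)" by (rule card_inj_on_le)
    also have "\<dots> = card (N w) ^ card D" using fD by (simp add: card_PiE)
    finally have "card ?S \<le> card (N w) ^ card D" .
    then have "real (card ?S) \<le> real (card (N w) ^ card D)" by (simp only: of_nat_le_iff)
    also have "\<dots> = real (card (N w)) ^ card D" by simp
    also have "\<dots> \<le> \<Delta> ^ card D" using deg[OF w] by (intro power_mono) auto
    finally show ?thesis .
  qed
  then have "(\<Sum>w\<in>X. real (card {\<phi> \<in> homs V X R E. \<forall>c\<in>C. \<phi> c = w})) \<le> (\<Sum>w\<in>X. \<Delta> ^ card D)"
    by (rule sum_mono)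
  then show ?thesis by (simp add: hom_const_def)
qed

text \<open>Disjoint domain and range make the host bipartite, so that a degenerate homomorphism
  identifies two vertices of the same part. \<open>1 \<le> \<Delta>\<close> allows both star counts
  to be bounded with the exponent of the larger part.\<close>

definition bounded_host :: "nat set \<Rightarrow> (nat \<times> nat) set \<Rightarrow> real \<Rightarrow> bool" where
  "bounded_host X R \<Delta> \<longleftrightarrow> finite X \<and> R \<subseteq> X \<times> X \<and> Domain R \<inter> Range R = {} \<and> 1 \<le> \<Delta> \<and>
     (\<forall>w\<in>X. real (card (R `` {w})) \<le> \<Delta> \<and> real (card (R\<inverse> `` {w})) \<le> \<Delta>)"

text \<open>If all homomorphisms are degenerate, then one of the \<open>q\<close> pairs accounts for
  at least a fraction \<open>1 / q\<close> of them. Its collapse inequality gives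
  \<open>h ^ Suc M \<le> q ^ Suc M * h ^ M * N\<close>, where \<open>N\<close> counts the
  homomorphisms that are constant on a part, and \<open>h ^ M\<close> cancels.\<close>

lemma few_homs:
  assumes fin: "finite A" "finite B" and AB: "A \<inter> B = {}" and E: "E \<subseteq> A \<times> B"
    and cov: "fst ` E = A" "snd ` E = B" and t: "card A \<le> t" "card B \<le> t"
    and colA: "\<And>u v. u \<in> A \<Longrightarrow> v \<in> A \<Longrightarrow> u \<noteq> v \<Longrightarrow> collapses (A \<union> B) E A {u, v}"
    and colB: "\<And>u v. u \<in> B \<Longrightarrow> v \<in> B \<Longrightarrow> u \<noteq> v \<Longrightarrow> collapses (A \<union> B) E B {u, v}"
  obtains D :: real where "D > 0" and
    "\<forall>X R \<Delta>. bounded_host X R \<Delta> \<longrightarrow> (\<forall>\<phi>\<in>homs (A \<union> B) X R E. \<not> inj_on \<phi> (A \<union> B)) \<longrightarrow>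
       card (homs (A \<union> B) X R E) \<le> D * card X * \<Delta> ^ t"
proof -
  let ?V = "A \<union> B"
  let ?part = "\<lambda>u. if u \<in> A then A else B"
  define Pr where "Pr = {(u, v) \<in> ?V \<times> ?V. u \<noteq> v \<and> (u \<in> A \<longleftrightarrow> v \<in> A)}"
  have finV: "finite ?V" and finP: "finite Pr" 
    using fin by (auto simp: Pr_def intro: finite_subset[of _ "?V \<times> ?V"])
  have covA: "\<exists>b. (a, b) \<in> E" if "a \<in> A" for a
  proof -
    have "a \<in> fst ` E" using that cov(1) by simp
    then show ?thesis by auto
  qed
  have covB: "\<exists>a. (a, b) \<in> E" if "b \<in> B" for b
  proof -
    have "b \<in> snd ` E" using that cov(2) by simp
    then show ?thesis by auto
  qed
  have "\<forall>p\<in>Pr. \<exists>M. \<forall>(X::nat set) R. finite X \<longrightarrow>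
     hom_const ?V X R E {fst p, snd p} ^ Suc M \<le> card (homs ?V X R E) ^ M * hom_const ?V X R E (?part (fst p))"
    using colA colB unfolding collapses_def by (auto simp: Pr_def)
  from bchoice[OF this] obtain M where "\<forall>p\<in>Pr. \<forall>(X::nat set) R. finite X \<longrightarrow>
     hom_const ?V X R E {fst p, snd p} ^ Suc (M p) \<le> card (homs ?V X R E) ^ M p * hom_const ?V X R E (?part (fst p))" ..
  then have M: "\<And>p X R. p \<in> Pr \<Longrightarrow> finite (X::nat set) \<Longrightarrow>
     hom_const ?V X R E {fst p, snd p} ^ Suc (M p) \<le> card (homs ?V X R E) ^ M p * hom_const ?V X R E (?part (fst p))"
    by blast
  define q where "q = real (card Pr)"
  \<comment> \<open>Which pair dominates depends on the host; the sum over all pairs serves every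
    host, and the 1 keeps \<open>D\<close> positive if there is no pair.\<close>
  define D where "D = 1 + (\<Sum>p\<in>Pr. q ^ Suc (M p))"
  have "D > 0" unfolding D_def q_def by (intro add_pos_nonneg sum_nonneg) auto
  have bd: "card (homs ?V X R E) \<le> D * card X * \<Delta> ^ t"
    if b: "bounded_host X R \<Delta>" and inj: "\<And>\<phi>. \<phi> \<in> homs ?V X R E \<Longrightarrow> \<not> inj_on \<phi> ?V" for X R \<Delta>
  proof (cases "homs ?V X R E = {}")
    case True
    then show ?thesis using \<open>D > 0\<close> b by (simp add: bounded_host_def)
  next
    case False
    let ?h = "card (homs ?V X R E)"
    let ?N = "\<lambda>p. hom_const ?V X R E {fst p, snd p}"
    have X: "finite X" and \<Delta>: "\<Delta> \<ge> 1" and dis: "Domain R \<inter> Range R = {}" using b by (auto simp: bounded_host_def)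
    have h: "?h > 0" using False finite_homs[OF finV X] by (simp add: card_gt_0_iff)
    have ex: "\<exists>p\<in>Pr. \<phi> (fst p) = \<phi> (snd p)" if p: "\<phi> \<in> homs ?V X R E" for \<phi>
    proof -
      obtain u v where uv: "u \<in> ?V" "v \<in> ?V" "u \<noteq> v" "\<phi> u = \<phi> v"
        using inj[OF p] by (auto simp: inj_on_def)
      have dom: "\<phi> a \<in> Domain R" if "a \<in> A" for a
      proof -
        from covA[OF that] obtain b where "(a, b) \<in> E" ..
        then show ?thesis using p by (auto simp: homs_def)
      qed
      have ran: "\<phi> b \<in> Range R" if "b \<in> B" for b
      proof -
        from covB[OF that] obtain a where "(a, b) \<in> E" ..
        then show ?thesis using p by (auto simp: homs_def)
      qed
      have "u \<in> A \<longleftrightarrow> v \<in> A" using uv dom ran dis AB by (metis UnE disjoint_iff)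
      then have "(u, v) \<in> Pr" using uv by (simp add: Pr_def)
      moreover have "\<phi> (fst (u, v)) = \<phi> (snd (u, v))" using uv by simp
      ultimately show ?thesis by blast
    qed
    have hN: "card {\<phi> \<in> homs ?V X R E. \<phi> (fst p) = \<phi> (snd p)} \<le> ?N p" if "p \<in> Pr" for p
    proof -
      have "?N p = card {\<phi> \<in> homs ?V X R E. \<forall>c\<in>{fst p, snd p}. \<phi> c = \<phi> (snd p)}"
        by (rule hom_const_eq[OF finV X]) (use that in \<open>auto simp: Pr_def\<close>)
      then show ?thesis by simp
    qed
    have "homs ?V X R E = (\<Union>p\<in>Pr. {\<phi> \<in> homs ?V X R E. \<phi> (fst p) = \<phi> (snd p)})"
    proof (intro equalityI subsetI)
      fix \<phi> assume p: "\<phi> \<in> homs ?V X R E"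
      obtain p where "p \<in> Pr" "\<phi> (fst p) = \<phi> (snd p)" using ex[OF p] ..
      then show "\<phi> \<in> (\<Union>p\<in>Pr. {\<phi> \<in> homs ?V X R E. \<phi> (fst p) = \<phi> (snd p)})"
        using p by (intro UN_I) auto
    qed auto
    then have "?h \<le> (\<Sum>p\<in>Pr. card {\<phi> \<in> homs ?V X R E. \<phi> (fst p) = \<phi> (snd p)})"
      using card_UN_le[OF finP, of "\<lambda>p. {\<phi> \<in> homs ?V X R E. \<phi> (fst p) = \<phi> (snd p)}"] by argo
    also have "\<dots> \<le> (\<Sum>p\<in>Pr. ?N p)" by (intro sum_mono hN)
    finally have hs: "?h \<le> (\<Sum>p\<in>Pr. ?N p)" .
    have "\<exists>p\<in>Pr. ?h \<le> q * ?N p"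
    proof (rule ccontr)
      assume "\<not> ?thesis"
      then have lt: "\<And>p. p \<in> Pr \<Longrightarrow> q * ?N p < ?h" by force
      have ne: "Pr \<noteq> {}"
      proof
        assume "Pr = {}"
        then have "?h \<le> 0" using hs by (simp only: sum.empty)
        then show False using h by simp
      qed
      have "(\<Sum>p\<in>Pr. q * ?N p) < (\<Sum>p\<in>Pr. real ?h)"
        by (rule sum_strict_mono[OF finP ne lt])
      then have "q * real (\<Sum>p\<in>Pr. ?N p) < q * ?h"
        by (simp add: q_def sum_distrib_left)
      then have "real (\<Sum>p\<in>Pr. ?N p) < ?h"
        by (rule mult_left_less_imp_less) (simp add: q_def)
      then show False using hs by linarith
    qed
    then obtain p where p: "p \<in> Pr" and hp: "?h \<le> q * ?N p" by blast
    let ?M = "M p"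
    have part: "hom_const ?V X R E (?part (fst p)) \<le> card X * \<Delta> ^ t"
    proof -
      have "hom_const ?V X R E A \<le> card X * \<Delta> ^ card B"
      proof (rule hom_const_star_le[OF finV X refl, where N = "\<lambda>w. R `` {w}"])
        fix \<phi> d assume a: "\<phi> \<in> homs ?V X R E" "d \<in> B"
        then obtain c where "(c, d) \<in> E" using covB by blast
        then show "\<exists>c\<in>A. \<phi> d \<in> R `` {\<phi> c}" using a E by (auto simp: homs_def)
      next
        fix w assume "w \<in> X"
        then show "finite (R `` {w}) \<and> card (R `` {w}) \<le> \<Delta>"
          using b by (auto simp: bounded_host_def intro: finite_subset[of _ X])
      qed
      moreover have "hom_const ?V X R E B \<le> card X * \<Delta> ^ card A"
      proof (rule hom_const_star_le[OF finV X, where N = "\<lambda>w. R\<inverse> `` {w}"])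
        fix \<phi> d assume a: "\<phi> \<in> homs ?V X R E" "d \<in> A"
        then obtain c where "(d, c) \<in> E" using covA by blast
        then show "\<exists>c\<in>B. \<phi> d \<in> R\<inverse> `` {\<phi> c}" using a E by (auto simp: homs_def)
      next
        fix w assume "w \<in> X"
        then show "finite (R\<inverse> `` {w}) \<and> card (R\<inverse> `` {w}) \<le> \<Delta>"
          using b by (auto simp: bounded_host_def intro: finite_subset[of _ X])
      qed auto
      moreover have "card X * \<Delta> ^ card A \<le> card X * \<Delta> ^ t" "card X * \<Delta> ^ card B \<le> card X * \<Delta> ^ t"
        using \<Delta> t by (auto intro!: mult_left_mono power_increasing)
      ultimately show ?thesis by auto
    qed
    have "real ?h ^ Suc ?M \<le> (q * ?N p) ^ Suc ?M"
      using hp by (intro power_mono) auto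
    also have "\<dots> = q ^ Suc ?M * real (?N p ^ Suc ?M)" by (simp add: power_mult_distrib)
    also have "\<dots> \<le> q ^ Suc ?M * real (?h ^ ?M * hom_const ?V X R E (?part (fst p)))"
      using M[OF p X, of R] by (intro mult_left_mono of_nat_mono) (auto simp: q_def)
    also have "\<dots> \<le> q ^ Suc ?M * (?h ^ ?M * (card X * \<Delta> ^ t))"
      using part by (simp add: mult_left_mono q_def)
    finally have "real ?h ^ ?M * ?h \<le> real ?h ^ ?M * (q ^ Suc ?M * (card X * \<Delta> ^ t))"
      by (simp add: mult_ac)
    then have "?h \<le> q ^ Suc ?M * (card X * \<Delta> ^ t)"
      using h by (simp add: mult_le_cancel_left)
    also have "\<dots> \<le> D * (card X * \<Delta> ^ t)"
    proof (rule mult_right_mono)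
      have "q ^ Suc ?M \<le> (\<Sum>p\<in>Pr. q ^ Suc (M p))"
        by (rule member_le_sum[OF p _ finP]) (simp add: q_def)
      then show "q ^ Suc ?M \<le> D" by (simp add: D_def)
    qed (use \<Delta> in simp)
    finally show ?thesis by (simp add: mult.assoc)
  qed
  show ?thesis
  proof (rule that[OF \<open>D > 0\<close>], intro allI impI)
    fix X R \<Delta>
    assume "bounded_host X R \<Delta>" "\<forall>\<phi>\<in>homs ?V X R E. \<not> inj_on \<phi> ?V"
    then show "card (homs ?V X R E) \<le> D * card X * \<Delta> ^ t" by (intro bd) blast+
  qed
qed

section \<open>Large bipartite subgraphs of bounded degree\<close>

lemma exists_large_cut:
  assumes "finite W" "finite F" "\<And>e. e \<in> F \<Longrightarrow> card e = 2"
  shows "\<exists>S\<subseteq>W. card {e \<in> F. e \<subseteq> W} \<le> 2 * card {e \<in> F. e \<subseteq> W \<and> card (e \<inter> S) = 1}"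
  using assms(1)
proof (induction W)
  case empty
  have "{e \<in> F. e \<subseteq> {}} = {}" using assms(3) by force
  then have "card {e \<in> F. e \<subseteq> {}} = 0" by (simp only: card.empty)
  then show ?case by (intro exI[of _ "{}"] conjI subset_refl) linarith
next
  case (insert x W)
  then obtain S where S: "S \<subseteq> W" and IH: "card {e \<in> F. e \<subseteq> W} \<le> 2 * card {e \<in> F. e \<subseteq> W \<and> card (e \<inter> S) = 1}"
    by auto
  let ?new = "{e \<in> F. e \<subseteq> insert x W \<and> x \<in> e}"
  have split: "card {e \<in> F. e \<subseteq> insert x W \<and> Q e} = card {e \<in> F. e \<subseteq> W \<and> Q e} + card {e \<in> ?new. Q e}" for Q
  proof -
    have "{e \<in> F. e \<subseteq> insert x W \<and> Q e} = {e \<in> F. e \<subseteq> W \<and> Q e} \<union> {e \<in> ?new. Q e}"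
      using insert(2) by auto
    moreover have "{e \<in> F. e \<subseteq> W \<and> Q e} \<inter> {e \<in> ?new. Q e} = {}" using insert(2) by auto
    ultimately show ?thesis using assms(2) by (simp add: card_Un_disjoint)
  qed
  have new: "card (e \<inter> S) = 1 \<longleftrightarrow> card (e \<inter> insert x S) \<noteq> 1" if e: "e \<in> ?new" for e
  proof -
    have "card e = 2" "x \<in> e" using e assms(3) by auto
    then obtain y where y: "e = {x, y}" "x \<noteq> y" by (metis card_2_iff doubleton_eq_iff insertE singletonD)
    have "x \<notin> S" using S insert(2) by auto
    then show ?thesis using y by (cases "y \<in> S") auto
  qed
  have old: "{e \<in> F. e \<subseteq> W \<and> card (e \<inter> insert x S) = 1} = {e \<in> F. e \<subseteq> W \<and> card (e \<inter> S) = 1}"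
  proof -
    have "e \<inter> insert x S = e \<inter> S" if "e \<subseteq> W" for e using that insert(2) by auto
    then show ?thesis by auto
  qed
  have "{e \<in> ?new. card (e \<inter> S) = 1} \<union> {e \<in> ?new. card (e \<inter> insert x S) = 1} = ?new"
    using new by blast
  then have "card ?new \<le> card {e \<in> ?new. card (e \<inter> S) = 1} + card {e \<in> ?new. card (e \<inter> insert x S) = 1}"
    by (metis (no_types, lifting) card_Un_le)
  \<comment> \<open>Greedy choice: the new vertex joins the side for which at least half of its
    edges to earlier vertices are cut.\<close>
  then consider "card ?new \<le> 2 * card {e \<in> ?new. card (e \<inter> S) = 1}" |
    "card ?new \<le> 2 * card {e \<in> ?new. card (e \<inter> insert x S) = 1}"
    by linarith
  then show ?case
  proof cases
    case 1
    then show ?thesis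
      using IH S split[of "\<lambda>e. True"] split[of "\<lambda>e. card (e \<inter> S) = 1"]
      by (intro exI[of _ S]) auto
  next
    case 2
    then show ?thesis
      using IH S split[of "\<lambda>e. True"] split[of "\<lambda>e. card (e \<inter> insert x S) = 1", unfolded old]
      by (intro exI[of _ "insert x S"]) auto
  qed
qed

lemma sum_degrees:
  assumes "finite U" "finite F" "\<And>e. e \<in> F \<Longrightarrow> e \<subseteq> U \<and> card e = 2"
  shows "(\<Sum>x\<in>U. card {e \<in> F. x \<in> e}) = 2 * card F"
proof -
  have "(\<Sum>x\<in>U. card {e \<in> F. x \<in> e}) = (\<Sum>x\<in>U. \<Sum>e\<in>F. of_bool (x \<in> e))"
    using assms(2) by (simp add: of_bool_def sum.If_cases Int_def)
  also have "\<dots> = (\<Sum>e\<in>F. \<Sum>x\<in>U. of_bool (x \<in> e))" by (rule sum.swap)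
  also have "\<dots> = (\<Sum>e\<in>F. card e)"
  proof (rule sum.cong[OF refl])
    fix e assume "e \<in> F"
    then have "{x \<in> U. x \<in> e} = e" using assms(3) by auto
    then show "(\<Sum>x\<in>U. of_bool (x \<in> e)) = card e"
      using assms(1) by (simp add: of_bool_def sum.If_cases Int_def)
  qed
  also have "\<dots> = 2 * card F" using assms(3) by simp
  finally show ?thesis .
qed

lemma equipartition:
  assumes "finite U" "K > 0" "K \<le> card U"
  obtains W where "U = (\<Union>j<K. W j)" "\<forall>j::nat. real (card (W j)) \<le> 2 * real (card U) / real K \<and> W j \<subseteq> U"
proof -
  obtain h where h: "bij_betw h U {0..<card U}" using assms(1) ex_bij_betw_finite_nat by blast
  \<comment> \<open>The parts are blocks of \<open>L\<close> consecutive indices. The 1 makes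
    \<open>K\<close> blocks suffice; since \<open>K \<le> card U\<close> it at most doubles the
    bound, hence the factor 2.\<close>
  define L where "L = card U div K + 1"
  define W where "W j = {x \<in> U. h x div L = j}" for j
  have KL: "card U < K * L"
    using assms(2) by (simp add: L_def) (metis add.commute dividend_less_times_div mult_Suc_right)
  have "U = (\<Union>j<K. W j)"
  proof -
    have "h x div L < K" if "x \<in> U" for x
    proof -
      have "h x < card U" using h that by (auto simp: bij_betw_def)
      then have "h x < K * L" using KL by simp
      then show ?thesis by (simp add: less_mult_imp_div_less)
    qed
    then show ?thesis by (auto simp: W_def)
  qed
  moreover have "real (card (W j)) \<le> 2 * real (card U) / real K" for j
  proof -
    have "h ` W j \<subseteq> {j * L..<j * L + L}"
    proof
      fix y assume "y \<in> h ` W j"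
      then have "y div L = j" by (auto simp: W_def)
      moreover have "L > 0" by (simp add: L_def)
      ultimately show "y \<in> {j * L..<j * L + L}"
        using dividend_less_div_times[of L y] by auto
    qed
    moreover have "inj_on h (W j)" using h by (auto simp: bij_betw_def W_def inj_on_def)
    ultimately have "card (W j) \<le> card {j * L..<j * L + L}" by (metis card_inj_on_le finite_atLeastLessThan)
    then have "real (card (W j)) \<le> L" by simp
    also have "real L = real (card U div K) + 1" by (simp add: L_def)
    also have "real (card U div K) \<le> card U / K" by (rule of_nat_div_le_of_nat)
    also have "1 \<le> card U / K" using assms(2,3) by simp
    finally show ?thesis by simp
  qed
  ultimately show ?thesis using that[of W] by (auto simp: W_def)
qed

text \<open>If \<open>U\<close> maximises \<open>e(U) / |U|^(1 + \<epsilon>)\<close>, then the few vertices of high degree meet at most half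
  of its edges: cut \<open>U\<close> into \<open>K\<close> parts and use the maximality for the union of each part with
  the set of these vertices.\<close>

lemma almost_regular_subgraph:
  fixes G :: "'a graph" and \<epsilon> :: real
  assumes G: "simple_graph G" "finite (verts G)" "verts G \<noteq> {}"
    and eps: "\<epsilon> > 0" and K: "K > 0" "3 powr (1 + \<epsilon>) * real K powr (- \<epsilon>) \<le> 1/2"
  obtains \<beta> U where "\<beta> \<ge> 0" "U \<subseteq> verts G" "U \<noteq> {}"
    "card (edges G) \<le> \<beta> * card (verts G) powr (1 + \<epsilon>)"
    "card {e \<in> edges G. e \<subseteq> U} = \<beta> * card U powr (1 + \<epsilon>)"
    "K \<le> card U \<longrightarrow> (\<exists>F\<subseteq>{e \<in> edges G. e \<subseteq> U}. \<beta> * card U powr (1 + \<epsilon>) \<le> 2 * real (card F) \<and>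
        (\<forall>x. card {e \<in> F. x \<in> e} \<le> 2 * real K * \<beta> * card U powr \<epsilon>))"
proof -
  let ?E = "\<lambda>U. {e \<in> edges G. e \<subseteq> U}"
  let ?r = "\<lambda>U. card (?E U) / card U powr (1 + \<epsilon>)"
  have "finite (Pow (verts G) - {{}})" "Pow (verts G) - {{}} \<noteq> {}" using G by auto
  then obtain U where U: "U \<in> Pow (verts G) - {{}}" and
    Umax: "\<And>W. W \<in> Pow (verts G) - {{}} \<Longrightarrow> ?r W \<le> ?r U"
    by (rule finite_arg_max[where f = ?r]) auto
  define \<beta> where "\<beta> = ?r U"
  have b0: "\<beta> \<ge> 0" by (simp add: \<beta>_def)
  have finE: "finite (edges G)" 
    by (rule finite_subset[of _ "Pow (verts G)"]) (use G in \<open>auto simp: simple_graph_def\<close>)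
  have finU: "finite U" using U G finite_subset by auto
  have pos: "card W > 0" if "W \<in> Pow (verts G) - {{}}" for W
    using that G finite_subset by (auto simp: card_gt_0_iff)
  have le: "card (?E W) \<le> \<beta> * card W powr (1 + \<epsilon>)" if "W \<subseteq> verts G" for W
  proof (cases "W = {}")
    case True
    then have "?E W = {}" using G by (auto simp: simple_graph_def)
    then have "card (?E W) = 0" by (simp only: card.empty)
    then show ?thesis using b0 by simp
  next
    case False
    then show ?thesis using Umax[of W] pos[of W] that by (simp add: \<beta>_def field_simps)
  qed
  have EG: "?E (verts G) = edges G" using G by (auto simp: simple_graph_def)
  have eU: "card (?E U) = \<beta> * card U powr (1 + \<epsilon>)" using pos[OF U] by (simp add: \<beta>_def)
  have reg: "\<exists>F\<subseteq>?E U. \<beta> * card U powr (1 + \<epsilon>) \<le> 2 * real (card F) \<and>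
        (\<forall>x. card {e \<in> F. x \<in> e} \<le> 2 * real K * \<beta> * card U powr \<epsilon>)" if KU: "K \<le> card U"
  proof (cases "\<beta> = 0")
    case True
    then show ?thesis by (intro exI[of _ "{}"]) simp
  next
    case False
    then have b: "\<beta> > 0" using b0 by simp
    let ?m = "real (card U)"
    have m: "?m > 0" using pos[OF U] by simp
    \<comment> \<open>\<open>K\<close> times the average degree of \<open>U\<close>, so at most
      \<open>card U / K\<close> vertices exceed it.\<close>
    define D where "D = 2 * real K * \<beta> * ?m powr \<epsilon>"
    have D: "D > 0" using b m K by (simp add: D_def)
    let ?d = "\<lambda>x. real (card {e \<in> ?E U. x \<in> e})"
    define V1 where "V1 = {x \<in> U. ?d x > D}"
    define F where "F = {e \<in> ?E U. e \<inter> V1 = {}}"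
    have finV1: "finite V1" using finU by (simp add: V1_def)
    have "card V1 * D = (\<Sum>x\<in>V1. D)" by simp
    also have "\<dots> \<le> (\<Sum>x\<in>V1. ?d x)" by (rule sum_mono) (simp add: V1_def)
    also have "\<dots> \<le> (\<Sum>x\<in>U. ?d x)" by (rule sum_mono2[OF finU]) (auto simp: V1_def)
    also have "\<dots> = real (2 * card (?E U))"
      unfolding of_nat_sum[symmetric]
      by (subst sum_degrees[OF finU]) (use finE G in \<open>auto simp: simple_graph_def\<close>)
    also have "\<dots> = 2 * \<beta> * ?m powr (1 + \<epsilon>)" using eU by simp
    also have "\<dots> = D * (?m / K)" using m K by (simp add: D_def powr_add)
    finally have "D * card V1 \<le> D * (?m / K)" by (simp add: mult.commute)
    then have V1: "card V1 \<le> ?m / K" using D by (rule mult_left_le_imp_le)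
    obtain W where W: "U = (\<Union>j<K. W j)" and W': "\<forall>j::nat. real (card (W j)) \<le> 2 * ?m / K \<and> W j \<subseteq> U"
      by (rule equipartition[OF finU K(1) KU])
    \<comment> \<open>A removed edge has one end in \<open>V1\<close>, and its other end lies in
      some part \<open>W j\<close>.\<close>
    have "?E U - F \<subseteq> (\<Union>j<K. ?E (V1 \<union> W j))"
    proof
      fix e assume e: "e \<in> ?E U - F"
      then obtain x where x: "x \<in> e" "x \<in> V1" by (auto simp: F_def)
      have "card e = 2" using e G by (auto simp: simple_graph_def)
      then obtain y where y: "e = {x, y}" using x(1) by (auto simp: card_2_iff)
      then have "y \<in> U" using e by auto
      then obtain j where "j < K" "y \<in> W j" using W by auto
      then show "e \<in> (\<Union>j<K. ?E (V1 \<union> W j))" using e x y by auto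
    qed
    then have "card (?E U - F) \<le> card (\<Union>j<K. ?E (V1 \<union> W j))"
      using finE by (intro card_mono) auto
    also have "\<dots> \<le> (\<Sum>j<K. card (?E (V1 \<union> W j)))" by (rule card_UN_le) simp
    finally have "real (card (?E U - F)) \<le> (\<Sum>j<K. real (card (?E (V1 \<union> W j))))"
      unfolding of_nat_sum[symmetric] of_nat_le_iff .
    \<comment> \<open>The 3 is 1 for \<open>V1\<close> and 2 for \<open>W j\<close>. Summing
      \<open>K\<close> such terms produces the factor
      \<open>3 powr (1 + \<epsilon>) * K powr (- \<epsilon>)\<close>, which is at most 1/2 by the
      assumption on \<open>K\<close>.\<close>
    also have "\<dots> \<le> (\<Sum>j<K. \<beta> * (3 * ?m / K) powr (1 + \<epsilon>))"
    proof (rule sum_mono)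
      fix j assume "j \<in> {..<K}"
      have "card (?E (V1 \<union> W j)) \<le> \<beta> * card (V1 \<union> W j) powr (1 + \<epsilon>)"
        by (rule le) (use U W' in \<open>auto simp: V1_def\<close>)
      also have "\<dots> \<le> \<beta> * (3 * ?m / K) powr (1 + \<epsilon>)"
      proof (intro mult_left_mono powr_mono2)
        have "real (card (V1 \<union> W j)) \<le> real (card V1) + real (card (W j))"
          using card_Un_le[of V1 "W j"] by linarith
        also have "\<dots> \<le> ?m / K + 2 * ?m / K" using V1 W'[rule_format, of j] by simp
        finally show "real (card (V1 \<union> W j)) \<le> 3 * ?m / K" by (simp add: add_divide_distrib[symmetric])
      qed (use eps b in auto)
      finally show "real (card (?E (V1 \<union> W j))) \<le> \<beta> * (3 * ?m / K) powr (1 + \<epsilon>)" .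
    qed
    also have "\<dots> = \<beta> * ?m powr (1 + \<epsilon>) * (3 powr (1 + \<epsilon>) * real K powr (- \<epsilon>))"
      using K m by (simp add: powr_mult powr_divide powr_add powr_minus field_simps)
    also have "\<dots> \<le> \<beta> * ?m powr (1 + \<epsilon>) * (1/2)"
      using K b by (intro mult_left_mono) auto
    finally have "2 * real (card (?E U - F)) \<le> card (?E U)" using eU by simp
    moreover have "card (?E U - F) = card (?E U) - card F"
      using finE by (intro card_Diff_subset) (auto simp: F_def)
    moreover have "card F \<le> card (?E U)" using finE by (intro card_mono) (auto simp: F_def)
    ultimately have "card (?E U) \<le> 2 * real (card F)" by linarith
    moreover have "card {e \<in> F. x \<in> e} \<le> D" for x
    proof (cases "{e \<in> F. x \<in> e} = {}")
      case True
      then have "card {e \<in> F. x \<in> e} = 0" by (simp only: card.empty)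
      then show ?thesis using D by simp
    next
      case False
      then have "x \<in> U" "x \<notin> V1" by (auto simp: F_def)
      then have "?d x \<le> D" by (auto simp: V1_def)
      moreover have "card {e \<in> F. x \<in> e} \<le> card {e \<in> ?E U. x \<in> e}"
        using finE by (intro card_mono) (auto simp: F_def)
      ultimately show ?thesis by linarith
    qed
    ultimately show ?thesis using eU unfolding D_def by (intro exI[of _ F]) (auto simp: F_def)
  qed
  have bd: "card (edges G) \<le> \<beta> * card (verts G) powr (1 + \<epsilon>)" using le[of "verts G"] EG by simp
  show ?thesis by (rule that[OF b0 _ _ bd eU impI[OF reg]]) (use U in auto)
qed

section \<open>The edge bound for graphs without a copy\<close>

lemma copy_of_hom:
  assumes "simple_graph G" "A \<inter> B = {}" "E \<subseteq> A \<times> B" "\<phi> \<in> homs (A \<union> B) X R E" "inj_on \<phi> (A \<union> B)"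
    "X \<subseteq> verts G" "\<And>x y. (x, y) \<in> R \<Longrightarrow> {x, y} \<in> edges G"
  shows "contains_copy G (A \<union> B, {{a, b} | a b. (a, b) \<in> E})"
proof -
  let ?V = "A \<union> B" and ?D = "{{a, b} | a b. (a, b) \<in> E}"
  let ?K = "(\<phi> ` ?V, (\<lambda>e. \<phi> ` e) ` ?D)"
  have V: "\<phi> ` ?V \<subseteq> verts G" using assms(4,6) by (auto simp: homs_def)
  have ed: "(\<lambda>e. \<phi> ` e) ` ?D \<subseteq> edges G"
  proof clarify
    fix a b assume "(a, b) \<in> E"
    then have "(\<phi> a, \<phi> b) \<in> R" using assms(4) by (auto simp: homs_def)
    then show "\<phi> ` {a, b} \<in> edges G" using assms(7) by simp
  qed
  have "e \<subseteq> \<phi> ` ?V" if "e \<in> (\<lambda>e. \<phi> ` e) ` ?D" for e using that assms(3) by auto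
  moreover have "card e = 2" if "e \<in> (\<lambda>e. \<phi> ` e) ` ?D" for e
    using subsetD[OF ed that] assms(1) by (simp add: simple_graph_def)
  ultimately have "simple_graph ?K" by (simp add: simple_graph_def)
  then have "subgraph_of ?K G" using V ed by (simp add: subgraph_of_def)
  moreover have "isomorphic_graphs (?V, ?D) ?K"
    unfolding isomorphic_graphs_def using assms(5) by (intro exI[of _ \<phi>]) (auto simp: bij_betw_def)
  ultimately show ?thesis unfolding contains_copy_def by blast
qed

text \<open>\<open>r\<close> stands for the number of edges of the bipartite host; the 4 is a 2 for
  removing high degrees times a 2 for the cut. By the choice of \<open>c\<close> the powers of
  \<open>m\<close> on the two sides of \<open>le\<close> are equal once \<open>r\<close> is replaced
  by its lower bound, so a bound on \<open>\<beta> ^ (e - t)\<close> is all that remains.\<close>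

lemma density_bound:
  fixes \<beta> m \<epsilon> c D K r :: real and e t v :: nat
  assumes "\<beta> \<ge> 1" "m \<ge> 1" "D > 0" "K > 0" and r: "\<beta> * m powr (1 + \<epsilon>) \<le> 4 * r"
    and le: "(r / m\<^sup>2) ^ e * m ^ v \<le> D * m * (2 * K * \<beta> * m powr \<epsilon>) ^ t"
    and c: "c = 1 - \<epsilon>" "c * (real e - real t) = real v - real t - 1" and et: "t < e"
  shows "\<beta> \<le> D * (2 * K) ^ t * 4 ^ e"
proof -
  have m: "m > 0" using assms by simp
  have "(\<beta> / 4) * m powr (\<epsilon> - 1) = (\<beta> * m powr (1 + \<epsilon>) / 4) / m\<^sup>2"
  proof -
    have "m powr (1 + \<epsilon>) = m powr (\<epsilon> - 1) * m powr 2" by (simp add: powr_add[symmetric])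
    then show ?thesis using m by (simp add: powr_numeral)
  qed
  also have "\<dots> \<le> r / m\<^sup>2" using r by (intro divide_right_mono) auto
  finally have "((\<beta> / 4) * m powr (\<epsilon> - 1)) ^ e * m ^ v \<le> (r / m\<^sup>2) ^ e * m ^ v"
    using assms m by (intro mult_right_mono power_mono) auto
  with le have "((\<beta> / 4) * m powr (\<epsilon> - 1)) ^ e * m ^ v \<le> D * m * (2 * K * \<beta> * m powr \<epsilon>) ^ t" by linarith
  moreover have "((\<beta> / 4) * m powr (\<epsilon> - 1)) ^ e * m ^ v = (\<beta> / 4) ^ e * m powr ((\<epsilon> - 1) * e + v)"
  proof -
    have "(m powr (\<epsilon> - 1)) ^ e = m powr ((\<epsilon> - 1) * e)"
      using m by (simp add: powr_realpow[symmetric] powr_powr)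
    then show ?thesis using m by (simp add: power_mult_distrib powr_add powr_realpow power_divide)
  qed
  moreover have "D * m * (2 * K * \<beta> * m powr \<epsilon>) ^ t = D * (2 * K) ^ t * \<beta> ^ t * m powr (1 + \<epsilon> * t)"
  proof -
    have "(m powr \<epsilon>) ^ t = m powr (\<epsilon> * t)" using m by (simp add: powr_realpow[symmetric] powr_powr)
    then show ?thesis using m by (simp add: power_mult_distrib powr_add)
  qed
  moreover have "(\<epsilon> - 1) * e + v = 1 + \<epsilon> * t"
  proof -
    have "(1 - \<epsilon>) * (real e - real t) = real v - real t - 1" using c by simp
    then show ?thesis by (simp add: algebra_simps)
  qed
  ultimately have "(\<beta> / 4) ^ e \<le> D * (2 * K) ^ t * \<beta> ^ t"
    using m by (simp add: mult_le_cancel_right)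
  then have "\<beta> ^ e \<le> D * (2 * K) ^ t * \<beta> ^ t * 4 ^ e" by (simp add: power_divide pos_divide_le_eq)
  moreover have "\<beta> ^ e = \<beta> ^ (e - t) * \<beta> ^ t" using et by (simp flip: power_add)
  ultimately have "\<beta> ^ (e - t) * \<beta> ^ t \<le> (D * (2 * K) ^ t * 4 ^ e) * \<beta> ^ t" by (simp add: mult_ac)
  then have "\<beta> ^ (e - t) \<le> D * (2 * K) ^ t * 4 ^ e" 
    by (rule mult_right_le_imp_le) (use assms in simp)
  moreover have "\<beta> ^ 1 \<le> \<beta> ^ (e - t)" using assms by (intro power_increasing) auto
  ultimately show ?thesis by simp
qed

lemma turan_upper:
  fixes c :: real
  assumes fin: "finite A" "finite B" and AB: "A \<inter> B = {}" and E: "E \<subseteq> A \<times> B"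
    and cov: "fst ` E = A" "snd ` E = B" and t: "t = max (card A) (card B)"
    and col: "\<And>u v. u \<in> A \<Longrightarrow> v \<in> A \<Longrightarrow> u \<noteq> v \<Longrightarrow> collapses (A \<union> B) E A {u, v}"
      "\<And>u v. u \<in> B \<Longrightarrow> v \<in> B \<Longrightarrow> u \<noteq> v \<Longrightarrow> collapses (A \<union> B) E B {u, v}"
    and sid: "\<And>X R. finite (X::nat set) \<Longrightarrow> R \<subseteq> X \<times> X \<Longrightarrow> R \<noteq> {} \<Longrightarrow>
      (card R / (card X)\<^sup>2) ^ card E * real (card X) ^ card (A \<union> B) \<le> card (homs (A \<union> B) X R E)"
    and c: "c < 1" "c * (real (card E) - real t) = real (card A + card B) - real t - 1" and et: "t < card E"
  obtains C :: real where "\<And>G :: nat graph. simple_graph G \<Longrightarrow> finite (verts G) \<Longrightarrow> verts G \<noteq> {} \<Longrightarrow>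
     \<not> contains_copy G (A \<union> B, {{a, b} | a b. (a, b) \<in> E}) \<Longrightarrow>
     card (edges G) \<le> C * card (verts G) powr (2 - c)"
proof -
  let ?V = "A \<union> B"
  let ?e = "card E" and ?v = "card ?V"
  define \<epsilon> where "\<epsilon> = 1 - c"
  have eps: "\<epsilon> > 0" "c = 1 - \<epsilon>" using c by (auto simp: \<epsilon>_def)
  have tA: "card A \<le> t" "card B \<le> t" using t by auto
  obtain D :: real where D: "D > 0" and few: "\<forall>X R (\<Delta> :: real). bounded_host X R \<Delta> \<longrightarrow>
      (\<forall>\<phi>\<in>homs ?V X R E. \<not> inj_on \<phi> ?V) \<longrightarrow>
       card (homs ?V X R E) \<le> D * card X * \<Delta> ^ t"
    by (rule few_homs[OF fin AB E cov tA col])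
  \<comment> \<open>\<open>K powr \<epsilon> \<ge> x\<close> is the condition on \<open>K\<close> in
    \<open>almost_regular_subgraph\<close>.\<close>
  define x where "x = 2 * 3 powr (1 + \<epsilon>)"
  have x: "x > 0" by (simp add: x_def)
  define K where "K = nat \<lceil>x powr (1 / \<epsilon>)\<rceil>"
  have Kx: "x powr (1 / \<epsilon>) \<le> K" by (simp add: K_def)
  moreover have "x powr (1 / \<epsilon>) > 0" using x by simp
  ultimately have K: "real K > 0" by linarith
  have "x = (x powr (1 / \<epsilon>)) powr \<epsilon>" using x eps by (simp add: powr_powr)
  also have "\<dots> \<le> real K powr \<epsilon>" using Kx eps by (intro powr_mono2) auto
  finally have "3 powr (1 + \<epsilon>) * real K powr (- \<epsilon>) \<le> 1/2"
    using K by (simp add: x_def powr_minus field_simps)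
  note K = K this
  \<comment> \<open>One term for each case below: \<open>\<beta> \<le> 1\<close>, fewer than
    \<open>K\<close> vertices, and the density estimate.\<close>
  define C where "C = max 1 (max (2 ^ K) (D * (2 * K) ^ t * 4 ^ ?e))"
  have "card (edges G) \<le> C * card (verts G) powr (2 - c)"
    if G: "simple_graph G" "finite (verts G)" "verts G \<noteq> {}"
      and free: "\<not> contains_copy G (?V, {{a, b} | a b. (a, b) \<in> E})" for G :: "nat graph"
  proof -
    have "K > 0" using K by simp
    obtain \<beta> U where b0: "\<beta> \<ge> 0" and U: "U \<subseteq> verts G" "U \<noteq> {}"
      and eG: "card (edges G) \<le> \<beta> * card (verts G) powr (1 + \<epsilon>)"
      and eU: "card {e \<in> edges G. e \<subseteq> U} = \<beta> * card U powr (1 + \<epsilon>)"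
      and reg: "K \<le> card U \<longrightarrow> (\<exists>F\<subseteq>{e \<in> edges G. e \<subseteq> U}. \<beta> * card U powr (1 + \<epsilon>) \<le> 2 * real (card F) \<and>
        (\<forall>x. card {e \<in> F. x \<in> e} \<le> 2 * real K * \<beta> * card U powr \<epsilon>))"
      by (rule almost_regular_subgraph[OF G eps(1) \<open>K > 0\<close> K(2)])
    have finU: "finite U" using U G finite_subset by blast
    let ?m = "real (card U)"
    have m: "?m \<ge> 1" using finU U by (simp add: Suc_leI card_gt_0_iff)
    have "\<beta> \<le> C"
    proof (cases "card U < K")
      case True
      have "\<beta> * 1 \<le> \<beta> * ?m powr (1 + \<epsilon>)"
        using b0 m eps by (intro mult_left_mono ge_one_powr_ge_zero) auto
      also have "\<dots> = card {e \<in> edges G. e \<subseteq> U}" using eU by simp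
      also have "card {e \<in> edges G. e \<subseteq> U} \<le> card (Pow U)"
        using finU by (intro card_mono) auto
      also have "real (card (Pow U)) = 2 ^ card U" using finU by (simp add: card_Pow)
      also have "\<dots> \<le> 2 ^ K" using True by (intro power_increasing) auto
      finally show ?thesis by (simp add: C_def)
    next
      case False
      show ?thesis
      proof (cases "\<beta> \<le> 1")
        case True
        then show ?thesis by (simp add: C_def)
      next
        case b1: False
        obtain F where F: "F \<subseteq> {e \<in> edges G. e \<subseteq> U}" and eF: "\<beta> * ?m powr (1 + \<epsilon>) \<le> 2 * real (card F)"
          and dF: "\<And>x. card {e \<in> F. x \<in> e} \<le> 2 * real K * \<beta> * ?m powr \<epsilon>"
          using reg False by auto
        define \<Delta> where "\<Delta> = 2 * real K * \<beta> * ?m powr \<epsilon>"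
        have finF: "finite F" 
          by (rule finite_subset[of _ "Pow U"]) (use F finU in auto)
        have F2: "card e = 2" if "e \<in> F" for e using that F G by (auto simp: simple_graph_def)
        obtain S where S: "S \<subseteq> U" and cut: "card {e \<in> F. e \<subseteq> U} \<le> 2 * card {e \<in> F. e \<subseteq> U \<and> card (e \<inter> S) = 1}"
          using exists_large_cut[OF finU finF F2] by blast
        \<comment> \<open>Orienting the cut edges away from \<open>S\<close> makes domain and range
          disjoint.\<close>
        define R where "R = {(x, y). x \<in> S \<and> y \<in> U - S \<and> {x, y} \<in> F}"
        have RU: "R \<subseteq> U \<times> U" using S by (auto simp: R_def)
        then have finR: "finite R" using finU finite_subset by blast
        have "{e \<in> F. e \<subseteq> U \<and> card (e \<inter> S) = 1} \<subseteq> (\<lambda>(x, y). {x, y}) ` R"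
        proof
          fix e assume e: "e \<in> {e \<in> F. e \<subseteq> U \<and> card (e \<inter> S) = 1}"
          then obtain x where x: "e \<inter> S = {x}" by (auto simp: card_1_singleton_iff)
          have "card e = 2" using e F2 by auto
          moreover have "x \<in> e" using x by auto
          ultimately obtain y where y: "e = {x, y}" "x \<noteq> y" by (metis card_2_iff insertE insert_commute singletonD)
          then have "(x, y) \<in> R" using e x by (auto simp: R_def)
          then show "e \<in> (\<lambda>(x, y). {x, y}) ` R" using y by force
        qed
        then have "card {e \<in> F. e \<subseteq> U \<and> card (e \<inter> S) = 1} \<le> card R"
          using finR by (meson card_image_le card_mono finite_imageI le_trans)
        moreover have "{e \<in> F. e \<subseteq> U} = F" using F by auto
        ultimately have "card F \<le> 2 * card R" using cut by simp
        then have r: "\<beta> * ?m powr (1 + \<epsilon>) \<le> 4 * real (card R)" using eF by linarith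
        have "\<beta> * ?m powr (1 + \<epsilon>) > 0" using b1 m by simp
        then have "R \<noteq> {}" using r by auto
        have \<Delta>1: "\<Delta> \<ge> 1"
        proof -
          have "1 \<le> real K" using \<open>K > 0\<close> by simp
          moreover have "1 \<le> ?m powr \<epsilon>" using m eps by (intro ge_one_powr_ge_zero) auto
          ultimately have "1 * 1 * 1 * 1 \<le> 2 * real K * \<beta> * ?m powr \<epsilon>"
            using b1 by (intro mult_mono) auto
          then show ?thesis by (simp add: \<Delta>_def)
        qed
        have deg: "card (R `` {w}) \<le> \<Delta>" "card (R\<inverse> `` {w}) \<le> \<Delta>" for w
        proof -
          have "inj_on (\<lambda>y. {w, y}) Y" for Y by (auto simp: inj_on_def doubleton_eq_iff)
          moreover have "(\<lambda>y. {w, y}) ` (R `` {w}) \<subseteq> {e \<in> F. w \<in> e}" "(\<lambda>y. {w, y}) ` (R\<inverse> `` {w}) \<subseteq> {e \<in> F. w \<in> e}"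
            by (auto simp: R_def insert_commute)
          moreover have "finite {e \<in> F. w \<in> e}" using finF by simp
          ultimately have "card (R `` {w}) \<le> card {e \<in> F. w \<in> e}" "card (R\<inverse> `` {w}) \<le> card {e \<in> F. w \<in> e}"
            by (auto intro: card_inj_on_le)
          then show "card (R `` {w}) \<le> \<Delta>" "card (R\<inverse> `` {w}) \<le> \<Delta>"
            using dF[of w] unfolding \<Delta>_def by linarith+
        qed
        have host: "bounded_host U R \<Delta>"
          unfolding bounded_host_def using finU RU \<Delta>1 deg by (auto simp: R_def)
        have "\<not> inj_on \<phi> ?V" if "\<phi> \<in> homs ?V U R E" for \<phi>
        proof
          assume i: "inj_on \<phi> ?V"
          have "contains_copy G (?V, {{a, b} | a b. (a, b) \<in> E})"
            by (rule copy_of_hom[OF G(1) AB E that i U(1)]) (use F in \<open>auto simp: R_def\<close>)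
          then show False using free by simp
        qed
        then have "card (homs ?V U R E) \<le> D * ?m * \<Delta> ^ t" using few host by blast
        with sid[OF finU RU \<open>R \<noteq> {}\<close>]
        have "(card R / ?m\<^sup>2) ^ ?e * ?m ^ ?v \<le> D * ?m * (2 * real K * \<beta> * ?m powr \<epsilon>) ^ t"
          by (simp add: \<Delta>_def)
        moreover have "?v = card A + card B" using fin AB by (simp add: card_Un_disjoint)
        ultimately have "\<beta> \<le> D * (2 * real K) ^ t * 4 ^ ?e"
          using b1 m D K(1) r eps(2) c(2) et by (intro density_bound[of \<beta> ?m D "real K" \<epsilon> "card R" ?e ?v t c]) auto
        then show ?thesis by (simp add: C_def)
      qed
    qed
    then have "\<beta> * card (verts G) powr (1 + \<epsilon>) \<le> C * card (verts G) powr (1 + \<epsilon>)"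
      by (rule mult_right_mono) simp
    then show ?thesis using eG by (simp add: \<epsilon>_def)
  qed
  then show ?thesis using that by blast
qed

section \<open>Flags and reflections of a regular polytope\<close>

text \<open>The average of the vertices is a relative interior point that every isometry carries to
  the centre of the image. For the empty face it is the empty sum 0, without geometric meaning;
  hence the recurring exclusion of \<open>{}\<close>.\<close>

definition centre :: "'a::euclidean_space set \<Rightarrow> 'a" where
  "centre F = (\<Sum>x | x extreme_point_of F. (1 / card {x. x extreme_point_of F}) *\<^sub>R x)"

lemma centre_in_rel_interior:
  assumes "polytope F" "F \<noteq> {}"
  shows "centre F \<in> rel_interior F"
proof -
  let ?S = "{x. x extreme_point_of F}"
  have fin: "finite ?S" by (rule finite_polyhedron_extreme_points[OF polytope_imp_polyhedron[OF assms(1)]])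
  have F: "F = convex hull ?S"
    by (rule Krein_Milman_Minkowski) (use assms polytope_imp_compact polytope_imp_convex in auto)
  then have "?S \<noteq> {}" using assms(2) by auto
  then have "card ?S > 0" using fin by (simp add: card_gt_0_iff)
  then have "centre F \<in> {y. \<exists>u. (\<forall>x\<in>?S. 0 < u x) \<and> sum u ?S = 1 \<and> (\<Sum>x\<in>?S. u x *\<^sub>R x) = y}"
    unfolding centre_def by (intro CollectI exI[of _ "\<lambda>_. 1 / card ?S"]) auto
  then show ?thesis
    using explicit_subset_rel_interior_convex_hull_minimal[OF fin] F by auto
qed

lemma isometry_obtain:
  fixes f :: "'a::euclidean_space \<Rightarrow> 'a"
  assumes "\<And>x y. dist (f x) (f y) = dist x y"
  obtains g a where "linear g" "inj g" "f = (\<lambda>x. a + g x)"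
proof -
  define g where "g x = f x - f 0" for x
  have "dist (g x) (g y) = dist x y" for x y
    using assms[of x y] by (simp add: g_def dist_norm)
  then have "orthogonal_transformation g"
    unfolding orthogonal_transformation_isometry by (simp add: g_def)
  then have "linear g" "inj g"
    by (auto simp: orthogonal_transformation_def intro: orthogonal_transformation_inj)
  moreover have "f = (\<lambda>x. f 0 + g x)" by (simp add: g_def)
  ultimately show ?thesis using that by blast
qed

lemma isometry_affine_sum:
  fixes f :: "'a::euclidean_space \<Rightarrow> 'a"
  assumes "\<And>x y. dist (f x) (f y) = dist x y" "sum u S = 1"
  shows "f (\<Sum>i\<in>S. u i *\<^sub>R x i) = (\<Sum>i\<in>S. u i *\<^sub>R f (x i))"
proof -
  obtain g a where g: "linear g" and f: "f = (\<lambda>x. a + g x)" by (rule isometry_obtain[OF assms(1)])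
  have "(\<Sum>i\<in>S. u i *\<^sub>R f (x i)) = sum u S *\<^sub>R a + (\<Sum>i\<in>S. u i *\<^sub>R g (x i))"
    by (simp add: f scaleR_add_right sum.distrib scaleR_sum_left)
  then show ?thesis using assms(2) by (simp add: f linear_sum[OF g] linear_cmul[OF g])
qed

lemma isometry_image:
  fixes f :: "'a::euclidean_space \<Rightarrow> 'a"
  assumes "\<And>x y. dist (f x) (f y) = dist x y"
  shows "inj f" "f ` F face_of f ` P \<longleftrightarrow> F face_of P" "aff_dim (f ` F) = aff_dim F"
    "{x. x extreme_point_of f ` F} = f ` {x. x extreme_point_of F}"
proof -
  obtain g a where g: "linear g" "inj g" and f: "f = (\<lambda>x. a + g x)" by (rule isometry_obtain[OF assms])
  have im: "f ` S = (+) a ` g ` S" for S by (simp add: f image_image)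
  show inj: "inj f" using g(2) by (simp add: f inj_def)
  show face: "f ` F face_of f ` P \<longleftrightarrow> F face_of P" for F P
    by (simp add: im face_of_linear_image[OF g])
  show "aff_dim (f ` F) = aff_dim F"
    by (simp add: im aff_dim_translation_eq g aff_dim_injective_linear_image)
  have "f x extreme_point_of f ` F \<longleftrightarrow> x extreme_point_of F" for x
    using face[of "{x}" F] by (simp add: face_of_singleton)
  moreover have "x \<in> f ` F" if "x extreme_point_of f ` F" for x
    using that by (simp add: extreme_point_of_def)
  ultimately show "{x. x extreme_point_of f ` F} = f ` {x. x extreme_point_of F}" by fast
qed

lemma centre_isometry:
  fixes f :: "'a::euclidean_space \<Rightarrow> 'a"
  assumes f: "\<And>x y. dist (f x) (f y) = dist x y" and "polytope F" "F \<noteq> {}"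
  shows "centre (f ` F) = f (centre F)"
proof -
  let ?S = "{x. x extreme_point_of F}"
  have fin: "finite ?S" by (rule finite_polyhedron_extreme_points[OF polytope_imp_polyhedron[OF assms(2)]])
  have "F = convex hull ?S"
    by (rule Krein_Milman_Minkowski) (use assms polytope_imp_compact polytope_imp_convex in auto)
  then have "?S \<noteq> {}" using assms(3) by auto
  then have 1: "(\<Sum>x\<in>?S. 1 / real (card ?S)) = 1" using fin by simp
  have inj: "inj_on f ?S" using isometry_image(1)[OF f] by (auto simp: inj_on_def)
  have "centre (f ` F) = (\<Sum>x\<in>f ` ?S. (1 / card (f ` ?S)) *\<^sub>R x)"
    by (simp add: centre_def isometry_image(4)[OF f])
  also have "\<dots> = (\<Sum>x\<in>?S. (1 / card ?S) *\<^sub>R f x)"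
    by (simp add: sum.reindex[OF inj] card_image[OF inj])
  also have "\<dots> = f (centre F)"
    unfolding centre_def by (rule isometry_affine_sum[OF f 1, symmetric])
  finally show ?thesis .
qed

lemma symmetry_face:
  assumes "symmetry_of P f"
  shows "f ` F face_of P \<longleftrightarrow> F face_of P"
proof -
  have "f ` P = P" "\<And>x y. dist (f x) (f y) = dist x y" using assms by (auto simp: symmetry_of_def)
  then show ?thesis using isometry_image(2)[of f F P] by simp
qed

lemma symmetry_aff_dim:
  assumes "symmetry_of P f"
  shows "aff_dim (f ` F) = aff_dim F"
  by (rule isometry_image(3)) (use assms in \<open>simp add: symmetry_of_def\<close>)

lemma symmetry_centre:
  assumes "symmetry_of P f" "polytope P" "F face_of P" "F \<noteq> {}"
  shows "centre (f ` F) = f (centre F)"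
  by (rule centre_isometry[OF _ face_of_polytope_polytope[OF assms(2,3)] assms(4)])
    (use assms(1) in \<open>simp add: symmetry_of_def\<close>)

lemma faces_eq_of_subset:
  fixes P :: "'a::euclidean_space set"
  assumes "polytope P" "F face_of P" "G face_of P" "F \<subseteq> G" "aff_dim F = aff_dim G"
  shows "F = G"
proof (rule ccontr)
  assume "F \<noteq> G"
  moreover have "F face_of G" using assms face_of_face by blast
  ultimately have "aff_dim F < aff_dim G"
    using face_of_aff_dim_lt[OF face_of_imp_convex[OF assms(3)]] by blast
  then show False using assms(5) by simp
qed

text \<open>Different faces have disjoint relative interiors, so centres can stand for
  faces.\<close>

lemma centre_inj:
  assumes "polytope P" "F face_of P" "G face_of P" "F \<noteq> {}" "G \<noteq> {}" "centre F = centre G"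
  shows "F = G"
proof (rule face_of_eq[OF assms(2,3)])
  have "centre F \<in> rel_interior F" "centre G \<in> rel_interior G"
    using centre_in_rel_interior face_of_polytope_polytope[OF assms(1)] assms(2-5) by blast+
  then show "rel_interior F \<inter> rel_interior G \<noteq> {}" using assms(6) by auto
qed

section \<open>Flags of a polytope\<close>

lemma flag_iff:
  "flag P C \<longleftrightarrow> (\<forall>F\<in>C. F face_of P) \<and> (\<forall>F\<in>C. \<forall>G\<in>C. F \<subseteq> G \<or> G \<subseteq> F) \<and>
     (\<forall>F. F face_of P \<longrightarrow> (\<forall>G\<in>C. F \<subseteq> G \<or> G \<subseteq> F) \<longrightarrow> F \<in> C)" (is "_ \<longleftrightarrow> ?r")
proof -
  have ch: "subset.chain {F. F face_of P} D \<longleftrightarrow> (\<forall>F\<in>D. F face_of P) \<and> (\<forall>F\<in>D. \<forall>G\<in>D. F \<subseteq> G \<or> G \<subseteq> F)" for D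
    unfolding subset.chain_def by blast
  show ?thesis
  proof
    assume "flag P C"
    then have m: "subset.chain {F. F face_of P} C" "\<And>S. subset.chain {F. F face_of P} S \<Longrightarrow> C \<subset> S \<Longrightarrow> False"
      unfolding flag_def subset.maxchain_def by blast+
    have "F \<in> C" if F: "F face_of P" "\<forall>G\<in>C. F \<subseteq> G \<or> G \<subseteq> F" for F
    proof (rule ccontr)
      assume "F \<notin> C"
      moreover have "subset.chain {F. F face_of P} (insert F C)" using F m(1) unfolding ch by blast
      ultimately show False using m(2)[of "insert F C"] by blast
    qed
    then show ?r using m(1) unfolding ch by blast
  next
    assume r: ?r
    have "\<not> (subset.chain {F. F face_of P} S \<and> C \<subset> S)" for S
    proof
      assume S: "subset.chain {F. F face_of P} S \<and> C \<subset> S"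
      then obtain F where F: "F \<in> S" "F \<notin> C" by blast
      have "F face_of P" "\<forall>G\<in>C. F \<subseteq> G \<or> G \<subseteq> F" using S F(1) unfolding ch by blast+
      then show False using r F(2) by blast
    qed
    moreover have "subset.chain {F. F face_of P} C" using r unfolding ch by blast
    ultimately show "flag P C" unfolding flag_def subset.maxchain_def by blast
  qed
qed

lemma flag_extend:
  fixes P :: "'a::euclidean_space set"
  assumes "polytope P" "\<And>F. F \<in> C \<Longrightarrow> F face_of P" "\<And>F G. F \<in> C \<Longrightarrow> G \<in> C \<Longrightarrow> F \<subseteq> G \<or> G \<subseteq> F"
  obtains D where "flag P D" "C \<subseteq> D"
proof -
  let ?S = "{D. C \<subseteq> D \<and> (\<forall>F\<in>D. F face_of P) \<and> (\<forall>F\<in>D. \<forall>G\<in>D. F \<subseteq> G \<or> G \<subseteq> F)}"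
  have "?S \<subseteq> Pow {F. F face_of P}" by auto
  then have "finite ?S" using finite_polytope_faces[OF assms(1)] by (simp add: finite_subset)
  moreover have "C \<in> ?S"
    by (intro CollectI conjI ballI order_refl assms(2,3))
  then have "?S \<noteq> {}" by blast
  ultimately have "\<exists>D\<in>?S. \<forall>E\<in>?S. D \<le> E \<longrightarrow> D = E" by (rule finite_has_maximal)
  then obtain D where D: "D \<in> ?S" "\<forall>E\<in>?S. D \<le> E \<longrightarrow> D = E" ..
  have "F \<in> D" if F: "F face_of P" "\<forall>G\<in>D. F \<subseteq> G \<or> G \<subseteq> F" for F
  proof -
    have "insert F D \<in> ?S" using F D(1) by auto
    moreover have "D \<subseteq> insert F D" by blast
    ultimately have "D = insert F D" by (rule D(2)[rule_format])
    then show ?thesis by blast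
  qed
  then have "flag P D" using D(1) unfolding flag_iff by blast
  then show ?thesis using that D(1) by blast
qed

lemma flagD:
  assumes "flag P C"
  shows "F \<in> C \<Longrightarrow> F face_of P" "F \<in> C \<Longrightarrow> G \<in> C \<Longrightarrow> F \<subseteq> G \<or> G \<subseteq> F"
    "F face_of P \<Longrightarrow> (\<And>G. G \<in> C \<Longrightarrow> F \<subseteq> G \<or> G \<subseteq> F) \<Longrightarrow> F \<in> C"
  using assms unfolding flag_iff by blast+

lemma flag_empty: "flag P C \<Longrightarrow> {} \<in> C"
  by (rule flagD(3)) auto

lemma flag_top: "polytope P \<Longrightarrow> flag P C \<Longrightarrow> P \<in> C"
  by (rule flagD(3)) (auto simp: face_of_refl polytope_imp_convex dest: flagD(1) face_of_imp_subset)

lemma flag_finite: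
  fixes P :: "'a::euclidean_space set"
  shows "polytope P \<Longrightarrow> flag P C \<Longrightarrow> finite C"
  by (rule finite_subset[OF _ finite_polytope_faces]) (auto dest: flagD(1))

lemma flag_aff_dim_inj:
  fixes P :: "'a::euclidean_space set"
  assumes "polytope P" "flag P C" "F \<in> C" "G \<in> C" "aff_dim F = aff_dim G"
  shows "F = G"
proof -
  have f: "F face_of P" "G face_of P" using flagD(1)[OF assms(2)] assms(3,4) by blast+
  show ?thesis
    using flagD(2)[OF assms(2-4)] faces_eq_of_subset[OF assms(1) f] faces_eq_of_subset[OF assms(1) f(2,1)] assms(5)
    by argo
qed

lemma flag_least_above:
  fixes P :: "'a::euclidean_space set"
  assumes "polytope P" "flag P C" "F \<in> C" "F \<noteq> P"
  obtains G where "G \<in> C" "F \<subset> G" "\<forall>H\<in>C. F \<subset> H \<longrightarrow> G \<subseteq> H"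
proof -
  let ?S = "{G \<in> C. F \<subset> G}"
  have "P \<in> ?S" using flag_top[OF assms(1,2)] flagD(1)[OF assms(2,3)] assms(4) face_of_imp_subset by auto
  then have "\<exists>G\<in>?S. \<forall>H\<in>?S. H \<le> G \<longrightarrow> G = H"
    using flag_finite[OF assms(1,2)] by (intro finite_has_minimal) auto
  then obtain G where G: "G \<in> ?S" "\<forall>H\<in>?S. H \<le> G \<longrightarrow> G = H" ..
  then have "\<forall>H\<in>C. F \<subset> H \<longrightarrow> G \<subseteq> H" using flagD(2)[OF assms(2)] by blast
  then show ?thesis using that G by blast
qed

lemma flag_greatest_below:
  fixes P :: "'a::euclidean_space set"
  assumes "polytope P" "flag P C" "F \<in> C" "F \<noteq> {}"
  obtains G where "G \<in> C" "G \<subset> F" "\<forall>H\<in>C. H \<subset> F \<longrightarrow> H \<subseteq> G"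
proof -
  let ?S = "{G \<in> C. G \<subset> F}"
  have "{} \<in> ?S" using flag_empty[OF assms(2)] assms(4) by auto
  then have "\<exists>G\<in>?S. \<forall>H\<in>?S. G \<le> H \<longrightarrow> G = H"
    using flag_finite[OF assms(1,2)] by (intro finite_has_maximal) auto
  then obtain G where G: "G \<in> ?S" "\<forall>H\<in>?S. G \<le> H \<longrightarrow> G = H" ..
  then have "\<forall>H\<in>C. H \<subset> F \<longrightarrow> H \<subseteq> G" using flagD(2)[OF assms(2)] by blast
  then show ?thesis using that G by blast
qed

text \<open>A facet of \<open>G\<close> above \<open>F\<close> is comparable with every member of
  the flag, so it belongs to the flag by maximality, and nothing lies strictly between
  \<open>F\<close> and \<open>G\<close>.\<close>

lemma flag_consecutive_facet:
  fixes P :: "'a::euclidean_space set"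
  assumes P: "polytope P" "flag P C" and FG: "F \<in> C" "G \<in> C" "F \<noteq> {}" "F \<subset> G"
    and btw: "\<And>H. H \<in> C \<Longrightarrow> H \<subseteq> F \<or> G \<subseteq> H"
  shows "F facet_of G"
proof -
  have fP: "F face_of P" "G face_of P" using flagD(1)[OF P(2)] FG by auto
  then have "F face_of G" using FG face_of_face by blast
  moreover have "polyhedron G" using fP P polytope_imp_polyhedron face_of_polytope_polytope by blast
  ultimately obtain H where H: "H facet_of G" "F \<subseteq> H"
    using face_of_polyhedron_subset_facet FG by (metis psubset_eq)
  have HG: "H face_of G" "H \<noteq> G" using H(1) by (auto simp: facet_of_def)
  then have "H \<subseteq> G" using face_of_imp_subset by blast
  note HG = HG this
  have "H \<in> C"
  proof (rule flagD(3)[OF P(2)])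
    show "H face_of P" using HG fP face_of_trans by blast
    show "\<And>K. K \<in> C \<Longrightarrow> H \<subseteq> K \<or> K \<subseteq> H" using btw H HG by blast
  qed
  then have "H = F" using btw[of H] H(2) HG by blast
  then show ?thesis using H by simp
qed

text \<open>This provides a replacement for \<open>F\<close> between its neighbours
  \<open>G1\<close> and \<open>G2\<close>. If \<open>G1\<close> is nonempty, it is the intersection
  of the facets of \<open>G2\<close> above it, and \<open>F\<close> cannot be the only one. If
  \<open>G1\<close> is empty, a vertex of \<open>G2\<close> outside \<open>F\<close> serves.\<close>

lemma flag_diamond:
  fixes P :: "'a::euclidean_space set"
  assumes P: "polytope P" "flag P C" and F: "F \<in> C" "F \<noteq> {}" "F \<noteq> P"
  obtains F' where "F' face_of P" "\<forall>G\<in>C - {F}. F' \<subseteq> G \<or> G \<subseteq> F'" "\<not> F \<subseteq> F'" "\<not> F' \<subseteq> F"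
proof -
  obtain G2 where G2: "G2 \<in> C" "F \<subset> G2" "\<forall>H\<in>C. F \<subset> H \<longrightarrow> G2 \<subseteq> H"
    by (rule flag_least_above[OF P F(1,3)])
  obtain G1 where G1: "G1 \<in> C" "G1 \<subset> F" "\<forall>H\<in>C. H \<subset> F \<longrightarrow> H \<subseteq> G1"
    by (rule flag_greatest_below[OF P F(1,2)])
  have fP: "F face_of P" "G1 face_of P" "G2 face_of P" using flagD(1)[OF P(2)] F G1 G2 by auto
  have FG2: "F facet_of G2"
    by (rule flag_consecutive_facet[OF P F(1) G2(1) F(2) G2(2)]) (use G2 flagD(2)[OF P(2) F(1)] in blast)
  have pG2: "polytope G2" using fP P face_of_polytope_polytope by blast
  have comp: "\<forall>G\<in>C - {F}. F' \<subseteq> G \<or> G \<subseteq> F'" if "G1 \<subseteq> F'" "F' \<subseteq> G2" for F'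
    using that G1 G2 flagD(2)[OF P(2) F(1)] by blast
  show ?thesis
  proof (cases "G1 = {}")
    case False
    have "G1 \<subset> G2" using G1(2) G2(2) by (rule psubset_trans)
    then have "G1 face_of G2" using fP(2) face_of_face[OF fP(3)] by blast
    then have "G1 = \<Inter> {F. F facet_of G2 \<and> G1 \<subseteq> F}"
      by (intro face_of_polyhedron) (use polytope_imp_polyhedron[OF pG2] False \<open>G1 \<subset> G2\<close> in auto)
    moreover have "F \<in> {F. F facet_of G2 \<and> G1 \<subseteq> F}" using FG2 G1 by auto
    moreover have "G1 \<noteq> F" using G1 by auto
    ultimately obtain F' where F': "F' facet_of G2" "G1 \<subseteq> F'" "F' \<noteq> F" by blast
    have f: "F' face_of G2" "F face_of G2" "aff_dim F = aff_dim F'" using F' FG2 by (auto simp: facet_of_def)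
    then have "F' face_of P" using fP face_of_trans by blast
    then have "\<not> F \<subseteq> F'" "\<not> F' \<subseteq> F"
      using faces_eq_of_subset[OF P(1), of F F'] faces_eq_of_subset[OF P(1), of F' F] f(3) F'(3) fP(1) by metis+
    then show ?thesis using that \<open>F' face_of P\<close> comp[OF F'(2) face_of_imp_subset[OF f(1)]] by blast
  next
    case True
    have "G2 = convex hull {x. x extreme_point_of G2}"
      by (rule Krein_Milman_Minkowski) (use pG2 polytope_imp_compact polytope_imp_convex in auto)
    moreover have "convex F" using fP face_of_imp_convex P polytope_imp_convex by blast
    ultimately have "\<not> {x. x extreme_point_of G2} \<subseteq> F" using G2(2) by (metis hull_minimal psubset_eq subset_antisym)
    then obtain v where v: "v extreme_point_of G2" "v \<notin> F" by blast
    have "{v} face_of G2" using v face_of_singleton by blast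
    then have "{v} face_of P" using fP face_of_trans by blast
    moreover have "\<forall>G\<in>C - {F}. {v} \<subseteq> G \<or> G \<subseteq> {v}"
      using comp[of "{v}"] True face_of_imp_subset[OF \<open>{v} face_of G2\<close>] by blast
    moreover have "\<not> F \<subseteq> {v}" "\<not> {v} \<subseteq> F" using v F by auto
    ultimately show ?thesis using that by blast
  qed
qed

section \<open>Symmetries between adjacent flags act as reflections\<close>

definition wall :: "'a::euclidean_space set \<Rightarrow> 'a set set \<Rightarrow> 'a set \<Rightarrow> ('a \<Rightarrow> 'a) \<Rightarrow> bool" where
  "wall P C F \<sigma> \<longleftrightarrow> symmetry_of P \<sigma> \<and> (\<forall>G\<in>C - {F}. \<sigma> ` G = G) \<and> \<sigma> ` F \<noteq> F"

text \<open>Regularity gives a symmetry that maps \<open>C\<close> to a flag in which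
  \<open>F\<close> has been replaced. Symmetries preserve dimension and a flag has at most one face
  of each dimension, so all other faces are fixed.\<close>

lemma wall_exists:
  fixes P :: "'a::euclidean_space set"
  assumes reg: "regular_polytope P" and P: "flag P C" and F: "F \<in> C" "F \<noteq> {}" "F \<noteq> P"
  shows "\<exists>\<sigma>. wall P C F \<sigma>"
proof -
  have poly: "polytope P" using reg by (simp add: regular_polytope_def)
  obtain F' where F': "F' face_of P" "\<forall>G\<in>C - {F}. F' \<subseteq> G \<or> G \<subseteq> F'" "\<not> F \<subseteq> F'" "\<not> F' \<subseteq> F"
    by (rule flag_diamond[OF poly P F])
  obtain D where D: "flag P D" "insert F' (C - {F}) \<subseteq> D"
  proof (rule flag_extend[OF poly, of "insert F' (C - {F})"])
    show "\<And>G. G \<in> insert F' (C - {F}) \<Longrightarrow> G face_of P" using F'(1) flagD(1)[OF P] by blast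
    show "\<And>G H. G \<in> insert F' (C - {F}) \<Longrightarrow> H \<in> insert F' (C - {F}) \<Longrightarrow> G \<subseteq> H \<or> H \<subseteq> G"
      using F'(2) flagD(2)[OF P] by blast
  qed blast
  have FD: "F \<notin> D" using F' D flagD(2)[OF D(1)] by blast
  obtain \<sigma> where s: "symmetry_of P \<sigma>" "(\<lambda>F. \<sigma> ` F) ` C = D"
    using reg P D(1) unfolding regular_polytope_def by blast
  have "\<sigma> ` G = G" if "G \<in> C - {F}" for G
  proof (rule flag_aff_dim_inj[OF poly D(1)])
    show "\<sigma> ` G \<in> D" "G \<in> D" using s that D by auto
  qed (rule symmetry_aff_dim[OF s(1)])
  moreover have "\<sigma> ` F \<in> D" using s F by blast
  ultimately show ?thesis using s FD unfolding wall_def by metis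
qed

text \<open>Going up the flag, the centre of a face is not in the affine hull of the facet below it,
  so adding it raises the dimension to that of the face. As a consequence, a symmetry is determined
  on \<open>P\<close> by its values at the centres.\<close>

lemma flag_span:
  fixes P :: "'a::euclidean_space set"
  assumes P: "polytope P" "flag P C"
  shows "F \<in> C \<Longrightarrow> F \<subseteq> affine hull (centre ` (C - {{}}))"
proof (induction "card {G \<in> C. G \<subset> F}" arbitrary: F rule: less_induct)
  case less
  show ?case
  proof (cases "F = {}")
    case F: False
    obtain G where G: "G \<in> C" "G \<subset> F" "\<forall>H\<in>C. H \<subset> F \<longrightarrow> H \<subseteq> G"
      by (rule flag_greatest_below[OF P less.prems F])
    have fP: "F face_of P" "G face_of P" using flagD(1)[OF P(2)] less.prems G by auto
    have pF: "polytope F" using fP P face_of_polytope_polytope by blast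
    have cF: "centre F \<in> rel_interior F" by (rule centre_in_rel_interior[OF pF F])
    have cS: "centre F \<in> affine hull (centre ` (C - {{}}))" using less.prems F by (intro hull_inc) auto
    show ?thesis
    proof (cases "G = {}")
      \<comment> \<open>By maximality the lowest nonempty face of a flag is a vertex.\<close>
      case True
      have "F = convex hull {x. x extreme_point_of F}"
        by (rule Krein_Milman_Minkowski) (use pF polytope_imp_compact polytope_imp_convex in auto)
      then obtain x where x: "x extreme_point_of F" using F by fastforce
      then have xF: "{x} face_of F" using face_of_singleton by blast
      have "{x} \<in> C"
      proof (rule flagD(3)[OF P(2)])
        show "{x} face_of P" using xF fP face_of_trans by blast
        show "{x} \<subseteq> H \<or> H \<subseteq> {x}" if "H \<in> C" for H
          using flagD(2)[OF P(2) less.prems that] G(3) that True face_of_imp_subset[OF xF] by blast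
      qed
      then have "F = {x}" using G(3) True face_of_imp_subset[OF xF] by blast
      then show ?thesis using cF cS rel_interior_subset by fastforce
    next
      case False
      have fac: "G facet_of F"
        by (rule flag_consecutive_facet[OF P G(1) less.prems False G(2)])
          (use G(3) flagD(2)[OF P(2) less.prems] in blast)
      have "{H \<in> C. H \<subset> G} \<subset> {H \<in> C. H \<subset> F}" using G by blast
      then have "card {H \<in> C. H \<subset> G} < card {H \<in> C. H \<subset> F}"
        using flag_finite[OF P] by (intro psubset_card_mono) auto
      then have IH: "G \<subseteq> affine hull (centre ` (C - {{}}))" using less.hyps G(1) by blast
      have "affine hull G \<inter> rel_interior F = {}"
        by (rule affine_hull_face_of_disjoint_rel_interior)
          (use pF polytope_imp_convex facet_of_imp_face_of[OF fac] G(2) in auto)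
      then have "aff_dim (insert (centre F) G) = aff_dim F"
        using cF fac by (auto simp: aff_dim_insert facet_of_def)
      moreover have "insert (centre F) G \<subseteq> F" using G(2) cF rel_interior_subset by blast
      ultimately have "affine hull (insert (centre F) G) = affine hull F"
        by (intro affine_dim_equal) (auto simp: hull_mono)
      moreover have "affine hull (insert (centre F) G) \<subseteq> affine hull (centre ` (C - {{}}))"
        using IH cS by (intro hull_minimal) auto
      ultimately show ?thesis using hull_subset[of F affine] by blast
    qed
  qed simp
qed

text \<open>The quadratic terms cancel, so this is an affine function of \<open>z\<close>. Its zero
  set is the mirror, the perpendicular bisector of \<open>centre F\<close> and its image, and it is
  positive on the side of \<open>centre F\<close>.\<close>

definition side :: "('a::euclidean_space \<Rightarrow> 'a) \<Rightarrow> 'a set \<Rightarrow> 'a \<Rightarrow> real" where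
  "side \<sigma> F z = (dist z (\<sigma> (centre F)))\<^sup>2 - (dist z (centre F))\<^sup>2"

lemma dist_sq_diff:
  fixes c c' z :: "'a::euclidean_space"
  shows "(dist z c')\<^sup>2 - (dist z c)\<^sup>2 = 2 * (z \<bullet> (c - c')) + (c' \<bullet> c' - c \<bullet> c)"
  by (simp add: dist_norm power2_norm_eq_inner inner_diff_left inner_diff_right inner_commute)

lemma side_inner:
  "side \<sigma> F z = 2 * (z \<bullet> (centre F - \<sigma> (centre F))) + (\<sigma> (centre F) \<bullet> \<sigma> (centre F) - centre F \<bullet> centre F)"
  unfolding side_def by (rule dist_sq_diff)

lemma side_affine:
  assumes "sum u S = 1"
  shows "side \<sigma> F (\<Sum>i\<in>S. u i *\<^sub>R x i) = (\<Sum>i\<in>S. u i * side \<sigma> F (x i))"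
proof -
  let ?k = "\<sigma> (centre F) \<bullet> \<sigma> (centre F) - centre F \<bullet> centre F"
  have "(\<Sum>i\<in>S. u i * side \<sigma> F (x i)) = 2 * (\<Sum>i\<in>S. u i * (x i \<bullet> (centre F - \<sigma> (centre F)))) + sum u S * ?k"
    unfolding side_inner distrib_left sum.distrib sum_distrib_right sum_distrib_left
    by (intro arg_cong2[of _ _ _ _ "(+)"] sum.cong refl) simp
  then show ?thesis using assms by (simp add: side_inner inner_sum_left)
qed

text \<open>Subtracting that multiple of \<open>n\<close> is the reflection in the bisector of
  \<open>c\<close> and \<open>c'\<close>. The second identity shows that the reflection brings
  \<open>z\<close> closer to \<open>p\<close> exactly when the mirror strictly separates the
  two.\<close>

lemma reflect_dist:
  fixes c c' z p :: "'a::euclidean_space"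
  assumes "c \<noteq> c'"
  defines "n \<equiv> c - c'" and "s \<equiv> \<lambda>z. (dist z c')\<^sup>2 - (dist z c)\<^sup>2"
  shows "s (z - (s z / (n \<bullet> n)) *\<^sub>R n) = - s z"
    "(dist p (z - (s z / (n \<bullet> n)) *\<^sub>R n))\<^sup>2 - (dist p z)\<^sup>2 = s p * s z / (n \<bullet> n)"
proof -
  have n: "n \<bullet> n \<noteq> 0" using assms by simp
  define \<tau> where "\<tau> = s z / (n \<bullet> n)"
  have t: "\<tau> * (n \<bullet> n) = s z" using n by (simp add: \<tau>_def)
  have s: "s z = 2 * (z \<bullet> n) + (c' \<bullet> c' - c \<bullet> c)" for z unfolding s_def n_def by (rule dist_sq_diff)
  have "s (z - \<tau> *\<^sub>R n) = s z - 2 * (\<tau> * (n \<bullet> n))"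
    unfolding s by (simp add: inner_diff_left algebra_simps)
  then show "s (z - (s z / (n \<bullet> n)) *\<^sub>R n) = - s z" using t by (simp add: \<tau>_def)
  have "(dist p (z - \<tau> *\<^sub>R n))\<^sup>2 - (dist p z)\<^sup>2 = \<tau> * (2 * (p \<bullet> n) - 2 * (z \<bullet> n) + \<tau> * (n \<bullet> n))"
    by (simp add: dist_norm power2_norm_eq_inner inner_diff_left inner_diff_right inner_commute algebra_simps)
  also have "\<dots> = \<tau> * s p" unfolding t by (simp add: s)
  finally show "(dist p (z - (s z / (n \<bullet> n)) *\<^sub>R n))\<^sup>2 - (dist p z)\<^sup>2 = s p * s z / (n \<bullet> n)"
    by (simp add: \<tau>_def)
qed

lemma wall_centre_ne:
  assumes "polytope P" "flag P C" "F \<in> C" "F \<noteq> {}" "wall P C F \<sigma>"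
  shows "centre F \<noteq> \<sigma> (centre F)"
proof
  assume eq: "centre F = \<sigma> (centre F)"
  have s: "symmetry_of P \<sigma>" "\<sigma> ` F \<noteq> F" using assms(5) by (auto simp: wall_def)
  have f: "F face_of P" using flagD(1)[OF assms(2,3)] .
  have "centre (\<sigma> ` F) = centre F" using symmetry_centre[OF s(1) assms(1) f assms(4)] eq by simp
  then have "\<sigma> ` F = F"
    by (intro centre_inj[OF assms(1) _ f]) (use symmetry_face[OF s(1)] f assms(4) in auto)
  then show False using s by simp
qed

lemma side_centre_other:
  assumes "polytope P" "flag P C" "wall P C F \<sigma>" "G \<in> C - {F}" "G \<noteq> {}"
  shows "side \<sigma> F (centre G) = 0" "\<sigma> (centre G) = centre G"
proof -
  have s: "symmetry_of P \<sigma>" "\<sigma> ` G = G" using assms(3,4) by (auto simp: wall_def)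
  have f: "G face_of P" using flagD(1)[OF assms(2)] assms(4) by blast
  show c: "\<sigma> (centre G) = centre G" using symmetry_centre[OF s(1) assms(1) f assms(5)] s(2) by simp
  have "dist (\<sigma> (centre G)) (\<sigma> (centre F)) = dist (centre G) (centre F)"
    using s(1) by (simp add: symmetry_of_def)
  then show "side \<sigma> F (centre G) = 0" by (simp add: side_def c)
qed

lemma side_centre_self:
  assumes "polytope P" "flag P C" "F \<in> C" "F \<noteq> {}" "wall P C F \<sigma>"
  shows "side \<sigma> F (centre F) > 0"
  using wall_centre_ne[OF assms] by (simp add: side_def)

lemma flag_coordinates:
  assumes "polytope P" "flag P C" "z \<in> P"
  obtains u where "sum u (C - {{}}) = 1" "z = (\<Sum>F\<in>C - {{}}. u F *\<^sub>R centre F)"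
proof -
  let ?S = "centre ` (C - {{}})"
  have fin: "finite ?S" using flag_finite[OF assms(1,2)] by simp
  have "z \<in> affine hull ?S" using flag_span[OF assms(1,2) flag_top[OF assms(1,2)]] assms(3) by blast
  then obtain v where v: "sum v ?S = 1" "(\<Sum>x\<in>?S. v x *\<^sub>R x) = z"
    unfolding affine_hull_finite[OF fin] by blast
  have inj: "inj_on centre (C - {{}})"
    using centre_inj[OF assms(1)] flagD(1)[OF assms(2)] by (intro inj_onI) blast
  show ?thesis
    by (rule that[of "\<lambda>F. v (centre F)"]) (use v in \<open>simp_all add: sum.reindex[OF inj]\<close>)
qed

text \<open>Both sides are affine in \<open>z\<close>, so it is enough to compare them at the
  centres of the flag. All of these but \<open>centre F\<close> are fixed, hence equidistant from
  \<open>centre F\<close> and its image, hence on the mirror.\<close>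

lemma wall_reflection:
  assumes P: "polytope P" "flag P C" "F \<in> C" "F \<noteq> {}" and W: "wall P C F \<sigma>" and z: "z \<in> P"
  defines "n \<equiv> centre F - \<sigma> (centre F)"
  shows "\<sigma> z = z - (side \<sigma> F z / (n \<bullet> n)) *\<^sub>R n"
proof -
  have n: "n \<bullet> n \<noteq> 0" using wall_centre_ne[OF P W] by (simp add: n_def)
  have iso: "\<And>x y. dist (\<sigma> x) (\<sigma> y) = dist x y" using W by (simp add: wall_def symmetry_of_def)
  obtain u where u: "sum u (C - {{}}) = 1" "z = (\<Sum>G\<in>C - {{}}. u G *\<^sub>R centre G)"
    by (rule flag_coordinates[OF P(1,2) z])
  have c: "\<sigma> (centre G) = centre G - (side \<sigma> F (centre G) / (n \<bullet> n)) *\<^sub>R n" if "G \<in> C - {{}}" for G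
  proof (cases "G = F")
    case True
    have "side \<sigma> F (centre F) = n \<bullet> n"
      by (simp add: side_def dist_norm power2_norm_eq_inner n_def)
    then show ?thesis using n True by (simp add: n_def)
  next
    case False
    then show ?thesis using side_centre_other[OF P(1,2) W, of G] that by simp
  qed
  have "\<sigma> z = (\<Sum>G\<in>C - {{}}. u G *\<^sub>R \<sigma> (centre G))"
    unfolding u(2) by (rule isometry_affine_sum[OF iso u(1)])
  also have "\<dots> = (\<Sum>G\<in>C - {{}}. u G *\<^sub>R centre G - ((u G * side \<sigma> F (centre G)) / (n \<bullet> n)) *\<^sub>R n)"
    by (rule sum.cong[OF refl]) (simp add: c scaleR_diff_right)
  also have "\<dots> = z - (side \<sigma> F z / (n \<bullet> n)) *\<^sub>R n"
    unfolding sum_subtractf scaleR_sum_left[symmetric] sum_divide_distrib[symmetric]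
      side_affine[OF u(1), symmetric] u(2)[symmetric] ..
  finally show ?thesis .
qed

lemma wall_reflection_props:
  assumes P: "polytope P" "flag P C" "F \<in> C" "F \<noteq> {}" and W: "wall P C F \<sigma>" and z: "z \<in> P"
  shows "side \<sigma> F (\<sigma> z) = - side \<sigma> F z" "\<sigma> (\<sigma> z) = z" "side \<sigma> F z = 0 \<Longrightarrow> \<sigma> z = z"
    "\<exists>k>0. \<forall>p. (dist p (\<sigma> z))\<^sup>2 - (dist p z)\<^sup>2 = k * side \<sigma> F p * side \<sigma> F z"
proof -
  define n where "n = centre F - \<sigma> (centre F)"
  have ne: "centre F \<noteq> \<sigma> (centre F)" by (rule wall_centre_ne[OF P W])
  have "\<sigma> ` P = P" using W by (simp add: wall_def symmetry_of_def)
  then have sz: "\<sigma> z \<in> P" using z by blast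
  have r: "\<sigma> z = z - (side \<sigma> F z / (n \<bullet> n)) *\<^sub>R n" if "z \<in> P" for z
    unfolding n_def by (rule wall_reflection[OF P W that])
  show s: "side \<sigma> F (\<sigma> z) = - side \<sigma> F z"
    unfolding r[OF z] using reflect_dist(1)[OF ne, of z] by (simp add: side_def n_def)
  show "\<sigma> (\<sigma> z) = z" unfolding r[OF sz] s by (simp add: r[OF z])
  show "side \<sigma> F z = 0 \<Longrightarrow> \<sigma> z = z" by (simp add: r[OF z])
  have "(dist p (\<sigma> z))\<^sup>2 - (dist p z)\<^sup>2 = (1 / (n \<bullet> n)) * side \<sigma> F p * side \<sigma> F z" for p
    unfolding r[OF z] using reflect_dist(2)[OF ne, of p z] by (simp add: side_def n_def)
  moreover have "1 / (n \<bullet> n) > 0" using ne by (simp add: n_def)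
  ultimately show "\<exists>k>0. \<forall>p. (dist p (\<sigma> z))\<^sup>2 - (dist p z)\<^sup>2 = k * side \<sigma> F p * side \<sigma> F z" by blast
qed

text \<open>A point of the segment on the mirror lies in the relative interior of the larger face and is
  fixed, so the larger face is mapped to itself and its centre is on the mirror, too.\<close>

lemma side_incident:
  assumes P: "polytope P" "flag P C" "F \<in> C" "F \<noteq> {}" and W: "wall P C F \<sigma>"
    and D: "D face_of P" "D' face_of P" "D \<subseteq> D'" "D \<noteq> {}"
    and neg: "side \<sigma> F (centre D) * side \<sigma> F (centre D') < 0"
  shows False
proof -
  let ?a = "side \<sigma> F (centre D)" and ?b = "side \<sigma> F (centre D')"
  define t where "t = ?b / (?b - ?a)"
  have ab: "?a < 0 \<and> 0 < ?b \<or> 0 < ?a \<and> ?b < 0" using neg by (auto simp: mult_less_0_iff)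
  then have t: "0 < t" "t < 1" by (auto simp: t_def field_simps)
  have t0: "t * ?a + (1 - t) * ?b = 0" using ab by (auto simp: t_def field_simps)
  define x where "x = t *\<^sub>R centre D + (1 - t) *\<^sub>R centre D'"
  have "side \<sigma> F x = t * ?a + (1 - t) * ?b"
    unfolding x_def side_inner by (simp add: inner_add_left algebra_simps)
  then have x0: "side \<sigma> F x = 0" using t0 by simp
  have pD: "polytope D" "polytope D'" using face_of_polytope_polytope[OF P(1)] D by auto
  have c: "centre D \<in> D'" "centre D' \<in> rel_interior D'"
    using centre_in_rel_interior[OF pD(1) D(4)] centre_in_rel_interior[OF pD(2)] D(3,4) rel_interior_subset by blast+
  have "x = centre D - (1 - t) *\<^sub>R (centre D - centre D')" by (simp add: x_def algebra_simps)
  then have xr: "x \<in> rel_interior D'"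
    using rel_interior_convex_shrink[OF polytope_imp_convex[OF pD(2)] c(2,1)] t by simp
  then have xP: "x \<in> P" using rel_interior_subset face_of_imp_subset[OF D(2)] by blast
  have s: "symmetry_of P \<sigma>" using W by (simp add: wall_def)
  have fx: "\<sigma> x = x" by (rule wall_reflection_props(3)[OF P W xP x0])
  have "x \<in> D'" using xr rel_interior_subset by blast
  then have "x \<in> \<sigma> ` D'" using fx by (metis imageI)
  moreover have sf: "\<sigma> ` D' face_of P" using symmetry_face[OF s] D(2) by blast
  ultimately have "D' \<subseteq> \<sigma> ` D'"
    using subset_of_face_of[OF sf face_of_imp_subset[OF D(2)]] xr by blast
  then have "D' = \<sigma> ` D'"
    by (rule faces_eq_of_subset[OF P(1) D(2) sf]) (simp add: symmetry_aff_dim[OF s])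
  then have "centre D' = \<sigma> (centre D')"
    using symmetry_centre[OF s P(1) D(2)] D(3,4) by auto
  moreover have "centre D' \<in> P" using c(2) rel_interior_subset face_of_imp_subset[OF D(2)] by blast
  ultimately have "?b = 0" using wall_reflection_props(1)[OF P W] by fastforce
  then show False using neg by simp
qed

text \<open>\<open>F\<close> is the largest face of positive weight: the sum mixes its centre, a
  relative interior point, with other points of \<open>F\<close>.\<close>

lemma chain_combination_rel_interior:
  assumes "polytope P" "flag P C" "D \<subseteq> C - {{}}" "\<And>F. F \<in> D \<Longrightarrow> w F \<ge> 0" "sum w D = 1"
  obtains F where "F \<in> D" "(\<Sum>F\<in>D. w F *\<^sub>R centre F) \<in> rel_interior F"
proof -
  let ?D = "{F \<in> D. w F > 0}"
  have finD: "finite D" using assms(3) flag_finite[OF assms(1,2)] finite_subset by blast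
  have "?D \<noteq> {}"
  proof
    assume "?D = {}"
    then have "sum w D \<le> 0" by (intro sum_nonpos) force
    then show False using assms(5) by simp
  qed
  then have "\<exists>F\<in>?D. \<forall>G\<in>?D. F \<subseteq> G \<longrightarrow> F = G"
    using finD by (intro finite_has_maximal) auto
  then obtain F where F: "F \<in> D" "w F > 0" and max: "\<And>G. G \<in> ?D \<Longrightarrow> F \<subseteq> G \<Longrightarrow> F = G" by blast
  have sub: "G \<subseteq> F" if "G \<in> ?D" for G
    using flagD(2)[OF assms(2), of F G] max[OF that] that F assms(3) by blast
  have FC: "F \<in> C" "F \<noteq> {}" using F assms(3) by auto
  have pG: "polytope G" if "G \<in> C" for G
    using flagD(1)[OF assms(2) that] face_of_polytope_polytope[OF assms(1)] by blast
  have cF: "centre F \<in> rel_interior F" by (rule centre_in_rel_interior[OF pG[OF FC(1)] FC(2)])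
  have split: "sum f D = f F + sum f (D - {F})" for f :: "'a set \<Rightarrow> 'b::comm_monoid_add"
    using finD F(1) by (rule sum.remove)
  let ?a = "w F"
  let ?x = "\<Sum>F\<in>D. w F *\<^sub>R centre F"
  have rest: "sum w (D - {F}) = 1 - ?a" using split[of w] assms(5) by simp
  have restnn: "\<And>G. G \<in> D - {F} \<Longrightarrow> w G \<ge> 0" using assms(4) by blast
  have "0 \<le> sum w (D - {F})" by (rule sum_nonneg) (rule restnn)
  then have a1: "?a \<le> 1" using rest by simp
  have x: "?x = ?a *\<^sub>R centre F + (\<Sum>G\<in>D - {F}. w G *\<^sub>R centre G)" by (rule split)
  have "?x \<in> rel_interior F"
  proof (cases "?a = 1")
    case True
    then have "\<forall>G\<in>D - {F}. w G = 0"
      using sum_nonneg_eq_0_iff[of "D - {F}" w] rest restnn finD by auto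
    then have "?x = centre F" using x True by simp
    then show ?thesis using cF by simp
  next
    case False
    \<comment> \<open>Faces of weight 0 need not be contained in \<open>F\<close>, so their centres
      are replaced by that of \<open>F\<close>.\<close>
    let ?y = "\<Sum>G\<in>D - {F}. (w G / (1 - ?a)) *\<^sub>R (if w G = 0 then centre F else centre G)"
    have "?y \<in> F"
    proof (rule convex_sum)
      show "convex F" by (rule polytope_imp_convex[OF pG[OF FC(1)]])
      show "(\<Sum>G\<in>D - {F}. w G / (1 - ?a)) = 1" using rest False by (simp flip: sum_divide_distrib)
      show "(if w G = 0 then centre F else centre G) \<in> F" if G: "G \<in> D - {F}" for G
      proof (cases "w G = 0")
        case True
        then show ?thesis using cF rel_interior_subset by auto
      next
        case False
        then have "G \<in> ?D" using restnn[OF G] G by auto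
        then have "G \<subseteq> F" by (rule sub)
        moreover have "centre G \<in> G"
          using centre_in_rel_interior[OF pG, of G] G assms(3) rel_interior_subset by blast
        ultimately show ?thesis using False by auto
      qed
      show "0 \<le> w G / (1 - ?a)" if "G \<in> D - {F}" for G using restnn[OF that] a1 by simp
    qed (use finD in auto)
    moreover have "?x = ?y - ?a *\<^sub>R (?y - centre F)"
    proof -
      have "(1 - ?a) *\<^sub>R ?y = (\<Sum>G\<in>D - {F}. w G *\<^sub>R centre G)"
        unfolding scaleR_sum_right by (rule sum.cong) (use False in auto)
      then show ?thesis unfolding x by (simp add: algebra_simps)
    qed
    ultimately show ?thesis
      using rel_interior_convex_shrink[OF polytope_imp_convex[OF pG[OF FC(1)]] cF _ F(2) a1] by simp
  qed
  then show ?thesis using that F(1) by blast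
qed

text \<open>The barycentric coordinates of \<open>centre G\<close> with respect to the centres of a flag are
  nonnegative except perhaps the one at \<open>P\<close>. If that one were negative, then the segment from the
  centre of \<open>P\<close> to \<open>centre G\<close> would meet a proper face before its endpoint.\<close>

lemma flag_chamber:
  assumes P: "polytope P" "flag P C" and G: "G face_of P" "G \<noteq> {}"
    and W: "\<And>F. F \<in> C \<Longrightarrow> F \<noteq> {} \<Longrightarrow> F \<noteq> P \<Longrightarrow> \<exists>\<sigma>. wall P C F \<sigma> \<and> side \<sigma> F (centre G) \<ge> 0"
  shows "G \<in> C"
proof -
  let ?C = "C - {{}}"
  have finC: "finite ?C" using flag_finite[OF P] by simp
  have cG: "centre G \<in> rel_interior G"
    by (rule centre_in_rel_interior[OF face_of_polytope_polytope[OF P(1) G(1)] G(2)])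
  then have cGP: "centre G \<in> P" using rel_interior_subset face_of_imp_subset[OF G(1)] by blast
  then have Pne: "P \<noteq> {}" by auto
  then have PC: "P \<in> ?C" using flag_top[OF P] by simp
  obtain u where u: "sum u ?C = 1" "centre G = (\<Sum>F\<in>?C. u F *\<^sub>R centre F)"
    by (rule flag_coordinates[OF P cGP])
  \<comment> \<open>The side function of the wall at \<open>F\<close> vanishes at all other centres,
    so up to a positive factor it reads off the coordinate at \<open>F\<close>.\<close>
  have unn: "u F \<ge> 0" if F: "F \<in> ?C" "F \<noteq> P" for F
  proof -
    obtain \<sigma> where s: "wall P C F \<sigma>" "side \<sigma> F (centre G) \<ge> 0" using W F by blast
    have "side \<sigma> F (centre G) = (\<Sum>H\<in>?C. u H * side \<sigma> F (centre H))"
      unfolding u(2) by (rule side_affine[OF u(1)])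
    also have "\<dots> = u F * side \<sigma> F (centre F) + (\<Sum>H\<in>?C - {F}. u H * side \<sigma> F (centre H))"
      by (rule sum.remove[OF finC F(1)])
    also have "(\<Sum>H\<in>?C - {F}. u H * side \<sigma> F (centre H)) = 0"
      using side_centre_other(1)[OF P s(1)] by (intro sum.neutral) auto
    finally have "0 \<le> u F * side \<sigma> F (centre F)" using s(2) by simp
    moreover have "side \<sigma> F (centre F) > 0" using side_centre_self[OF P _ _ s(1)] F by blast
    ultimately show ?thesis by (simp add: zero_le_mult_iff)
  qed
  show ?thesis
  proof (cases "u P \<ge> 0")
    case True
    then have "\<And>F. F \<in> ?C \<Longrightarrow> u F \<ge> 0" using unn by blast
    then obtain F where F: "F \<in> ?C" "(\<Sum>F\<in>?C. u F *\<^sub>R centre F) \<in> rel_interior F"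
      using chain_combination_rel_interior[OF P order_refl _ u(1)] by blast
    then have "centre G \<in> rel_interior F" by (simp add: u(2))
    moreover have "F face_of P" using flagD(1)[OF P(2)] F by blast
    ultimately have "F = G" using face_of_eq[of F P G] G cG by blast
    then show ?thesis using F by blast
  next
    case False
    let ?D = "?C - {P}"
    define l where "l = 1 - u P"
    have l: "l > 1" using False by (simp add: l_def)
    have split: "sum f ?C = f P + sum f ?D" for f :: "'a set \<Rightarrow> 'b::comm_monoid_add"
      using finC PC by (rule sum.remove)
    have "sum u ?D = l" using split[of u] u(1) by (simp add: l_def)
    then have 1: "(\<Sum>F\<in>?D. u F / l) = 1" using l by (simp flip: sum_divide_distrib)
    have nn: "\<And>F. F \<in> ?D \<Longrightarrow> u F / l \<ge> 0" using unn l by simp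
    let ?y = "\<Sum>F\<in>?D. (u F / l) *\<^sub>R centre F"
    obtain F where F: "F \<in> ?D" "?y \<in> rel_interior F"
      by (rule chain_combination_rel_interior[OF P _ nn 1]) blast+
    have "l *\<^sub>R ?y = (\<Sum>F\<in>?D. u F *\<^sub>R centre F)" unfolding scaleR_sum_right using l by simp
    then have "centre G = u P *\<^sub>R centre P + l *\<^sub>R ?y"
      using split[of "\<lambda>F. u F *\<^sub>R centre F"] u(2) by simp
    then have "(1 / l) *\<^sub>R centre G = ((1 - l) / l) *\<^sub>R centre P + ?y"
      using l by (simp add: l_def scaleR_add_right)
    then have "?y = centre G - (1 - 1 / l) *\<^sub>R (centre G - centre P)"
      using l by (simp add: algebra_simps diff_divide_distrib)
    moreover have "centre P \<in> rel_interior P" by (rule centre_in_rel_interior[OF P(1) Pne])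
    ultimately have "?y \<in> rel_interior P"
      using rel_interior_convex_shrink[OF polytope_imp_convex[OF P(1)] _ cGP, of "centre P" "1 - 1 / l"] l by simp
    moreover have "F face_of P" "F \<noteq> P" using flagD(1)[OF P(2)] F by blast+
    moreover have "?y \<in> F" using F rel_interior_subset by blast
    ultimately show ?thesis using face_of_disjoint_rel_interior by blast
  qed
qed

section \<open>Folds of the incidence graph\<close>

text \<open>A point inside the chamber of the flag: it is strictly on the near side of each
  wall.\<close>

definition barycentre :: "'a::euclidean_space set set \<Rightarrow> 'a" where
  "barycentre C = (\<Sum>F\<in>C - {{}}. (1 / card (C - {{}})) *\<^sub>R centre F)"

lemma flag_face_props:
  fixes P :: "'a::euclidean_space set"
  assumes "polytope P" "F face_of P" "F \<noteq> {}"
  shows "centre F \<in> P" "centre F \<in> F" "F \<subseteq> P"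
proof -
  show "F \<subseteq> P" by (rule face_of_imp_subset[OF assms(2)])
  moreover show "centre F \<in> F"
    using centre_in_rel_interior[OF face_of_polytope_polytope[OF assms(1,2)] assms(3)] rel_interior_subset by blast
  ultimately show "centre F \<in> P" by blast
qed

lemma barycentre_weights:
  assumes "polytope P" "flag P C" "F \<in> C" "F \<noteq> {}"
  shows "card (C - {{}}) > 0" "(\<Sum>F\<in>C - {{}}. 1 / real (card (C - {{}}))) = 1"
proof -
  show c: "card (C - {{}}) > 0" using flag_finite[OF assms(1,2)] assms(3,4) by (auto simp: card_gt_0_iff)
  then show "(\<Sum>F\<in>C - {{}}. 1 / real (card (C - {{}}))) = 1" by simp
qed

lemma side_barycentre:
  assumes "polytope P" "flag P C" "F \<in> C" "F \<noteq> {}" "wall P C F \<sigma>"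
  shows "side \<sigma> F (barycentre C) > 0"
proof -
  let ?N = "1 / real (card (C - {{}}))"
  note w = barycentre_weights[OF assms(1-4)]
  have fin: "finite (C - {{}})" using flag_finite[OF assms(1,2)] by simp
  have "side \<sigma> F (barycentre C) = (\<Sum>G\<in>C - {{}}. ?N * side \<sigma> F (centre G))"
    unfolding barycentre_def by (rule side_affine[OF w(2)])
  also have "\<dots> = ?N * side \<sigma> F (centre F) + (\<Sum>G\<in>C - {{}} - {F}. ?N * side \<sigma> F (centre G))"
    by (rule sum.remove[OF fin]) (use assms in simp)
  also have "(\<Sum>G\<in>C - {{}} - {F}. ?N * side \<sigma> F (centre G)) = 0"
    using side_centre_other(1)[OF assms(1,2,5)] by (intro sum.neutral) auto
  finally show ?thesis using side_centre_self[OF assms] w(1) by simp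
qed

lemma barycentre_in:
  assumes "polytope P" "flag P C" "F \<in> C" "F \<noteq> {}"
  shows "barycentre C \<in> P"
  unfolding barycentre_def
  by (rule convex_sum)
    (use flag_finite[OF assms(1,2)] barycentre_weights[OF assms] polytope_imp_convex[OF assms(1)]
      flag_face_props(1)[OF assms(1)] flagD(1)[OF assms(2)] in auto)

lemma flag_image:
  assumes "symmetry_of P \<sigma>" "flag P C"
  shows "flag P ((\<lambda>F. \<sigma> ` F) ` C)"
proof -
  have inj: "inj \<sigma>" and im: "\<sigma> ` P = P"
    using isometry_image(1)[of \<sigma>] assms(1) by (auto simp: symmetry_of_def)
  have "F \<in> (\<lambda>F. \<sigma> ` F) ` C" if F: "F face_of P" "\<forall>G\<in>(\<lambda>F. \<sigma> ` F) ` C. F \<subseteq> G \<or> G \<subseteq> F" for F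
  proof -
    have "F \<subseteq> \<sigma> ` P" using face_of_imp_subset[OF F(1)] im by simp
    then obtain F' where F': "F = \<sigma> ` F'" by (auto simp: subset_image_iff)
    have "F' \<in> C"
    proof (rule flagD(3)[OF assms(2)])
      show "F' face_of P" using F(1) symmetry_face[OF assms(1)] F' by blast
      show "F' \<subseteq> G \<or> G \<subseteq> F'" if "G \<in> C" for G
        using F(2) that inj unfolding F' by (simp add: inj_image_subset_iff)
    qed
    then show ?thesis using F' by blast
  qed
  moreover have "\<forall>F\<in>(\<lambda>F. \<sigma> ` F) ` C. F face_of P"
    using flagD(1)[OF assms(2)] symmetry_face[OF assms(1)] by blast
  moreover have "\<forall>F\<in>(\<lambda>F. \<sigma> ` F) ` C. \<forall>G\<in>(\<lambda>F. \<sigma> ` F) ` C. F \<subseteq> G \<or> G \<subseteq> F"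
  proof (intro ballI, elim imageE)
    fix F G F' G' assume "F = \<sigma> ` F'" "F' \<in> C" "G = \<sigma> ` G'" "G' \<in> C"
    then show "F \<subseteq> G \<or> G \<subseteq> F" using flagD(2)[OF assms(2), of F' G'] by blast
  qed
  ultimately show ?thesis unfolding flag_iff by blast
qed

lemma barycentre_image:
  assumes "symmetry_of P \<sigma>" "polytope P" "flag P C" "F \<in> C" "F \<noteq> {}"
  shows "barycentre ((\<lambda>F. \<sigma> ` F) ` C) = \<sigma> (barycentre C)"
proof -
  let ?im = "\<lambda>F. \<sigma> ` F"
  have iso: "\<And>x y. dist (\<sigma> x) (\<sigma> y) = dist x y" using assms(1) by (simp add: symmetry_of_def)
  have inj: "inj_on ?im (C - {{}})"
    using isometry_image(1)[OF iso] by (auto simp: inj_on_def inj_image_eq_iff)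
  have eq: "?im ` C - {{}} = ?im ` (C - {{}})" by auto
  have "barycentre (?im ` C) = (\<Sum>F\<in>C - {{}}. (1 / card (C - {{}})) *\<^sub>R centre (\<sigma> ` F))"
    unfolding barycentre_def eq by (simp add: sum.reindex[OF inj] card_image[OF inj])
  also have "\<dots> = (\<Sum>F\<in>C - {{}}. (1 / card (C - {{}})) *\<^sub>R \<sigma> (centre F))"
    using symmetry_centre[OF assms(1,2)] flagD(1)[OF assms(3)] by (intro sum.cong) auto
  also have "\<dots> = \<sigma> (barycentre C)"
    unfolding barycentre_def by (rule isometry_affine_sum[OF iso barycentre_weights(2)[OF assms(2-5)], symmetric])
  finally show ?thesis .
qed

section \<open>The cuts that the mirrors induce on the incidence graph\<close>

definition half :: "'a::euclidean_space set set \<Rightarrow> ('a \<Rightarrow> 'a) \<Rightarrow> 'a set \<Rightarrow> 'a set set" where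
  "half V \<sigma> F = {G \<in> V. side \<sigma> F (centre G) \<ge> 0}"

definition incidences :: "'a::euclidean_space set \<Rightarrow> int \<Rightarrow> int \<Rightarrow> ('a set \<times> 'a set) set" where
  "incidences P k r = {(F, G). F \<in> faces_of_dim P k \<and> G \<in> faces_of_dim P r \<and> F \<subseteq> G}"

lemma symmetry_faces_of_dim:
  "symmetry_of P \<sigma> \<Longrightarrow> F \<in> faces_of_dim P k \<Longrightarrow> \<sigma> ` F \<in> faces_of_dim P k"
  by (simp add: faces_of_dim_def symmetry_face symmetry_aff_dim)

context
  fixes P :: "'a::euclidean_space set" and k r :: int and V E
  assumes reg: "regular_polytope P" and kr: "k < r"
    and ne: "{} \<notin> faces_of_dim P k" "{} \<notin> faces_of_dim P r"
  defines "V \<equiv> faces_of_dim P k \<union> faces_of_dim P r" and "E \<equiv> incidences P k r"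
begin

lemma poly: "polytope P"
  using reg by (simp add: regular_polytope_def)

lemma V_face: "F \<in> V \<Longrightarrow> F face_of P" "F \<in> V \<Longrightarrow> F \<noteq> {}"
  using ne by (auto simp: V_def faces_of_dim_def)

lemma finite_V: "finite V"
  using finite_polytope_faces[OF poly] by (rule finite_subset[rotated]) (auto dest: V_face(1))

text \<open>The reflection is an involution on \<open>P\<close> and changes the sign of
  \<open>side\<close>. A face with its centre on the mirror is fixed because the centre determines
  the face, and incident faces are never strictly separated, by
  \<open>side_incident\<close>.\<close>

lemma wall_cut:
  assumes C: "flag P C" "F \<in> C" "F \<noteq> {}" and W: "wall P C F \<sigma>"
  shows "cut V E (\<lambda>G. \<sigma> ` G) (half V \<sigma> F)"
proof -
  have s: "symmetry_of P \<sigma>" using W by (simp add: wall_def)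
  have inV: "\<sigma> ` G \<in> V" if "G \<in> V" for G
    using that symmetry_faces_of_dim[OF s] by (auto simp: V_def)
  have cP: "centre G \<in> P" if "G \<in> V" for G
    using flag_face_props(1)[OF poly] V_face that by blast
  have sd: "side \<sigma> F (centre (\<sigma> ` G)) = - side \<sigma> F (centre G)" if "G \<in> V" for G
    using symmetry_centre[OF s poly] V_face[OF that] wall_reflection_props(1)[OF poly C W cP[OF that]] by simp
  have inc: "0 \<le> side \<sigma> F (centre G) * side \<sigma> F (centre H)" if "(G, H) \<in> E" for G H
    using side_incident[OF poly C W, of G H] that V_face[of G] V_face[of H]
    by (force simp: E_def incidences_def V_def)
  show ?thesis
    unfolding cut_def
  proof (intro conjI ballI)
    show "half V \<sigma> F \<subseteq> V" by (auto simp: half_def)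
    show "E \<subseteq> V \<times> V" by (auto simp: E_def incidences_def V_def)
  next
    fix G assume G: "G \<in> V"
    show "\<sigma> ` G \<in> V" by (rule inV[OF G])
    have "\<sigma> (\<sigma> x) = x" if "x \<in> G" for x
      using wall_reflection_props(2)[OF poly C W] face_of_imp_subset[OF V_face(1)[OF G]] that by blast
    then show "\<sigma> ` \<sigma> ` G = G" by (simp add: image_image)
    show "G \<in> half V \<sigma> F \<or> \<sigma> ` G \<in> half V \<sigma> F"
      using G inV[OF G] sd[OF G] by (auto simp: half_def)
  next
    fix G assume "G \<in> half V \<sigma> F"
    then have G: "G \<in> V" "side \<sigma> F (centre G) \<ge> 0" by (auto simp: half_def)
    show "\<sigma> ` G \<in> half V \<sigma> F \<longrightarrow> \<sigma> ` G = G"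
    proof
      assume "\<sigma> ` G \<in> half V \<sigma> F"
      then have "side \<sigma> F (centre G) = 0" using sd[OF G(1)] G(2) by (simp add: half_def)
      then have "\<sigma> (centre G) = centre G" by (rule wall_reflection_props(3)[OF poly C W cP[OF G(1)]])
      then have "centre (\<sigma> ` G) = centre G" using symmetry_centre[OF s poly V_face[OF G(1)]] by simp
      then show "\<sigma> ` G = G"
        using centre_inj[OF poly V_face(1)[OF inV[OF G(1)]] V_face(1)[OF G(1)] V_face(2)[OF inV[OF G(1)]] V_face(2)[OF G(1)]]
        by blast
    qed
  next
    fix e assume e: "e \<in> E"
    obtain G H where GH: "e = (G, H)" by (cases e)
    have V: "G \<in> V" "H \<in> V" using e GH by (auto simp: E_def incidences_def V_def)
    have "(\<sigma> ` G, \<sigma> ` H) \<in> E"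
      using e GH symmetry_faces_of_dim[OF s] by (auto simp: E_def incidences_def)
    moreover have "G \<in> half V \<sigma> F \<and> H \<in> half V \<sigma> F \<or> \<sigma> ` G \<in> half V \<sigma> F \<and> \<sigma> ` H \<in> half V \<sigma> F"
      using inc[of G H] e GH V inV[OF V(1)] inV[OF V(2)] sd[OF V(1)] sd[OF V(2)]
      by (auto simp: half_def zero_le_mult_iff)
    ultimately show "case e of (G, H) \<Rightarrow> (\<sigma> ` G, \<sigma> ` H) \<in> E \<and>
        (G \<in> half V \<sigma> F \<and> H \<in> half V \<sigma> F \<or> \<sigma> ` G \<in> half V \<sigma> F \<and> \<sigma> ` H \<in> half V \<sigma> F)"
      using GH by simp
  qed
qed

text \<open>One fold for each wall of the flag, towards the flag. \<open>{}\<close> and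
  \<open>P\<close> are fixed by every symmetry, so they have no wall.\<close>

definition wall_folds :: "'a set set \<Rightarrow> ('a set \<Rightarrow> 'a \<Rightarrow> 'a) \<Rightarrow> (('a set \<Rightarrow> 'a set) \<times> 'a set set) set" where
  "wall_folds C \<tau> = (\<lambda>F. (\<lambda>G. \<tau> F ` G, half V (\<tau> F) F)) ` (C - {{}, P})"

text \<open>Folding towards a chamber decreases the distances to its barycentre.\<close>

lemma folds_into_flag:
  assumes C: "flag P C" and W: "\<And>F. F \<in> C - {{}, P} \<Longrightarrow> wall P C F (\<tau> F)"
  obtains \<Phi> where "fold_comp (wall_folds C \<tau>) \<Phi>" "\<forall>G\<in>V. \<Phi> G \<in> C"
proof -
  let ?K = "wall_folds C \<tau>"
  let ?p = "barycentre C"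
  have K: "cut V E \<sigma> Q" if "(\<sigma>, Q) \<in> ?K" for \<sigma> Q
    using that wall_cut[OF C] W by (auto simp: wall_folds_def)
  have inV: "\<Phi> G \<in> V" if "fold_comp ?K \<Phi>" "G \<in> V" for \<Phi> G
    by (rule fold_comp_in[OF that(1) K that(2)])
  \<comment> \<open>\<open>d\<close> depends only on the restriction to the finite set
    \<open>V\<close>, so it has a minimum over all composites. At a minimum no image is beyond a
    wall, and then \<open>flag_chamber\<close> puts all images into the flag.\<close>
  define d where "d f = (\<Sum>G\<in>V. (dist ?p (centre (f G)))\<^sup>2)" for f
  have "d \<Phi> = d (restrict \<Phi> V)" for \<Phi> by (simp add: d_def)
  then have "d ` {\<Phi>. fold_comp ?K \<Phi>} \<subseteq> d ` (V \<rightarrow>\<^sub>E V)" using inV by fastforce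
  then have fin: "finite (d ` {\<Phi>. fold_comp ?K \<Phi>})"
    using finite_V by (meson finite_PiE finite_imageI finite_subset)
  have nonempty: "d ` {\<Phi>. fold_comp ?K \<Phi>} \<noteq> {}" using fold_comp.id by blast
  obtain \<Phi> where \<Phi>: "fold_comp ?K \<Phi>" and "d \<Phi> = Min (d ` {\<Phi>. fold_comp ?K \<Phi>})"
    using Min_in[OF fin nonempty] by auto
  then have min: "d \<Phi> \<le> d \<Psi>" if "fold_comp ?K \<Psi>" for \<Psi>
    using Min_le[OF fin] that by simp
  have "\<Phi> G \<in> C" if G: "G \<in> V" for G
  proof (rule ccontr)
    assume "\<Phi> G \<notin> C"
    then obtain F where F: "F \<in> C - {{}, P}" and neg: "side (\<tau> F) F (centre (\<Phi> G)) < 0"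
      using flag_chamber[OF poly C V_face[OF inV[OF \<Phi> G]]] W by (metis DiffI insertE not_le singletonD)
    let ?f = "fold_map (\<lambda>G. \<tau> F ` G) (half V (\<tau> F) F)"
    have w: "wall P C F (\<tau> F)" by (rule W[OF F])
    have F': "F \<in> C" "F \<noteq> {}" using F by auto
    have s: "symmetry_of P (\<tau> F)" using w by (simp add: wall_def)
    have less: "(dist ?p (centre (?f H)))\<^sup>2 < (dist ?p (centre H))\<^sup>2"
      if H: "H \<in> V" "side (\<tau> F) F (centre H) < 0" for H
    proof -
      have "centre H \<in> P" using flag_face_props(1)[OF poly] V_face H(1) by blast
      then obtain \<kappa> where "\<kappa> > 0" "(dist ?p (\<tau> F (centre H)))\<^sup>2 - (dist ?p (centre H))\<^sup>2 =
          \<kappa> * side (\<tau> F) F ?p * side (\<tau> F) F (centre H)"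
        using wall_reflection_props(4)[OF poly C F' w] by blast
      moreover have "\<kappa> * side (\<tau> F) F ?p * side (\<tau> F) F (centre H) < 0"
        using side_barycentre[OF poly C F' w] H(2) \<open>\<kappa> > 0\<close> by (simp add: mult_pos_neg)
      moreover have "?f H = \<tau> F ` H" using H(2) by (simp add: fold_map_def half_def)
      ultimately show ?thesis using symmetry_centre[OF s poly V_face[OF H(1)]] by simp
    qed
    have le: "(dist ?p (centre (?f H)))\<^sup>2 \<le> (dist ?p (centre H))\<^sup>2" if "H \<in> V" for H
    proof (cases "side (\<tau> F) F (centre H) < 0")
      case True
      then show ?thesis by (rule less_imp_le[OF less[OF that]])
    next
      case False then show ?thesis using that by (simp add: fold_map_def half_def)
    qed
    have "d (?f \<circ> \<Phi>) < d \<Phi>"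
      unfolding d_def
      by (rule sum_strict_mono_ex1[OF finite_V]) (use le less[OF inV[OF \<Phi> G] neg] inV[OF \<Phi>] G in auto)
    moreover have "fold_comp ?K (?f \<circ> \<Phi>)"
      by (rule fold_comp.step[OF \<Phi>]) (use F in \<open>auto simp: wall_folds_def\<close>)
    ultimately show False using min by fastforce
  qed
  then show ?thesis using that \<Phi> by blast
qed

lemma folds_aff_dim:
  assumes C: "flag P C" and W: "\<And>F. F \<in> C - {{}, P} \<Longrightarrow> wall P C F (\<tau> F)"
    and "fold_comp (wall_folds C \<tau>) \<Phi>"
  shows "aff_dim (\<Phi> G) = aff_dim G"
  using assms(3)
proof induction
  case (step \<Phi> \<sigma> Q)
  have "aff_dim (\<sigma> H) = aff_dim H" for H
  proof -
    obtain F where F: "F \<in> C - {{}, P}" "\<sigma> = (\<lambda>G. \<tau> F ` G)" using step(2) by (auto simp: wall_folds_def)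
    then have "symmetry_of P (\<tau> F)" using W by (simp add: wall_def)
    then show ?thesis using F(2) symmetry_aff_dim by blast
  qed
  then show ?case using step.IH by (simp add: fold_map_def)
qed simp

lemma walls_exist:
  assumes "flag P C"
  obtains \<tau> where "\<forall>F\<in>C - {{}, P}. wall P C F (\<tau> F)"
proof -
  have "\<forall>F\<in>C - {{}, P}. \<exists>\<sigma>. wall P C F \<sigma>" using wall_exists[OF reg assms] by blast
  from bchoice[OF this] show ?thesis using that by blast
qed

text \<open>Folds preserve dimension. Folding into a flag through both ends of \<open>e\<close>
  therefore sends each face to the member of its own dimension, so each incidence to
  \<open>e\<close>, while the members of the flag stay on the near side of all walls.\<close>

lemma incidence_folds:
  assumes e: "e \<in> E"
  shows "\<exists>K \<Phi>. fold_comp K \<Phi> \<and> (\<forall>(a, b)\<in>E. (\<Phi> a, \<Phi> b) = e) \<and>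
       (\<forall>(\<sigma>, Q)\<in>K. cut V E \<sigma> Q \<and> fst e \<in> Q \<and> snd e \<in> Q)"
proof -
  obtain a b where ab: "e = (a, b)" by (cases e)
  have abV: "a \<in> faces_of_dim P k" "b \<in> faces_of_dim P r" "a \<subseteq> b" using e ab by (auto simp: E_def incidences_def)
  obtain C where C: "flag P C" "{a, b} \<subseteq> C"
    by (rule flag_extend[OF poly, of "{a, b}"]) (use abV in \<open>auto simp: faces_of_dim_def\<close>)
  obtain \<tau> where \<tau>: "\<forall>F\<in>C - {{}, P}. wall P C F (\<tau> F)" by (rule walls_exist[OF C(1)])
  then have W: "\<And>F. F \<in> C - {{}, P} \<Longrightarrow> wall P C F (\<tau> F)" by blast
  obtain \<Phi> where \<Phi>: "fold_comp (wall_folds C \<tau>) \<Phi>" "\<forall>G\<in>V. \<Phi> G \<in> C"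
    by (rule folds_into_flag[OF C(1) W])
  have "\<Phi> x = a \<and> \<Phi> y = b" if "(x, y) \<in> E" for x y
  proof -
    have xy: "x \<in> faces_of_dim P k" "y \<in> faces_of_dim P r" using that by (auto simp: E_def incidences_def)
    then have "aff_dim (\<Phi> x) = aff_dim a" "aff_dim (\<Phi> y) = aff_dim b"
      using folds_aff_dim[OF C(1) W \<Phi>(1)] abV by (auto simp: faces_of_dim_def)
    moreover have "\<Phi> x \<in> C" "\<Phi> y \<in> C" using \<Phi>(2) xy by (auto simp: V_def)
    ultimately show ?thesis using flag_aff_dim_inj[OF poly C(1)] C(2) by blast
  qed
  moreover have "cut V E \<sigma> Q \<and> a \<in> Q \<and> b \<in> Q" if "(\<sigma>, Q) \<in> wall_folds C \<tau>" for \<sigma> Q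
  proof -
    obtain F where F: "F \<in> C - {{}, P}" "\<sigma> = (\<lambda>G. \<tau> F ` G)" "Q = half V (\<tau> F) F"
      using \<open>(\<sigma>, Q) \<in> wall_folds C \<tau>\<close> by (auto simp: wall_folds_def)
    have "side (\<tau> F) F (centre G) \<ge> 0" if "G \<in> C" "G \<noteq> {}" for G
      using side_centre_other(1)[OF poly C(1) W[OF F(1)]] side_centre_self[OF poly C(1) _ _ W[OF F(1)]] F(1) that
      by (cases "G = F") auto
    then show ?thesis
      using wall_cut[OF C(1) _ _ W[OF F(1)]] F C(2) abV ne by (auto simp: half_def V_def)
  qed
  ultimately show ?thesis using \<Phi>(1) ab by (intro exI[of _ "wall_folds C \<tau>"] exI[of _ \<Phi>]) auto
qed

text \<open>Choose the flag through \<open>u\<close> whose barycentre is closest to the centre of \<open>v\<close>. The mirrors of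
  its walls other than the one at \<open>u\<close> have \<open>v\<close> on the near side, so the one at \<open>u\<close> separates
  \<open>u\<close> from \<open>v\<close>. Folding along it yields the condition that \<open>u\<close> and its mirror image agree, and this
  condition keeps meeting the far side of every wall of the flag, as required for further folds.\<close>

lemma incidence_part_collapses:
  assumes Z: "Z = faces_of_dim P j" "j = k \<or> j = r" and u: "u \<in> Z" and v: "v \<in> Z" and uv: "u \<noteq> v"
  shows "collapses V E Z {u, v}"
proof -
  have ZV: "Z \<subseteq> V" using Z by (auto simp: V_def)
  have uf: "u face_of P" "u \<noteq> {}" and vf: "v face_of P" "v \<noteq> {}" using V_face ZV u v by blast+
  have dims: "aff_dim u = aff_dim v" using u v Z(1) by (simp add: faces_of_dim_def)
  \<comment> \<open>\<open>P\<close> is the only face of its dimension, whereas \<open>u\<close> and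
    \<open>v\<close> share theirs.\<close>
  have uP: "u \<noteq> P" using faces_eq_of_subset[OF poly vf(1) uf(1)] face_of_imp_subset[OF vf(1)] dims uv by auto
  let ?S = "{C. flag P C \<and> u \<in> C}"
  have "?S \<subseteq> Pow {F. F face_of P}" using flagD(1) by blast
  then have finS: "finite ?S" using finite_polytope_faces[OF poly] by (simp add: finite_subset)
  obtain C0 where "flag P C0" "{u} \<subseteq> C0" by (rule flag_extend[OF poly, of "{u}"]) (use uf in auto)
  then have "?S \<noteq> {}" by blast
  then obtain C where "C \<in> ?S" and "\<And>D. D \<in> ?S \<Longrightarrow>
      - (dist (centre v) (barycentre D))\<^sup>2 \<le> - (dist (centre v) (barycentre C))\<^sup>2"
    by (rule finite_arg_max[OF finS, where f = "\<lambda>C. - (dist (centre v) (barycentre C))\<^sup>2"]) blast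
  then have C: "flag P C" and uC: "u \<in> C" and close: "\<And>D. flag P D \<Longrightarrow> u \<in> D \<Longrightarrow>
      (dist (centre v) (barycentre C))\<^sup>2 \<le> (dist (centre v) (barycentre D))\<^sup>2"
    by auto
  obtain \<tau> where \<tau>: "\<forall>F\<in>C - {{}, P}. wall P C F (\<tau> F)" by (rule walls_exist[OF C])
  then have W: "\<And>F. F \<in> C - {{}, P} \<Longrightarrow> wall P C F (\<tau> F)" by blast
  have cv: "centre v \<in> P" by (rule flag_face_props(1)[OF poly vf])
  have uw: "u \<in> C - {{}, P}" using uC uf uP by blast
  have pos: "side (\<tau> F) F (centre v) \<ge> 0" if F: "F \<in> C - {{}, P}" "F \<noteq> u" for F
  proof -
    have F': "F \<in> C" "F \<noteq> {}" using F by auto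
    have w: "wall P C F (\<tau> F)" by (rule W[OF F(1)])
    then have s: "symmetry_of P (\<tau> F)" and "\<tau> F ` u = u" using uC F(2) by (auto simp: wall_def)
    \<comment> \<open>The reflected flag still contains \<open>u\<close>, so it competes with
      \<open>C\<close>, and its barycentre is the mirror image of that of \<open>C\<close>.\<close>
    then have "flag P ((\<lambda>F'. \<tau> F ` F') ` C)" "u \<in> (\<lambda>F'. \<tau> F ` F') ` C"
      using flag_image[OF s C] uC by (auto simp: image_iff)
    then have "(dist (centre v) (barycentre C))\<^sup>2 \<le> (dist (centre v) (\<tau> F (barycentre C)))\<^sup>2"
      using close barycentre_image[OF s poly C uC uf(2)] by metis
    moreover obtain \<kappa> where "\<kappa> > 0" "(dist (centre v) (\<tau> F (barycentre C)))\<^sup>2 - (dist (centre v) (barycentre C))\<^sup>2 =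
        \<kappa> * side (\<tau> F) F (centre v) * side (\<tau> F) F (barycentre C)"
      using wall_reflection_props(4)[OF poly C F' w barycentre_in[OF poly C uC uf(2)]] by blast
    ultimately have "0 \<le> \<kappa> * side (\<tau> F) F (centre v) * side (\<tau> F) F (barycentre C)" "\<kappa> > 0" by linarith+
    then show ?thesis using side_barycentre[OF poly C F' w] by (simp add: zero_le_mult_iff)
  qed
  have neg: "side (\<tau> u) u (centre v) < 0"
  proof (rule ccontr)
    assume "\<not> ?thesis"
    then have "side (\<tau> F) F (centre v) \<ge> 0" if "F \<in> C - {{}, P}" for F
      using pos[OF that] by (cases "F = u") auto
    then have "v \<in> C" by (intro flag_chamber[OF poly C vf]) (use W in blast)
    then show False using flag_aff_dim_inj[OF poly C uC _ dims] uv by blast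
  qed
  have wu: "wall P C u (\<tau> u)" by (rule W[OF uw])
  let ?y = "\<tau> u ` u"
  let ?h = "half V (\<tau> u) u"
  have cut: "cut V E (\<lambda>G. \<tau> F ` G) (half V (\<tau> F) F)" if "F \<in> C - {{}, P}" for F
    by (rule wall_cut[OF C _ _ W[OF that]]) (use that in auto)
  have sideC: "side (\<tau> F) F (centre u) \<ge> 0" if "F \<in> C - {{}, P}" for F
    using side_centre_other(1)[OF poly C W[OF that]] side_centre_self[OF poly C _ _ W[OF that]] that uC uf
    by (cases "u = F") auto
  have uh: "u \<in> half V (\<tau> F) F" if "F \<in> C - {{}, P}" for F
    using sideC[OF that] ZV u by (auto simp: half_def)
  have yV: "?y \<in> V" and inv: "\<tau> u ` ?y = u" 
    using cutD(1,2)[OF cut[OF uw], of u] ZV u by blast+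
  have "\<tau> u ` v \<in> ?h"
    using cutD(3)[OF cut[OF uw], of v] ZV v neg by (simp add: half_def subset_iff)
  \<comment> \<open>\<open>\<tau> u\<close> fixes \<open>F\<close> and maps \<open>u\<close> to
    \<open>?y\<close>, so \<open>F\<close> and \<open>?y\<close> are incident and the mirror of
    \<open>F\<close> cannot separate them.\<close>
  have side_y: "side (\<tau> F) F (centre ?y) \<ge> 0" if F: "F \<in> C - {{}, P}" "F \<noteq> u" for F
  proof (rule ccontr)
    assume n: "\<not> ?thesis"
    have F': "F \<in> C" "F \<noteq> {}" using F by auto
    have "\<tau> u ` F = F" using wu F by (auto simp: wall_def)
    then have inc: "F \<subseteq> ?y \<or> ?y \<subseteq> F" using flagD(2)[OF C uC F'(1)] by (metis image_mono)
    have "side (\<tau> F) F (centre F) * side (\<tau> F) F (centre ?y) < 0"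
      using side_centre_self[OF poly C F' W[OF F(1)]] n by (simp add: mult_pos_neg)
    then show False
      using inc side_incident[OF poly C F' W[OF F(1)], of F ?y] side_incident[OF poly C F' W[OF F(1)], of ?y F]
        flagD(1)[OF C F'(1)] F'(2) V_face[OF yV] by (auto simp: mult.commute)
  qed
  obtain \<Phi> where \<Phi>: "fold_comp (wall_folds C \<tau>) \<Phi>" "\<forall>G\<in>V. \<Phi> G \<in> C"
    by (rule folds_into_flag[OF C W])
  have \<Phi>u: "\<Phi> a = u" if "a \<in> Z" for a
  proof (rule flag_aff_dim_inj[OF poly C _ uC])
    show "\<Phi> a \<in> C" using \<Phi>(2) that ZV by blast
    show "aff_dim (\<Phi> a) = aff_dim u"
      using folds_aff_dim[OF C W \<Phi>(1)] that u Z(1) by (simp add: faces_of_dim_def)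
  qed
  \<comment> \<open>\<open>v\<close> is beyond the mirror and only enters the discarded factor; what
    remains is the condition that \<open>u\<close> and its image \<open>?y\<close> agree.\<close>
  let ?B = "{a \<in> V. fold_map (\<lambda>G. \<tau> u ` G) ?h a \<in> {u, v}}"
  have uB: "u \<in> ?B" using ZV u uh[OF uw] by (auto simp: fold_map_def)
  have yB: "?y \<in> ?B"
  proof -
    have "?y \<in> ?h \<Longrightarrow> ?y = u" using cutD(4)[OF cut[OF uw] uh[OF uw]] by blast
    then show ?thesis using yV inv by (simp add: fold_map_def)
  qed
  have "collapses V E Z ?B"
  proof (rule collapses_fold_comp[OF \<Phi>(1), where x = u and y = ?y])
    fix \<sigma> Q assume "(\<sigma>, Q) \<in> wall_folds C \<tau>"
    then obtain F where F: "F \<in> C - {{}, P}" "\<sigma> = (\<lambda>G. \<tau> F ` G)" "Q = half V (\<tau> F) F"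
      by (auto simp: wall_folds_def)
    have "\<sigma> u = u \<and> ?y \<in> Q \<or> \<sigma> u = ?y"
    proof (cases "F = u")
      case False
      then have "\<tau> F ` u = u" using W[OF F(1)] uC by (auto simp: wall_def)
      then show ?thesis using F side_y[OF F(1) False] yV by (simp add: half_def)
    qed (use F in simp)
    then show "cut V E \<sigma> Q \<and> u \<in> Q \<and> (\<sigma> u = u \<and> ?y \<in> Q \<or> \<sigma> u = ?y)"
      using cut[OF F(1)] uh[OF F(1)] F by simp
  next
    \<comment> \<open>All of \<open>Z\<close> is folded to \<open>u\<close>, so the preimage of
      \<open>?B\<close> contains \<open>Z\<close>.\<close>
    show "collapses V E Z {a \<in> V. \<Phi> a \<in> ?B}"
      by (rule collapses_superset[OF finite_V]) (use \<Phi>u uB ZV in auto)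
  qed (use finite_V uB yB in auto)
  then show ?thesis
    by (rule collapses_fold[OF cut[OF uw] finite_V _ _ uh[OF uw] _ \<open>\<tau> u ` v \<in> ?h\<close>, rotated 3])
      (use ZV u v in auto)
qed

section \<open>Transitivity on faces and biregularity\<close>

lemma faces_transitive:
  assumes "F \<in> faces_of_dim P j" "F' \<in> faces_of_dim P j" "flag P C'" "F' \<in> C'"
  obtains \<sigma> C where "symmetry_of P \<sigma>" "flag P C" "F \<in> C" "(\<lambda>G. \<sigma> ` G) ` C = C'" "\<sigma> ` F = F'"
proof -
  obtain C where C: "flag P C" "{F} \<subseteq> C"
    by (rule flag_extend[OF poly, of "{F}"]) (use assms in \<open>auto simp: faces_of_dim_def\<close>)
  then obtain \<sigma> where s: "symmetry_of P \<sigma>" "(\<lambda>G. \<sigma> ` G) ` C = C'"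
    using reg assms(3) unfolding regular_polytope_def by blast
  have "\<sigma> ` F = F'"
    by (rule flag_aff_dim_inj[OF poly assms(3) _ assms(4)])
      (use s C assms(1,2) symmetry_aff_dim[OF s(1)] in \<open>auto simp: faces_of_dim_def\<close>)
  then show ?thesis using that s C by blast
qed

text \<open>By regularity: a symmetry that maps a flag through some \<open>j\<close>-face to
  \<open>C\<close> puts a \<open>j\<close>-face into \<open>C\<close>.\<close>

lemma flag_meets:
  assumes "flag P C" "faces_of_dim P j \<noteq> {}"
  obtains F where "F \<in> C" "F \<in> faces_of_dim P j"
proof -
  obtain G where G: "G \<in> faces_of_dim P j" using assms(2) by blast
  obtain D where D: "flag P D" "{G} \<subseteq> D"
    by (rule flag_extend[OF poly, of "{G}"]) (use G in \<open>auto simp: faces_of_dim_def\<close>)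
  then obtain \<sigma> where s: "symmetry_of P \<sigma>" "(\<lambda>G. \<sigma> ` G) ` D = C"
    using reg assms(1) unfolding regular_polytope_def by blast
  then have "\<sigma> ` G \<in> C" using D by blast
  then show ?thesis using that symmetry_faces_of_dim[OF s(1) G] by blast
qed

lemma flag_incidence:
  assumes "flag P C" "F \<in> C" "G \<in> C" "F \<in> faces_of_dim P k" "G \<in> faces_of_dim P r"
  shows "(F, G) \<in> E"
proof -
  have "\<not> G \<subseteq> F" using aff_dim_subset[of G F] assms(4,5) kr by (auto simp: faces_of_dim_def)
  then show ?thesis using flagD(2)[OF assms(1-3)] assms(4,5) by (auto simp: E_def incidences_def)
qed

lemma incidences_cover:
  assumes "faces_of_dim P k \<noteq> {}" "faces_of_dim P r \<noteq> {}"
  shows "fst ` E = faces_of_dim P k" "snd ` E = faces_of_dim P r"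
proof -
  have "F \<in> fst ` E" if F: "F \<in> faces_of_dim P k" for F
  proof -
    obtain C where C: "flag P C" "{F} \<subseteq> C"
      by (rule flag_extend[OF poly, of "{F}"]) (use F in \<open>auto simp: faces_of_dim_def\<close>)
    obtain G where "G \<in> C" "G \<in> faces_of_dim P r" by (rule flag_meets[OF C(1) assms(2)])
    then show ?thesis using flag_incidence[OF C(1)] C(2) F by force
  qed
  moreover have "G \<in> snd ` E" if G: "G \<in> faces_of_dim P r" for G
  proof -
    obtain C where C: "flag P C" "{G} \<subseteq> C"
      by (rule flag_extend[OF poly, of "{G}"]) (use G in \<open>auto simp: faces_of_dim_def\<close>)
    obtain F where "F \<in> C" "F \<in> faces_of_dim P k" by (rule flag_meets[OF C(1) assms(1)])
    then show ?thesis using flag_incidence[OF C(1)] C(2) G by force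
  qed
  moreover have "fst ` E \<subseteq> faces_of_dim P k" "snd ` E \<subseteq> faces_of_dim P r"
    by (auto simp: E_def incidences_def)
  ultimately show "fst ` E = faces_of_dim P k" "snd ` E = faces_of_dim P r" by blast+
qed

lemma symmetry_exists:
  assumes "F \<in> faces_of_dim P j" "F' \<in> faces_of_dim P j"
  shows "\<exists>\<sigma>. symmetry_of P \<sigma> \<and> \<sigma> ` F = F'"
proof -
  obtain C' where C': "flag P C'" "{F'} \<subseteq> C'"
    by (rule flag_extend[OF poly, of "{F'}"]) (use assms in \<open>auto simp: faces_of_dim_def\<close>)
  then show ?thesis using faces_transitive[OF assms C'(1)] by (metis insert_subset)
qed

lemma finite_faces_of_dim: "finite (faces_of_dim P j)"
  by (rule finite_subset[OF _ finite_polytope_faces[OF poly]]) (auto simp: faces_of_dim_def)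

lemma degree_le:
  assumes "symmetry_of P \<sigma>"
  shows "card {G. (F, G) \<in> E} \<le> card {G. (\<sigma> ` F, G) \<in> E}" "card {G. (G, F) \<in> E} \<le> card {G. (G, \<sigma> ` F) \<in> E}"
proof -
  have "inj \<sigma>" using isometry_image(1)[of \<sigma>] assms by (simp add: symmetry_of_def)
  then have inj: "inj_on (\<lambda>G. \<sigma> ` G) S" for S by (auto simp: inj_on_def inj_image_eq_iff)
  have im: "(\<sigma> ` F, \<sigma> ` G) \<in> E" if "(F, G) \<in> E" for F G
    using that symmetry_faces_of_dim[OF assms] by (auto simp: E_def incidences_def)
  have fin: "finite {G. (F, G) \<in> E}" "finite {G. (G, F) \<in> E}" for F
    by (rule finite_subset[OF _ finite_V]; auto simp: E_def incidences_def V_def)+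
  show "card {G. (F, G) \<in> E} \<le> card {G. (\<sigma> ` F, G) \<in> E}"
    by (rule card_inj_on_le[OF inj _ fin(1)]) (use im in auto)
  show "card {G. (G, F) \<in> E} \<le> card {G. (G, \<sigma> ` F) \<in> E}"
    by (rule card_inj_on_le[OF inj _ fin(2)]) (use im in auto)
qed

text \<open>Symmetries are transitive on the faces of each dimension, so degrees are constant on
  both parts. Divisibility by the larger part size \<open>t\<close> turns \<open>card E > t\<close>
  into \<open>card E \<ge> 2 * t\<close>, from which \<open>c < 1\<close> is derived.\<close>

lemma incidences_regular:
  assumes "faces_of_dim P k \<noteq> {}" "faces_of_dim P r \<noteq> {}"
  obtains d1 d2 where "card E = card (faces_of_dim P k) * d1" "card E = card (faces_of_dim P r) * d2"
proof -
  obtain F0 G0 where F0: "F0 \<in> faces_of_dim P k" and G0: "G0 \<in> faces_of_dim P r" using assms by blast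
  have d1: "card {G. (F, G) \<in> E} = card {G. (F0, G) \<in> E}" if "F \<in> faces_of_dim P k" for F
    using symmetry_exists[OF F0 that] symmetry_exists[OF that F0] degree_le(1) by (metis le_antisym)
  have d2: "card {F. (F, G) \<in> E} = card {F. (F, G0) \<in> E}" if "G \<in> faces_of_dim P r" for G
    using symmetry_exists[OF G0 that] symmetry_exists[OF that G0] degree_le(2) by (metis le_antisym)
  have fin: "finite {G. (F, G) \<in> E}" "finite {G. (G, F) \<in> E}" for F
    by (rule finite_subset[OF _ finite_V]; auto simp: E_def incidences_def V_def)+
  have "E = (SIGMA F:faces_of_dim P k. {G. (F, G) \<in> E})" by (auto simp: E_def incidences_def)
  then have "card E = card (SIGMA F:faces_of_dim P k. {G. (F, G) \<in> E})" by (rule arg_cong)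
  also have "\<dots> = (\<Sum>F\<in>faces_of_dim P k. card {G. (F, G) \<in> E})"
    by (rule card_SigmaI) (use fin finite_faces_of_dim in blast)+
  finally have "card E = (\<Sum>F\<in>faces_of_dim P k. card {G. (F, G) \<in> E})" .
  then have 1: "card E = card (faces_of_dim P k) * card {G. (F0, G) \<in> E}" using d1 by simp
  have "E\<inverse> = (SIGMA G:faces_of_dim P r. {F. (F, G) \<in> E})" by (auto simp: E_def incidences_def)
  then have "card (E\<inverse>) = card (SIGMA G:faces_of_dim P r. {F. (F, G) \<in> E})" by (rule arg_cong)
  also have "\<dots> = (\<Sum>G\<in>faces_of_dim P r. card {F. (F, G) \<in> E})"
    by (rule card_SigmaI) (use fin finite_faces_of_dim in blast)+
  finally have "card (E\<inverse>) = (\<Sum>G\<in>faces_of_dim P r. card {F. (F, G) \<in> E})" .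
  then have "card E = card (faces_of_dim P r) * card {F. (F, G0) \<in> E}" using d2 by simp
  then show ?thesis using that 1 by blast
qed

end

section \<open>The extremal number\<close>

lemma card_edges_le:
  assumes "simple_graph G" "finite (verts G)"
  shows "card (edges G) \<le> (card (verts G))\<^sup>2"
proof -
  have "edges G \<subseteq> (\<lambda>(x, y). {x, y}) ` (verts G \<times> verts G)"
  proof
    fix e assume "e \<in> edges G"
    then have "e \<subseteq> verts G" "card e = 2" using assms(1) by (auto simp: simple_graph_def)
    then obtain x y where "e = {x, y}" "x \<in> verts G" "y \<in> verts G" by (auto simp: card_2_iff)
    then show "e \<in> (\<lambda>(x, y). {x, y}) ` (verts G \<times> verts G)" by force
  qed
  then have "card (edges G) \<le> card (verts G \<times> verts G)"
    using assms(2) by (meson card_image_le card_mono finite_SigmaI finite_imageI le_trans)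
  then show ?thesis by (simp add: power2_eq_square card_cartesian_product)
qed

lemma ex_attained:
  fixes H :: "'a graph"
  assumes "edges H \<noteq> {}"
  obtains G :: "nat graph" where "simple_graph G" "finite (verts G)" "card (verts G) = n"
    "\<not> contains_copy G H" "ex n H = card (edges G)"
proof -
  let ?S = "{card (edges G) | G :: nat graph.
     simple_graph G \<and> finite (verts G) \<and> card (verts G) = n \<and> \<not> contains_copy G H}"
  have "?S \<subseteq> {..n\<^sup>2}" using card_edges_le by auto
  then have fin: "finite ?S" using finite_subset by blast
  let ?G = "({0..<n}, {}) :: nat graph"
  have "\<not> contains_copy ?G H"
    using assms by (auto simp: contains_copy_def subgraph_of_def isomorphic_graphs_def)
  then have "card (edges ?G) \<in> ?S" by (intro CollectI exI[of _ ?G]) (simp add: simple_graph_def)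
  then have "ex n H \<in> ?S" unfolding ex_def using Max_in[OF fin] by blast
  then show ?thesis using that by blast
qed

lemma incidence_graph_eq:
  "incidence_graph P k r = (faces_of_dim P k \<union> faces_of_dim P r, {{a, b} | a b. (a, b) \<in> incidences P k r})"
  by (auto simp: incidence_graph_def incidences_def)

text \<open>The dimensions of its ends recover the orientation of an edge.\<close>

lemma card_incidence_graph_edges:
  assumes "k < r"
  shows "card (edges (incidence_graph P k r)) = card (incidences P k r)"
proof -
  have "edges (incidence_graph P k r) = (\<lambda>(a, b). {a, b}) ` incidences P k r"
    by (force simp: incidence_graph_eq)
  moreover have "inj_on (\<lambda>(a, b). {a, b}) (incidences P k r)"
    using assms by (auto simp: inj_on_def incidences_def faces_of_dim_def doubleton_eq_iff)
  ultimately show ?thesis by (simp add: card_image)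
qed

theorem theorem1p2:
  fixes P :: "'a::euclidean_space set" and k r :: int
    and H :: "'a set graph" and t :: nat and c :: real
  assumes "regular_polytope P"
    and "k < r"
    and "faces_of_dim P k \<noteq> {}"
    and "faces_of_dim P r \<noteq> {}"
    and "H = incidence_graph P k r"
    and "t = max (card (faces_of_dim P k)) (card (faces_of_dim P r))"
    and "c = (real (card (verts H)) - real t - 1) / (real (card (edges H)) - real t)"
  shows "(\<lambda>n. real (ex n H)) \<in> O(\<lambda>n. real n powr (2 - c))"
proof -
  let ?A = "faces_of_dim P k" and ?B = "faces_of_dim P r" and ?E = "incidences P k r"
  have poly: "polytope P" using assms(1) by (simp add: regular_polytope_def)
  have fin: "finite ?A" "finite ?B" 
    by (rule finite_subset[OF _ finite_polytope_faces[OF poly]]; auto simp: faces_of_dim_def)+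
  have AB: "?A \<inter> ?B = {}" using assms(2) by (auto simp: faces_of_dim_def)
  have EAB: "?E \<subseteq> ?A \<times> ?B" by (auto simp: incidences_def)
  have H: "H = (?A \<union> ?B, {{a, b} | a b. (a, b) \<in> ?E})" using assms(5) incidence_graph_eq by simp
  have vH: "card (verts H) = card ?A + card ?B" using fin AB by (simp add: H card_Un_disjoint)
  have eH: "card (edges H) = card ?E" using card_incidence_graph_edges[OF assms(2)] assms(5) by simp
  have pos: "card ?A > 0" "card ?B > 0" using fin assms(3,4) by (simp_all add: card_gt_0_iff)
  have kA: "k \<ge> -1" using assms(3) aff_dim_geq by (force simp: faces_of_dim_def)
  have emptyB: "{} \<notin> ?B" using kA assms(2) by (auto simp: faces_of_dim_def)
  have cover: "fst ` ?E = ?A" "snd ` ?E = ?B" if "{} \<notin> ?A"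
    using incidences_cover[OF assms(1,2) that emptyB assms(3,4)] .
  have "?E \<noteq> {}"
  proof (cases "{} \<in> ?A")
    case True
    then show ?thesis using assms(4) by (auto simp: incidences_def)
  next
    case False
    then show ?thesis using cover(1) assms(3) by auto
  qed
  then have eHne: "edges H \<noteq> {}" by (auto simp: H)
  have "\<exists>C. \<forall>n\<ge>1. real (ex n H) \<le> C * real n powr (2 - c)"
  \<comment> \<open>Here the trivial bound \<open>n\<^sup>2\<close> suffices. The case includes
    \<open>e(H) = t\<close>, where division by zero gives \<open>c = 0\<close>.\<close>
  proof (cases "c \<le> 0")
    case True
    have "real (ex n H) \<le> 1 * real n powr (2 - c)" if "n \<ge> 1" for n
    proof -
      obtain G :: "nat graph" where G: "simple_graph G" "finite (verts G)" "card (verts G) = n" "ex n H = card (edges G)"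
        by (rule ex_attained[OF eHne])
      have "real (ex n H) \<le> real n powr 2"
        using card_edges_le[OF G(1,2)] G(3,4) that by (simp add: powr_numeral flip: of_nat_power)
      also have "\<dots> \<le> real n powr (2 - c)" using that True by (intro powr_mono) auto
      finally show ?thesis by simp
    qed
    then show ?thesis by blast
  next
    case c0: False
    \<comment> \<open>The numerator of \<open>c\<close> is \<open>s - 1\<close>, as
      \<open>v(H) - t\<close> is the size of the smaller part. Being nonnegative, it must be
      positive together with the denominator when \<open>c > 0\<close>.\<close>
    define s where "s = min (card ?A) (card ?B)"
    have c_eq: "c = (real s - 1) / (real (card ?E) - real t)"
      unfolding assms(7) vH eH assms(6) s_def by (simp add: min_def max_def)
    have num: "real s - 1 \<ge> 0" using pos by (simp add: s_def)
    have et: "real t < real (card ?E)" and s2: "real s > 1"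
      using c0 num unfolding c_eq by (auto simp: divide_le_0_iff not_le)
    \<comment> \<open>The empty face is alone in its dimension, so it would force
      \<open>s = 1\<close>.\<close>
    have "{} \<notin> ?A"
    proof
      assume "{} \<in> ?A"
      then have "k = -1" by (simp add: faces_of_dim_def)
      then have "?A \<subseteq> {{}}" by (auto simp: faces_of_dim_def aff_dim_empty[symmetric])
      then have "card ?A \<le> card {{} :: 'a set}" by (intro card_mono) auto
      then show False using s2 by (simp add: s_def)
    qed
    note ctx = assms(1,2) this emptyB
    obtain d1 d2 where d: "card ?E = card ?A * d1" "card ?E = card ?B * d2"
      by (rule incidences_regular[OF ctx assms(3,4)])
    \<comment> \<open>A multiple of \<open>t\<close> that exceeds \<open>t\<close> is at least
      \<open>2 * t\<close>, so the denominator of \<open>c\<close> is at least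
      \<open>t \<ge> s > s - 1\<close>.\<close>
    have "\<exists>d. card ?E = t * d" using d assms(6) by (metis max_def)
    then obtain d where d: "card ?E = t * d" ..
    have "t < card ?E" using et by simp
    then have "d \<noteq> 0" "d \<noteq> 1" unfolding d by (auto intro: gr0I)
    then have "2 \<le> d" by simp
    then have "real t * 2 \<le> real t * real d" by (intro mult_left_mono) auto
    then have "real t * 2 \<le> real (card ?E)" by (simp add: d)
    moreover have "real s \<le> real t" using assms(6) by (simp add: s_def)
    ultimately have "real s - 1 < 1 * (real (card ?E) - real t)" by argo
    then have c1: "c < 1" unfolding c_eq using et by (simp add: pos_divide_less_eq)
    have c_mult: "c * (real (card ?E) - real t) = real (card ?A + card ?B) - real t - 1"
      unfolding assms(7) vH eH using et by simp
    have sid: "(card R / (card X)\<^sup>2) ^ card ?E * real (card X) ^ card (?A \<union> ?B) \<le> card (homs (?A \<union> ?B) X R ?E)"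
      if "finite X" "R \<subseteq> X \<times> X" "R \<noteq> {}" for X :: "nat set" and R
    proof (rule homs_Sidorenko[OF _ that(1) that(2,3) EAB AB order_refl \<open>?E \<noteq> {}\<close>])
      show "finite (?A \<union> ?B)" using fin by simp
    qed (rule incidence_folds[OF ctx])
    obtain C where C: "\<And>G :: nat graph. simple_graph G \<Longrightarrow> finite (verts G) \<Longrightarrow> verts G \<noteq> {} \<Longrightarrow>
       \<not> contains_copy G H \<Longrightarrow> card (edges G) \<le> C * card (verts G) powr (2 - c)"
    proof (rule turan_upper[OF fin AB EAB cover[OF ctx(3)] assms(6) _ _ sid c1 c_mult])
      show "collapses (?A \<union> ?B) ?E ?A {u, v}" if "u \<in> ?A" "v \<in> ?A" "u \<noteq> v" for u v
        by (rule incidence_part_collapses[OF ctx refl _ that]) simp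
      show "collapses (?A \<union> ?B) ?E ?B {u, v}" if "u \<in> ?B" "v \<in> ?B" "u \<noteq> v" for u v
        by (rule incidence_part_collapses[OF ctx refl _ that]) simp
      show "t < card ?E" using et by simp
    qed (unfold H, blast+)
    have "real (ex n H) \<le> C * real n powr (2 - c)" if "n \<ge> 1" for n
    proof -
      obtain G :: "nat graph" where G: "simple_graph G" "finite (verts G)" "card (verts G) = n"
        "\<not> contains_copy G H" "ex n H = card (edges G)"
        by (rule ex_attained[OF eHne])
      then show ?thesis using C[OF G(1,2) _ G(4)] that by fastforce
    qed
    then show ?thesis by blast
  qed
  then obtain C where C: "\<forall>n\<ge>1. real (ex n H) \<le> C * real n powr (2 - c)" ..
  show ?thesis
    by (rule bigoI[of _ C]) (use C in \<open>auto intro!: eventually_sequentiallyI[of 1]\<close>)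
qed

end
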